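(* In any vertical plane $\Lambda$ there are infinitely many geometrically distinct symmetric figure eight periodic orbits of the fixed homogeneous circle problem, such that their essential parts are embeddings.
   Context: $\mathcal C=\{(x,y,0)\in\mathbb R^3: x^2+y^2=1\}$ is the unit circle in the $xy$-plane centered at the origin, with constant mass density $\lambda>0$. Its potential is $V(\mathbf r)=-\int_{\mathcal C}\frac{\lambda\,du}{\|\mathbf r-u\|}$ for $\mathbf r\in\mathbb R^3\setminus\mathcal C$ ($du$ is arc length). The fixed homogeneous circle problem is the differential equation $\ddot{\mathbf r}=-\nabla V(\mathbf r)$ in $\mathbb R^3\setminus\mathcal C$. A vertical plane is a plane $\Lambda$ containing the $z$-axis; vertical planes are invariant under the dynamics. By a rotation about the $z$-axis identify $\Lambda$ with the $xz$-plane, with coordinates $(x,z)$; then $\mathcal C\cap\Lambda=\{(\pm1,0)\}$. Essential part: an orbit $\mathbf r(t)=(x(t),z(t))$, $t\in[0,\tau]$, $\tau>0$, of the problem in $\Lambda$ is an essential part of a symmetric figure eight orbit if (1) $z(0)=0$ and $x(0)>1$; (2) $\mathbf r(\tau)=(0,0)$; (3) $\dot x(0)=0$; (4) $z(t)>0$ for $t\in(0,\tau)$. Let $\varphi_1(x,z)=(-x,z)$ and $\varphi_2(x,z)=(x,-z)$. The corresponding symmetric figure eight periodic orbit is the $4\tau$-periodic orbit $\bar{\mathbf r}:\mathbb R\to\Lambda$ of the problem given, for $n\in\mathbb Z$, by $\bar{\mathbf r}(t)=\mathbf r(t-4n\tau)$ on $[4n\tau,(4n+1)\tau]$; $\varphi_1\varphi_2\mathbf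 r((4n+2)\tau-t)$ on $[(4n+1)\tau,(4n+2)\tau]$; $\varphi_1\mathbf r(t-(4n+2)\tau)$ on $[(4n+2)\tau,(4n+3)\tau]$; $\varphi_2\mathbf r(4n\tau-t)$ on $[(4n-1)\tau,4n\tau]$. The orbit $\mathbf r:[0,\tau]\to\Lambda$ is called its essential part. Orbits are geometrically distinct if their traces (images) are different. *)

theory Defs
  imports "HOL-Analysis.Analysis"
begin

definition unit_circle :: "(real^3) set" where
  "unit_circle = {u. (u$1)\<^sup>2 + (u$2)\<^sup>2 = 1 \<and> u$3 = 0}"

text \<open>The arc-length integral over the circle is written in the unit-speed parametrisation
  \<open>\<theta> \<mapsto> (cos \<theta>, sin \<theta>, 0)\<close>, for which \<open>du = d\<theta>\<close>.\<close>

definition circle_potential :: "real \<Rightarrow> real^3 \<Rightarrow> real" where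
  "circle_potential lam r =
     - integral {0..2*pi} (\<lambda>\<theta>. lam / norm (r - vector [cos \<theta>, sin \<theta>, 0]))"

text \<open>A solution on \<open>T\<close> of \<open>r'' = - \<nabla>V(r)\<close>; at the end points of an interval \<open>T\<close> the time
  derivatives are one-sided. The existence of the gradient is part of the condition.\<close>

definition circle_orbit :: "real \<Rightarrow> real set \<Rightarrow> (real \<Rightarrow> real^3) \<Rightarrow> bool" where
  "circle_orbit lam T r \<longleftrightarrow>
     (\<forall>t\<in>T. r t \<notin> unit_circle) \<and>
     (\<exists>v. \<forall>t\<in>T. (r has_vector_derivative v t) (at t within T) \<and>
        (\<exists>g. GDERIV (circle_potential lam) (r t) :> g \<and>
             (v has_vector_derivative (- g)) (at t within T)))"

definition z_axis :: "(real^3) set" where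
  "z_axis = {u. u$1 = 0 \<and> u$2 = 0}"

definition vertical_plane :: "(real^3) set \<Rightarrow> bool" where
  "vertical_plane \<Lambda> \<longleftrightarrow> affine \<Lambda> \<and> aff_dim \<Lambda> = 2 \<and> z_axis \<subseteq> \<Lambda>"

definition rotation_z :: "real \<Rightarrow> real^3 \<Rightarrow> real^3" where
  "rotation_z \<phi> u =
     vector [cos \<phi> * u$1 - sin \<phi> * u$2, sin \<phi> * u$1 + cos \<phi> * u$2, u$3]"

text \<open>Coordinates \<open>(x, z)\<close> on the vertical plane obtained from the \<open>xz\<close>-plane by rotation
  through the angle \<open>\<phi>\<close>.\<close>

definition plane_point :: "real \<Rightarrow> real \<times> real \<Rightarrow> real^3" where
  "plane_point \<phi> p = rotation_z \<phi> (vector [fst p, 0, snd p])"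

definition refl1 :: "real \<times> real \<Rightarrow> real \<times> real" where
  "refl1 p = (- fst p, snd p)"

definition refl2 :: "real \<times> real \<Rightarrow> real \<times> real" where
  "refl2 p = (fst p, - snd p)"

text \<open>Planar curves are given in the coordinates \<open>(x, z)\<close>; only the values of \<open>r\<close> on
  \<open>{0..\<tau>}\<close> are relevant.\<close>

definition essential_part :: "real \<Rightarrow> real \<Rightarrow> real \<Rightarrow> (real \<Rightarrow> real \<times> real) \<Rightarrow> bool" where
  "essential_part lam \<phi> \<tau> r \<longleftrightarrow>
     \<tau> > 0 \<and>
     circle_orbit lam {0..\<tau>} (plane_point \<phi> \<circ> r) \<and>
     snd (r 0) = 0 \<and> fst (r 0) > 1 \<and>
     r \<tau> = (0, 0) \<and>
     ((\<lambda>t. fst (r t)) has_real_derivative 0) (at 0 within {0..\<tau>}) \<and>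
     (\<forall>t\<in>{0<..<\<tau>}. snd (r t) > 0)"

definition figure_eight_extension ::
    "real \<Rightarrow> (real \<Rightarrow> real \<times> real) \<Rightarrow> (real \<Rightarrow> real \<times> real) \<Rightarrow> bool" where
  "figure_eight_extension \<tau> r \<rho> \<longleftrightarrow>
     (\<forall>n::int.
        (\<forall>t\<in>{4 * of_int n * \<tau> .. (4 * of_int n + 1) * \<tau>}.
            \<rho> t = r (t - 4 * of_int n * \<tau>)) \<and>
        (\<forall>t\<in>{(4 * of_int n + 1) * \<tau> .. (4 * of_int n + 2) * \<tau>}.
            \<rho> t = refl1 (refl2 (r ((4 * of_int n + 2) * \<tau> - t)))) \<and>
        (\<forall>t\<in>{(4 * of_int n + 2) * \<tau> .. (4 * of_int n + 3) * \<tau>}.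
            \<rho> t = refl1 (r (t - (4 * of_int n + 2) * \<tau>))) \<and>
        (\<forall>t\<in>{(4 * of_int n - 1) * \<tau> .. 4 * of_int n * \<tau>}.
            \<rho> t = refl2 (r (4 * of_int n * \<tau> - t))))"

text \<open>\<open>R\<close> is the symmetric figure eight periodic orbit in the vertical plane \<open>\<Lambda>\<close> whose
  essential part is \<open>r\<close> on \<open>{0..\<tau>}\<close>, where \<open>\<Lambda>\<close> is identified with the \<open>xz\<close>-plane by the
  rotation through \<open>\<phi>\<close>.\<close>

definition symmetric_figure_eight ::
    "real \<Rightarrow> (real^3) set \<Rightarrow> real \<Rightarrow> real \<Rightarrow> (real \<Rightarrow> real \<times> real) \<Rightarrow> (real \<Rightarrow> real^3) \<Rightarrow> bool" where
  "symmetric_figure_eight lam \<Lambda> \<phi> \<tau> r R \<longleftrightarrow>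
     range (plane_point \<phi>) = \<Lambda> \<and>
     essential_part lam \<phi> \<tau> r \<and>
     (\<exists>\<rho>. figure_eight_extension \<tau> r \<rho> \<and> R = plane_point \<phi> \<circ> \<rho>) \<and>
     circle_orbit lam UNIV R \<and>
     (\<forall>t. R (t + 4 * \<tau>) = R t)"

text \<open>Embedding in the differentiable sense: a topological embedding that is also a \<open>C\<^sup>1\<close>
  immersion. (Orbits are automatically smooth, because the potential is smooth off the circle.)\<close>

definition embedded_arc :: "(real^3) set \<Rightarrow> real \<Rightarrow> (real \<Rightarrow> real^3) \<Rightarrow> bool" where
  "embedded_arc \<Lambda> \<tau> c \<longleftrightarrow>
     embedding_map (top_of_set {0..\<tau>}) (top_of_set \<Lambda>) c \<and>
     (\<exists>c'. continuous_on {0..\<tau>} c' \<and>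
        (\<forall>t\<in>{0..\<tau>}. (c has_vector_derivative c' t) (at t within {0..\<tau>}) \<and> c' t \<noteq> 0))"

end

theory Submission
  imports Defs
begin

text \<open>
  Let \<open>D(\<theta>)\<close> be the distance from \<open>(x, z)\<close> to the point of the circle at angle \<open>\<theta>\<close>. The acceleration
  in the vertical plane is \<open>(m - q x, - q z)\<close>, where \<open>q\<close> and \<open>m\<close> are the integrals of \<open>lam / D\<^sup>3\<close> and
  \<open>lam cos \<theta> / D\<^sup>3\<close>. This is the sum of two attractions, towards \<open>(1, 0)\<close> with weight
  \<open>(q + m) / 2\<close> and towards \<open>(- 1, 0)\<close> with weight \<open>(q - m) / 2\<close>; both weights are positive and the
  nearer point has the larger one. Three facts about an orbit launched upwards from \<open>(x0, 0)\<close>,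
  \<open>x0 > 1\<close>, follow for as long as \<open>z > 0\<close>. The height is concave. The angular momentum about
  \<open>(1, 0)\<close> grows, because only the other attraction has a moment; so the orbit turns strictly
  monotonically about \<open>(1, 0)\<close>, which makes it injective, keeps it (by conservation of energy) away
  from \<open>(1, 0)\<close>, and lets it return to \<open>z = 0\<close> only with \<open>x < 1\<close>. Finally the angular momentum about the
  centre is nonincreasing where \<open>x \<ge> 0\<close> and nondecreasing where \<open>x \<le> 0\<close>, so an orbit that has gone over
  to \<open>x < 0\<close> cannot be back at \<open>x = 0\<close> before its return to \<open>z = 0\<close>, nor at that moment.

  The orbits are found by shooting. For fixed large \<open>x0\<close> let the orbit start vertically with speed
  \<open>v\<close>, and let \<open>h v\<close> be the abscissa of its first return to \<open>z = 0\<close>. At the speed with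
  \<open>v\<^sup>2 = lam / x0\<close>, comparable to the speed of a circular orbit, the orbit stays
  far from the circle, retains a positive angular momentum about the centre and passes over it:
  \<open>h v < 0\<close> (lemma \<open>x_end_neg_if_fast\<close>). For small \<open>v\<close> it drops almost straight onto the circle,
  whose pull near the circle is so strong that the orbit is bent down to \<open>z = 0\<close> before it gets from
  there to the centre: \<open>h v > 0\<close> (lemma \<open>x_end_pos_if_slow\<close>). As \<open>h\<close> is continuous, some
  orbit returns exactly at the centre (lemma \<open>exists_shot_to_center\<close>). Reflecting it in both axes
  gives a figure eight (lemma \<open>symmetric_figure_eight_from_arc\<close>). Its trace meets the horizontal plane
  at distance \<open>x0\<close> from the centre and otherwise only in the centre, so different \<open>x0\<close> give different traces.

  The initial value problem is solved for a modified force, in which the distances to \<open>(\<plusminus>1, 0)\<close> are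
  cut off below and above. The modified field is globally Lipschitz, so it has a global flow that
  depends continuously on the initial speed, and it shares all the sign properties used above.
  Energy and angular momentum confine the relevant orbits to the region where the cutoff is inactive
  (lemma \<open>genuine_while_x_nonneg\<close>).
\<close>

section \<open>Flows of Lipschitz vector fields\<close>

lemma integral_from_zero_derivative:
  fixes f :: "real \<Rightarrow> 'a::banach"
  assumes "continuous_on {0..} f" "t \<ge> 0"
  shows "((\<lambda>u. integral {0..u} f) has_vector_derivative f t) (at t within {0..})"
proof -
  have c: "continuous_on {0..t+1} f"
    by (rule continuous_on_subset[OF assms(1)]) auto
  have "((\<lambda>u. integral {0..u} f) has_vector_derivative f t) (at t within {0..t+1})"
    by (rule integral_has_vector_derivative[OF c]) (use assms in auto)
  moreover have "at t within {0..t+1} = at t within {0..}"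
    by (rule at_within_nhd[of t "{..<t+1}"]) auto
  ultimately show ?thesis by simp
qed

text \<open>Picard iteration on the whole half-line at once. For \<open>u t = exp (- 2 L t) y t\<close> the integral
  equation becomes a fixed point equation in the space of bounded continuous functions, and the weight
  makes the operator a contraction with factor \<open>1/2\<close>. As the operator depends on the initial value
  with Lipschitz constant \<open>1\<close>, its fixed point does so with constant \<open>2\<close>; this is the
  continuous dependence that shooting needs.\<close>

lemma lipschitz_flow:
  fixes G :: "'a::banach \<Rightarrow> 'a"
  assumes "L > 0" and lip: "\<And>x y. norm (G x - G y) \<le> L * norm (x - y)"
  obtains \<Phi> :: "'a \<Rightarrow> real \<Rightarrow> 'a" where
    "\<And>y. \<Phi> y 0 = y"
    "\<And>y t. t \<ge> 0 \<Longrightarrow> (\<Phi> y has_vector_derivative G (\<Phi> y t)) (at t within {0..})"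
    "\<And>y y' t. t \<ge> 0 \<Longrightarrow> norm (\<Phi> y t - \<Phi> y' t) \<le> 2 * exp (2 * L * t) * norm (y - y')"
proof -
  have contG: "continuous_on S G" for S
    by (rule lipschitz_on_continuous_on[of L])
      (use assms in \<open>auto simp: lipschitz_on_def dist_norm\<close>)
  have eint: "integral {0..t} (\<lambda>s. C * exp (2 * L * s)) = C / (2 * L) * (exp (2 * L * t) - 1)"
    if "t \<ge> 0" for t C :: real
  proof (rule integral_unique)
    have "((\<lambda>s. C * exp (2 * L * s)) has_integral
        (C / (2 * L) * exp (2 * L * t) - C / (2 * L) * exp (2 * L * 0))) {0..t}"
      by (rule fundamental_theorem_of_calculus[OF that])
        (use \<open>L > 0\<close> in \<open>auto intro!: derivative_eq_intros simp: has_real_derivative_iff_has_vector_derivative[symmetric]\<close>)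
    then show "((\<lambda>s. C * exp (2 * L * s)) has_integral C / (2 * L) * (exp (2 * L * t) - 1)) {0..t}"
      by (simp add: algebra_simps)
  qed
  define f where "f u s = G (exp (2 * L * s) *\<^sub>R apply_bcontfun u s)" for u :: "real \<Rightarrow>\<^sub>C 'a" and s
  have contf: "continuous_on S (f u)" for S u
    unfolding f_def by (intro continuous_on_compose2[OF contG[of UNIV]] continuous_intros) auto
  define p where "p y u t = exp (- 2 * L * max t 0) *\<^sub>R (y + integral {0..max t 0} (f u))" for y u t
  have pcont: "continuous_on UNIV (p y u)" for y u
  proof -
    have "continuous_on {0..} (\<lambda>t. integral {0..t} (f u))"
      using integral_from_zero_derivative[OF contf] 
      by (auto simp: continuous_on_eq_continuous_within intro!: has_vector_derivative_continuous)
    then have "continuous_on UNIV (\<lambda>t. integral {0..max t 0} (f u))"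
      by (rule continuous_on_compose2) (auto intro!: continuous_intros)
    then show ?thesis unfolding p_def by (intro continuous_intros)
  qed
  have bound: "norm (integral {0..t} (\<lambda>s. g s)) \<le> C / (2 * L) * (exp (2 * L * t) - 1)"
    if "t \<ge> 0" "continuous_on {0..t} g" "\<And>s. s \<in> {0..t} \<Longrightarrow> norm (g s) \<le> C * exp (2 * L * s)" for t C and g :: "real \<Rightarrow> 'a"
  proof -
    have "norm (integral {0..t} (\<lambda>s. g s)) \<le> integral {0..t} (\<lambda>s. C * exp (2 * L * s))"
      by (rule integral_norm_bound_integral)
        (use that in \<open>auto intro!: integrable_continuous_real continuous_intros\<close>)
    then show ?thesis using eint[OF that(1)] by simp
  qed
  have pbcont: "p y u \<in> bcontfun" for y u
  proof (rule bcontfun_normI[OF pcont])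
    fix t :: real
    define s where "s = max t 0"
    define C where "C = norm (G 0) + L * norm u"
    have C0: "C \<ge> 0" unfolding C_def using \<open>L > 0\<close> by simp
    have s: "s \<ge> 0" by (simp add: s_def)
    have "norm (f u r) \<le> C * exp (2 * L * r)" if "r \<in> {0..s}" for r
    proof -
      have "norm (f u r) \<le> norm (G 0) + norm (f u r - G 0)"
        using norm_triangle_ineq[of "G 0" "f u r - G 0"] by simp
      also have "norm (f u r - G 0) \<le> L * (exp (2 * L * r) * norm (apply_bcontfun u r))"
        unfolding f_def using lip[of "exp (2 * L * r) *\<^sub>R apply_bcontfun u r" 0] by simp
      also have "\<dots> \<le> L * (exp (2 * L * r) * norm u)"
        using \<open>L > 0\<close> by (intro mult_left_mono norm_bounded) auto
      also have "norm (G 0) \<le> norm (G 0) * exp (2 * L * r)"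
        using that \<open>L > 0\<close> by (intro mult_le_cancel_left1[THEN iffD2]) auto
      finally show ?thesis by (simp add: C_def algebra_simps)
    qed
    then have "norm (integral {0..s} (f u)) \<le> C / (2 * L) * (exp (2 * L * s) - 1)"
      by (intro bound s contf) auto
    also have "\<dots> \<le> C / (2 * L) * exp (2 * L * s)"
      using C0 \<open>L > 0\<close> by (intro mult_left_mono) auto
    finally have i: "norm (integral {0..s} (f u)) \<le> C / (2 * L) * exp (2 * L * s)" .
    have "norm (p y u t) \<le> exp (- 2 * L * s) * (norm y + norm (integral {0..s} (f u)))"
      unfolding p_def s_def[symmetric] by (simp add: norm_triangle_ineq)
    also have "\<dots> \<le> exp (- 2 * L * s) * (norm y + C / (2 * L) * exp (2 * L * s))"
      using i by (intro mult_left_mono) auto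
    also have "\<dots> = exp (- 2 * L * s) * norm y + C / (2 * L)"
      by (simp add: algebra_simps exp_minus field_simps)
    also have "\<dots> \<le> norm y + C / (2 * L)"
      using s \<open>L > 0\<close> by (auto intro!: mult_left_le_one_le)
    finally show "norm (p y u t) \<le> norm y + C / (2 * L)" .
  qed
  define P where "P y u = Bcontfun (p y u)" for y u
  have P: "apply_bcontfun (P y u) = p y u" for y u
    unfolding P_def by (rule Bcontfun_inverse[OF pbcont])
  have contr: "dist (P y u) (P y' u') \<le> norm (y - y') + 1/2 * dist u u'" for y y' u u'
  proof (rule dist_bound)
    fix t :: real
    define s where "s = max t 0"
    have s: "s \<ge> 0" by (simp add: s_def)
    have "norm (f u r - f u' r) \<le> L * dist u u' * exp (2 * L * r)" if "r \<in> {0..s}" for r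
    proof -
      have "norm (f u r - f u' r) \<le> L * (exp (2 * L * r) * norm (apply_bcontfun u r - apply_bcontfun u' r))"
        unfolding f_def using lip[of "exp (2 * L * r) *\<^sub>R apply_bcontfun u r" "exp (2 * L * r) *\<^sub>R apply_bcontfun u' r"]
        by (simp flip: scaleR_right_diff_distrib)
      also have "\<dots> \<le> L * (exp (2 * L * r) * dist u u')"
        using \<open>L > 0\<close> dist_bounded[of u r u'] by (intro mult_left_mono) (auto simp: dist_norm)
      finally show ?thesis by (simp add: algebra_simps)
    qed
    then have "norm (integral {0..s} (\<lambda>r. f u r - f u' r)) \<le> L * dist u u' / (2 * L) * (exp (2 * L * s) - 1)"
      by (intro bound s continuous_intros contf) auto
    also have "\<dots> \<le> 1/2 * dist u u' * exp (2 * L * s)"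
      using \<open>L > 0\<close> by (simp add: algebra_simps)
    finally have i: "norm (integral {0..s} (f u) - integral {0..s} (f u')) \<le> 1/2 * dist u u' * exp (2 * L * s)"
      by (subst Henstock_Kurzweil_Integration.integral_diff[symmetric])
        (auto intro!: integrable_continuous_real contf)
    have "dist (p y u t) (p y' u' t) = exp (- 2 * L * s) * norm ((y - y') + (integral {0..s} (f u) - integral {0..s} (f u')))"
      unfolding p_def s_def[symmetric] dist_norm
      by (simp flip: scaleR_right_diff_distrib) (simp add: algebra_simps)
    also have "\<dots> \<le> exp (- 2 * L * s) * (norm (y - y') + 1/2 * dist u u' * exp (2 * L * s))"
      using i by (intro mult_left_mono norm_triangle_le) auto
    also have "\<dots> = exp (- 2 * L * s) * norm (y - y') + 1/2 * dist u u'"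
      by (simp add: algebra_simps exp_minus field_simps)
    also have "\<dots> \<le> norm (y - y') + 1/2 * dist u u'"
      using s \<open>L > 0\<close> by (auto intro!: mult_left_le_one_le)
    finally show "dist (apply_bcontfun (P y u) t) (apply_bcontfun (P y' u') t) \<le> norm (y - y') + 1/2 * dist u u'"
      unfolding P .
  qed
  have "\<exists>!u. P y u = u" for y
    by (rule banach_fix_type[of "1/2"]) (use contr[of y _ y] in auto)
  then obtain U where U: "\<And>y. P y (U y) = U y" by metis
  define \<Phi> where "\<Phi> y t = exp (2 * L * t) *\<^sub>R apply_bcontfun (U y) t" for y t
  have \<Phi>: "\<Phi> y t = y + integral {0..t} (f (U y))" if "t \<ge> 0" for y t
  proof -
    have "apply_bcontfun (U y) t = p y (U y) t" using P[of y "U y"] U by simp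
    then show ?thesis unfolding \<Phi>_def p_def using that by (simp add: max_def exp_minus)
  qed
  show thesis
  proof
    show "\<Phi> y 0 = y" for y using \<Phi>[of 0] by simp
    show "(\<Phi> y has_vector_derivative G (\<Phi> y t)) (at t within {0..})" if "t \<ge> 0" for y t
    proof -
      have "((\<lambda>t. y + integral {0..t} (f (U y))) has_vector_derivative 0 + f (U y) t) (at t within {0..})"
        by (intro has_vector_derivative_add has_vector_derivative_const
            integral_from_zero_derivative contf that)
      moreover have "f (U y) t = G (\<Phi> y t)" by (simp add: f_def \<Phi>_def)
      ultimately show ?thesis
        using that by (auto intro: has_vector_derivative_transform[where f="\<lambda>t. y + integral {0..t} (f (U y))"] simp: \<Phi>)
    qed
    show "norm (\<Phi> y t - \<Phi> y' t) \<le> 2 * exp (2 * L * t) * norm (y - y')" if "t \<ge> 0" for y y' t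
    proof -
      have "dist (U y) (U y') \<le> 2 * norm (y - y')" using contr[of y "U y" y' "U y'"] U by simp
      then have "norm (apply_bcontfun (U y) t - apply_bcontfun (U y') t) \<le> 2 * norm (y - y')"
        using dist_bounded[of "U y" t "U y'"] by (simp add: dist_norm)
      then show ?thesis
        unfolding \<Phi>_def by (simp flip: scaleR_right_diff_distrib)
    qed
  qed
qed

section \<open>The two coefficients of the force\<close>

text \<open>Rotating the plane about the \<open>z\<close>-axis only shifts the angle in the potential, and reflecting it in
  the \<open>z\<close>-axis shifts that angle by \<open>pi\<close>; so both symmetries come from this.\<close>

lemma integral_periodic_shift:
  fixes f :: "real \<Rightarrow> 'a::banach"
  assumes cont: "continuous_on UNIV f" and per: "\<And>t. f (t + 2*pi) = f t"
  shows "integral {0..2*pi} (\<lambda>t. f (t + c)) = integral {0..2*pi} f"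
proof -
  have perk: "f (t + of_int k * (2*pi)) = f t" for t k
  proof (induction k rule: int_induct[where k=0])
    case (step1 i)
    then show ?case using per[of "t + of_int i * (2*pi)"] by (simp add: algebra_simps)
  next
    case (step2 i)
    then show ?case using per[of "t + of_int (i - 1) * (2*pi)"] by (simp add: algebra_simps)
  qed auto
  \<comment> \<open>reduce the shift modulo the period to one in \<open>[0, 2 pi]\<close>\<close>
  define k where "k = \<lfloor>c / (2*pi)\<rfloor>"
  define e where "e = c - of_int k * (2*pi)"
  have "of_int k \<le> c / (2*pi)" "c / (2*pi) < of_int k + 1" unfolding k_def by linarith+
  then have e: "0 \<le> e" "e \<le> 2*pi" unfolding e_def by (auto simp: field_simps)
  have int: "f integrable_on {a..b}" for a b
    by (intro integrable_continuous_real continuous_on_subset[OF cont]) auto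
  have "integral {0..2*pi} (\<lambda>t. f (t + c)) = integral {0..2*pi} (\<lambda>t. f (t + e))"
    using perk[of "t + e" k for t] by (intro integral_cong) (simp add: e_def algebra_simps)
  also have "\<dots> = integral {e..2*pi+e} f"
    using integral_shift_real_ivl[of e e "2*pi+e" f] by simp
  also have "\<dots> = integral {e..2*pi} f + integral {2*pi..2*pi+e} f"
    by (rule Henstock_Kurzweil_Integration.integral_combine[symmetric]) (use e int in auto)
  also have "integral {2*pi..2*pi+e} f = integral {0..e} (\<lambda>t. f (t + 2*pi))"
    using integral_shift_real_ivl[of "2*pi" "2*pi" "2*pi+e" f] by simp
  also have "\<dots> = integral {0..e} f" by (simp add: per)
  also have "integral {e..2*pi} f + integral {0..e} f = integral {0..2*pi} f"
    using e int Henstock_Kurzweil_Integration.integral_combine[of 0 e "2*pi" f] by (simp add: add.commute)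
  finally show ?thesis .
qed

text \<open>If \<open>a\<close> and \<open>b\<close> are the squared distances of a point of the plane to \<open>(1, 0)\<close> and \<open>(- 1, 0)\<close>, this
  is its squared distance to the point of the circle at angle \<open>\<theta>\<close> from \<open>(1, 0)\<close>. In these
  variables the force makes sense for all positive \<open>a\<close> and \<open>b\<close>, geometric or not, and this is what allows
  the two distances to be cut off independently.\<close>

definition chord2 :: "real \<Rightarrow> real \<Rightarrow> real \<Rightarrow> real" where
  "chord2 a b \<theta> = (a + b) / 2 + (a - b) / 2 * cos \<theta>"

text \<open>The coefficients \<open>q\<close> and \<open>m\<close> of the acceleration \<open>(m - q x, - q z)\<close> are \<open>pull\<close> and \<open>tilt\<close>.\<close>

definition pull :: "real \<Rightarrow> real \<Rightarrow> real \<Rightarrow> real" where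
  "pull lam a b = integral {0..2*pi} (\<lambda>\<theta>. lam / sqrt (chord2 a b \<theta>) ^ 3)"

definition tilt :: "real \<Rightarrow> real \<Rightarrow> real \<Rightarrow> real" where
  "tilt lam a b = integral {0..2*pi} (\<lambda>\<theta>. lam * cos \<theta> / sqrt (chord2 a b \<theta>) ^ 3)"

lemma chord2_convex: "chord2 a b \<theta> = a * ((1 + cos \<theta>) / 2) + b * ((1 - cos \<theta>) / 2)"
  by (simp add: chord2_def field_simps)

lemma one_plus_cos_nonneg [simp]: "0 \<le> 1 + cos (\<theta>::real)"
  using cos_ge_minus_one[of \<theta>] by linarith

lemma chord2_lower:
  assumes "m \<le> a" "m \<le> b"
  shows "m \<le> chord2 a b \<theta>"
proof -
  have "m = m * ((1 + cos \<theta>) / 2) + m * ((1 - cos \<theta>) / 2)" by (simp add: field_simps)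
  also have "\<dots> \<le> chord2 a b \<theta>"
    unfolding chord2_convex using assms
    by (intro add_mono mult_right_mono) auto
  finally show ?thesis .
qed

lemma chord2_upper:
  assumes "a \<le> M" "b \<le> M"
  shows "chord2 a b \<theta> \<le> M"
proof -
  have "chord2 a b \<theta> \<le> M * ((1 + cos \<theta>) / 2) + M * ((1 - cos \<theta>) / 2)"
    unfolding chord2_convex using assms
    by (intro add_mono mult_right_mono) auto
  also have "\<dots> = M" by (simp add: field_simps)
  finally show ?thesis .
qed

lemma chord2_pos: "a > 0 \<Longrightarrow> b > 0 \<Longrightarrow> chord2 a b \<theta> > 0"
  using chord2_lower[of "min a b" a b \<theta>] by auto

lemma continuous_on_chord2 [continuous_intros]: "continuous_on S (chord2 a b)"
  unfolding chord2_def by (intro continuous_intros)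

lemma chord_integrable:
  assumes "a > 0" "b > 0" "continuous_on {s..t} g"
  shows "(\<lambda>\<theta>. g \<theta> / sqrt (chord2 a b \<theta>) ^ 3) integrable_on {s..t::real}"
  using chord2_pos[OF assms(1,2)]
  by (intro integrable_continuous_real continuous_intros assms) (auto simp: less_imp_neq[symmetric])

lemma pull_ge_const:
  assumes "lam > 0" "a > 0" "b > 0" "a \<le> B\<^sup>2" "b \<le> B\<^sup>2" "B > 0"
  shows "pull lam a b \<ge> 2 * pi * lam / B ^ 3"
proof -
  have "integral {0..2*pi} (\<lambda>\<theta>. lam / B ^ 3) \<le> pull lam a b"
    unfolding pull_def
  proof (rule integral_le)
    fix \<theta> :: real
    have "sqrt (chord2 a b \<theta>) \<le> B" using chord2_upper[OF assms(4,5)] assms by (intro real_le_lsqrt) auto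
    then show "lam / B ^ 3 \<le> lam / sqrt (chord2 a b \<theta>) ^ 3"
      using assms chord2_pos[of a b \<theta>] by (intro divide_left_mono power_mono mult_pos_pos) auto
  qed (use assms in \<open>auto intro!: chord_integrable\<close>)
  then show ?thesis by (simp add: field_simps)
qed

text \<open>Half of this difference is the weight of the attraction to \<open>(- 1, 0)\<close>. That it is bounded below drives
  the growth of the angular momentum about \<open>(1, 0)\<close> and the fall of an orbit towards the circle.\<close>

lemma pull_minus_tilt_ge:
  assumes "lam > 0" "a > 0" "b > 0" "a \<le> B\<^sup>2" "b \<le> B\<^sup>2" "B > 0"
  shows "pull lam a b - tilt lam a b \<ge> 2 * pi * lam / B ^ 3"
proof -
  have i1: "(\<lambda>\<theta>. lam / sqrt (chord2 a b \<theta>) ^ 3) integrable_on {0..2*pi}"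
    and i2: "(\<lambda>\<theta>. lam * cos \<theta> / sqrt (chord2 a b \<theta>) ^ 3) integrable_on {0..2*pi}"
    using assms by (auto intro!: chord_integrable continuous_intros)
  have "((\<lambda>\<theta>. 1 - cos \<theta>) has_integral ((2*pi - sin (2*pi)) - (0 - sin 0))) {0..2*pi}"
    by (rule fundamental_theorem_of_calculus)
      (auto intro!: derivative_eq_intros simp: has_real_derivative_iff_has_vector_derivative[symmetric])
  from has_integral_mult_right[OF this, of "lam / B ^ 3"]
  have h: "((\<lambda>\<theta>. lam / B ^ 3 * (1 - cos \<theta>)) has_integral (2 * pi * lam / B ^ 3)) {0..2*pi}"
    by (simp add: ac_simps)
  have "2 * pi * lam / B ^ 3 = integral {0..2*pi} (\<lambda>\<theta>. lam / B ^ 3 * (1 - cos \<theta>))"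
    by (rule integral_unique[OF h, symmetric])
  also have "\<dots> \<le> integral {0..2*pi} (\<lambda>\<theta>. lam / sqrt (chord2 a b \<theta>) ^ 3 - lam * cos \<theta> / sqrt (chord2 a b \<theta>) ^ 3)"
  proof (rule integral_le)
    fix \<theta> :: real
    have "sqrt (chord2 a b \<theta>) \<le> B" using chord2_upper[OF assms(4,5)] assms by (intro real_le_lsqrt) auto
    then have "lam / B ^ 3 \<le> lam / sqrt (chord2 a b \<theta>) ^ 3"
      using assms chord2_pos[of a b \<theta>] by (intro divide_left_mono power_mono mult_pos_pos) auto
    then have "lam / B ^ 3 * (1 - cos \<theta>) \<le> lam / sqrt (chord2 a b \<theta>) ^ 3 * (1 - cos \<theta>)"
      by (intro mult_right_mono) auto
    also have "\<dots> = lam / sqrt (chord2 a b \<theta>) ^ 3 - lam * cos \<theta> / sqrt (chord2 a b \<theta>) ^ 3"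
      by (simp add: right_diff_distrib)
    finally show "lam / B ^ 3 * (1 - cos \<theta>) \<le> lam / sqrt (chord2 a b \<theta>) ^ 3 - lam * cos \<theta> / sqrt (chord2 a b \<theta>) ^ 3" .
  next
    show "(\<lambda>\<theta>. lam / B ^ 3 * (1 - cos \<theta>)) integrable_on {0..2*pi}" using h by blast
  qed (auto intro!: Henstock_Kurzweil_Integration.integrable_diff i1 i2)
  also have "\<dots> = pull lam a b - tilt lam a b"
    unfolding pull_def tilt_def by (rule Henstock_Kurzweil_Integration.integral_diff[OF i1 i2])
  finally show ?thesis .
qed

lemma abs_tilt_le_pull:
  assumes "lam > 0" "a > 0" "b > 0"
  shows "\<bar>tilt lam a b\<bar> \<le> pull lam a b"
proof -
  have "norm (tilt lam a b) \<le> pull lam a b"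
    unfolding pull_def tilt_def
  proof (rule integral_norm_bound_integral)
    fix \<theta> :: real
    show "norm (lam * cos \<theta> / sqrt (chord2 a b \<theta>) ^ 3) \<le> lam / sqrt (chord2 a b \<theta>) ^ 3"
      using assms chord2_pos[of a b \<theta>]
      by (auto simp: abs_mult mult_le_cancel_left1 intro!: divide_right_mono mult_right_le_one_le)
  qed (use assms in \<open>auto intro!: chord_integrable continuous_intros\<close>)
  then show ?thesis by simp
qed

lemma pull_le:
  assumes "lam > 0" "m > 0" "m\<^sup>2 \<le> a" "m\<^sup>2 \<le> b"
  shows "pull lam a b \<le> 2 * pi * lam / m ^ 3"
proof -
  have ab: "a > 0" "b > 0" using assms by (auto intro: less_le_trans[of 0 "m\<^sup>2"])
  have "pull lam a b \<le> integral {0..2*pi} (\<lambda>\<theta>. lam / m ^ 3)"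
    unfolding pull_def
  proof (rule integral_le)
    fix \<theta> :: real
    have "m \<le> sqrt (chord2 a b \<theta>)" using chord2_lower[OF assms(3,4)] assms by (intro real_le_rsqrt) auto
    then show "lam / sqrt (chord2 a b \<theta>) ^ 3 \<le> lam / m ^ 3"
      using assms chord2_pos[OF ab] by (intro divide_left_mono power_mono mult_pos_pos) auto
  qed (use ab in \<open>auto intro!: chord_integrable\<close>)
  then show ?thesis by (simp add: field_simps)
qed

lemma pull_commute: "a > 0 \<Longrightarrow> b > 0 \<Longrightarrow> pull lam b a = pull lam a b"
  and tilt_commute: "a > 0 \<Longrightarrow> b > 0 \<Longrightarrow> tilt lam b a = - tilt lam a b"
proof -
  assume ab: "a > 0" "b > 0"
  have c: "chord2 b a \<theta> = chord2 a b (\<theta> + pi)" for \<theta>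
    by (simp add: chord2_def field_simps)
  have p: "chord2 a b (\<theta> + 2 * pi) = chord2 a b \<theta>" for \<theta>
    by (simp add: chord2_def cos_periodic)
  have ne: "chord2 a b \<theta> \<noteq> 0" for \<theta> using chord2_pos[OF ab, of \<theta>] by simp
  show "pull lam b a = pull lam a b"
    unfolding pull_def c
    by (rule integral_periodic_shift) (use ne in \<open>auto intro!: continuous_intros simp: p\<close>)
  have "integral {0..2*pi} (\<lambda>\<theta>. lam * cos (\<theta> + pi) / sqrt (chord2 a b (\<theta> + pi)) ^ 3) = tilt lam a b"
    unfolding tilt_def
    by (rule integral_periodic_shift[where f="\<lambda>\<theta>. lam * cos \<theta> / sqrt (chord2 a b \<theta>) ^ 3"])
      (use ne in \<open>auto intro!: continuous_intros simp: p\<close>)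
  then show "tilt lam b a = - tilt lam a b"
    unfolding tilt_def[of _ b a] c by simp
qed

text \<open>The nearer point attracts more. The weight \<open>cos \<theta>\<close> has mean zero, so a constant may be subtracted
  from \<open>1 / D\<^sup>3\<close>; with its value at \<open>cos \<theta> = 0\<close> the integrand becomes a product of two factors of
  equal sign.\<close>

lemma tilt_nonneg:
  assumes "lam > 0" "a > 0" "a \<le> b"
  shows "tilt lam a b \<ge> 0"
proof -
  \<comment> \<open>the value of \<open>lam / D\<^sup>3\<close> at \<open>cos \<theta> = 0\<close>\<close>
  define C where "C = lam / sqrt ((a + b) / 2) ^ 3"
  have b: "b > 0" using assms by simp
  have "((\<lambda>\<theta>. C * cos \<theta>) has_integral (C * sin (2*pi) - C * sin 0)) {0..2*pi}"
    by (rule fundamental_theorem_of_calculus)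
      (auto intro!: derivative_eq_intros simp: has_real_derivative_iff_has_vector_derivative[symmetric])
  then have h: "((\<lambda>\<theta>. C * cos \<theta>) has_integral 0) {0..2*pi}" by simp
  then have "0 = integral {0..2*pi} (\<lambda>\<theta>. C * cos \<theta>)" by (simp add: integral_unique)
  also have "\<dots> \<le> tilt lam a b"
    unfolding tilt_def
  proof (rule integral_le)
    fix \<theta> :: real
    have w: "chord2 a b \<theta> > 0" using assms by (intro chord2_pos) auto
    have "C * cos \<theta> \<le> lam / sqrt (chord2 a b \<theta>) ^ 3 * cos \<theta>"
    proof (cases "cos \<theta> \<ge> 0")
      case True
      then have "(a - b) / 2 * cos \<theta> \<le> 0" using assms by (intro mult_nonpos_nonneg) auto
      then have "chord2 a b \<theta> \<le> (a + b) / 2" unfolding chord2_def by linarith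
      then have "C \<le> lam / sqrt (chord2 a b \<theta>) ^ 3"
        unfolding C_def using assms w
        by (intro divide_left_mono power_mono mult_pos_pos) auto
      then show ?thesis using True by (rule mult_right_mono)
    next
      case False
      then have "(a - b) / 2 * cos \<theta> \<ge> 0" using assms by (intro mult_nonpos_nonpos) auto
      then have "chord2 a b \<theta> \<ge> (a + b) / 2" unfolding chord2_def by linarith
      then have "C \<ge> lam / sqrt (chord2 a b \<theta>) ^ 3"
        unfolding C_def using assms w
        by (intro divide_left_mono power_mono mult_pos_pos) auto
      then show ?thesis using False by (intro mult_right_mono_neg) auto
    qed
    then show "C * cos \<theta> \<le> lam * cos \<theta> / sqrt (chord2 a b \<theta>) ^ 3" by simp
  qed (use h assms b in \<open>auto intro!: chord_integrable continuous_intros\<close>)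
  finally show ?thesis .
qed

text \<open>An arc of length \<open>\<delta>\<close> of the circle lies within distance \<open>3 \<delta>\<close>, and it alone contributes this much. The
  pull thus grows like the inverse square of the distance to the circle.\<close>

lemma pull_ge_near_circle:
  assumes "lam > 0" "0 < \<delta>" "0 < a" "a \<le> 5 * \<delta>\<^sup>2" "a \<le> b" "b \<le> 5"
    "\<delta> \<le> 1"
  shows "pull lam a b \<ge> lam / (27 * \<delta>\<^sup>2)"
proof -
  have b: "b > 0" using assms by simp
  have "lam / (27 * \<delta>\<^sup>2) = integral {0..\<delta>} (\<lambda>\<theta>. lam / (27 * \<delta> ^ 3))"
    using assms by (simp add: field_simps power2_eq_square power3_eq_cube)
  also have "\<dots> \<le> integral {0..\<delta>} (\<lambda>\<theta>. lam / sqrt (chord2 a b \<theta>) ^ 3)"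
  proof (rule integral_le)
    fix \<theta> assume \<theta>: "\<theta> \<in> {0..\<delta>}"
    have w: "chord2 a b \<theta> > 0" using assms by (intro chord2_pos) auto
    have "cos (2 * (\<theta> / 2)) = 1 - 2 * (sin (\<theta> / 2))\<^sup>2" by (rule cos_double_sin)
    moreover have "(sin (\<theta> / 2))\<^sup>2 \<le> (\<theta> / 2)\<^sup>2"
      using abs_sin_x_le_abs_x[of "\<theta> / 2"] by (simp only: abs_le_square_iff)
    ultimately have "(1 - cos \<theta>) / 2 \<le> \<theta>\<^sup>2 / 4" by (simp add: power_divide)
    also have "\<dots> \<le> \<delta>\<^sup>2 / 4" using \<theta> by (simp add: power_mono)
    finally have c: "(1 - cos \<theta>) / 2 \<le> \<delta>\<^sup>2 / 4" .
    have "chord2 a b \<theta> = a + (b - a) * ((1 - cos \<theta>) / 2)" by (simp add: chord2_def field_simps)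
    also have "\<dots> \<le> 5 * \<delta>\<^sup>2 + 5 * (\<delta>\<^sup>2 / 4)"
      using assms c by (intro add_mono mult_mono) auto
    also have "\<dots> \<le> (3 * \<delta>)\<^sup>2" by (simp add: power_mult_distrib)
    finally have "sqrt (chord2 a b \<theta>) \<le> 3 * \<delta>" using assms by (intro real_le_lsqrt) auto
    then have "sqrt (chord2 a b \<theta>) ^ 3 \<le> (3 * \<delta>) ^ 3" using w by (intro power_mono) auto
    then have "sqrt (chord2 a b \<theta>) ^ 3 \<le> 27 * \<delta> ^ 3" by (simp add: power_mult_distrib)
    then show "lam / (27 * \<delta> ^ 3) \<le> lam / sqrt (chord2 a b \<theta>) ^ 3"
      using assms w by (intro divide_left_mono mult_pos_pos) auto
  qed (use assms b in \<open>auto intro!: chord_integrable\<close>)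
  also have "\<dots> \<le> pull lam a b"
    unfolding pull_def
  proof (rule integral_subset_le)
    show "{0..\<delta>} \<subseteq> {0..2*pi}" using assms pi_gt3 by auto
    show "\<forall>\<theta>\<in>{0..2*pi}. 0 \<le> lam / sqrt (chord2 a b \<theta>) ^ 3"
      using chord2_pos[OF assms(3) b] assms by (auto simp: less_imp_le)
  qed (use assms b in \<open>auto intro!: chord_integrable\<close>)
  finally show ?thesis .
qed

lemma inverse_sqrt_cube_lipschitz:
  assumes "\<rho> > 0" "w \<ge> \<rho>\<^sup>2" "w' \<ge> \<rho>\<^sup>2"
  shows "\<bar>1 / sqrt w ^ 3 - 1 / sqrt w' ^ 3\<bar> \<le> 3 / (2 * \<rho> ^ 5) * \<bar>w - w'\<bar>"
proof -
  define s s' where "s = sqrt w" and "s' = sqrt w'"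
  have s: "s \<ge> \<rho>" "s' \<ge> \<rho>" unfolding s_def s'_def using assms by (auto intro: real_le_rsqrt)
  have w: "w = s\<^sup>2" "w' = s'\<^sup>2" 
    unfolding s_def s'_def using assms by (auto simp: order_trans[OF zero_le_power2])
  have p: "s > 0" "s' > 0" using s assms by auto
  have 1: "1 / s ^ 3 - 1 / s' ^ 3 = (s' - s) * (1 / (s * s' ^ 3) + 1 / (s\<^sup>2 * s'\<^sup>2) + 1 / (s ^ 3 * s'))"
    using p by (simp add: field_simps power2_eq_square power3_eq_cube)
  have bd: "1 / (s ^ i * s' ^ j) \<le> 1 / \<rho> ^ 4" if "i + j = 4" for i j
  proof -
    have "\<rho> ^ i * \<rho> ^ j \<le> s ^ i * s' ^ j" using s assms p by (intro mult_mono power_mono) auto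
    then have "\<rho> ^ 4 \<le> s ^ i * s' ^ j" by (simp flip: power_add add: that)
    then show ?thesis using assms p by (intro divide_left_mono mult_pos_pos) auto
  qed
  have "1 / (s * s' ^ 3) + 1 / (s\<^sup>2 * s'\<^sup>2) + 1 / (s ^ 3 * s') \<le> 3 / \<rho> ^ 4"
    using bd[of 1 3] bd[of 2 2] bd[of 3 1] by simp
  moreover have "0 \<le> 1 / (s * s' ^ 3) + 1 / (s\<^sup>2 * s'\<^sup>2) + 1 / (s ^ 3 * s')" using p by auto
  moreover have "\<bar>s' - s\<bar> \<le> \<bar>w - w'\<bar> / (2 * \<rho>)"
  proof -
    have "\<bar>w - w'\<bar> = \<bar>s' - s\<bar> * (s + s')"
    proof -
      have "w - w' = (s - s') * (s + s')" unfolding w by (simp add: power2_eq_square algebra_simps)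
      then show ?thesis using p by (simp add: abs_mult)
    qed
    also have "\<dots> \<ge> \<bar>s' - s\<bar> * (2 * \<rho>)" using s by (intro mult_left_mono) auto
    finally show ?thesis using assms by (simp add: field_simps)
  qed
  ultimately have "\<bar>1 / s ^ 3 - 1 / s' ^ 3\<bar> \<le> \<bar>w - w'\<bar> / (2 * \<rho>) * (3 / \<rho> ^ 4)"
    unfolding 1 abs_mult by (intro mult_mono) auto
  also have "\<dots> = 3 / (2 * \<rho> ^ 5) * \<bar>w - w'\<bar>" by (simp add: power_eq_if)
  finally show ?thesis unfolding s_def s'_def .
qed

lemma chord_integral_lipschitz:
  assumes "lam > 0" "\<rho> > 0" and ge: "a \<ge> \<rho>\<^sup>2" "b \<ge> \<rho>\<^sup>2" "a' \<ge> \<rho>\<^sup>2" "b' \<ge> \<rho>\<^sup>2"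
    and g: "continuous_on {0..2*pi} g" "\<And>\<theta>. \<bar>g \<theta>\<bar> \<le> lam"
  shows "\<bar>integral {0..2*pi} (\<lambda>\<theta>. g \<theta> / sqrt (chord2 a b \<theta>) ^ 3) -
      integral {0..2*pi} (\<lambda>\<theta>. g \<theta> / sqrt (chord2 a' b' \<theta>) ^ 3)\<bar>
     \<le> 3 * pi * lam / \<rho> ^ 5 * (\<bar>a - a'\<bar> + \<bar>b - b'\<bar>)"
proof -
  have pos: "a > 0" "b > 0" "a' > 0" "b' > 0"
    using ge \<open>\<rho> > 0\<close> by (auto intro: less_le_trans[of 0 "\<rho>\<^sup>2"])
  define D where "D = \<bar>a - a'\<bar> + \<bar>b - b'\<bar>"
  have "norm (integral {0..2*pi} (\<lambda>\<theta>. g \<theta> / sqrt (chord2 a b \<theta>) ^ 3 - g \<theta> / sqrt (chord2 a' b' \<theta>) ^ 3))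
     \<le> integral {0..2*pi} (\<lambda>\<theta>. lam * (3 / (2 * \<rho> ^ 5) * D))"
  proof (rule integral_norm_bound_integral)
    fix \<theta> :: real
    have "chord2 a b \<theta> - chord2 a' b' \<theta> = (a - a') * ((1 + cos \<theta>) / 2) + (b - b') * ((1 - cos \<theta>) / 2)"
      by (simp add: chord2_convex field_simps)
    also have "\<bar>\<dots>\<bar> \<le> \<bar>a - a'\<bar> * ((1 + cos \<theta>) / 2) + \<bar>b - b'\<bar> * ((1 - cos \<theta>) / 2)"
      by (intro order_trans[OF abs_triangle_ineq]) (auto simp: abs_mult)
    also have "\<dots> \<le> D"
      unfolding D_def by (intro add_mono mult_right_le_one_le) auto
    finally have d: "\<bar>chord2 a b \<theta> - chord2 a' b' \<theta>\<bar> \<le> D" .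
    have "\<bar>1 / sqrt (chord2 a b \<theta>) ^ 3 - 1 / sqrt (chord2 a' b' \<theta>) ^ 3\<bar>
        \<le> 3 / (2 * \<rho> ^ 5) * \<bar>chord2 a b \<theta> - chord2 a' b' \<theta>\<bar>"
      using assms by (intro inverse_sqrt_cube_lipschitz chord2_lower) auto
    also have "\<dots> \<le> 3 / (2 * \<rho> ^ 5) * D"
      using d \<open>\<rho> > 0\<close> by (intro mult_left_mono) auto
    finally have "\<bar>g \<theta>\<bar> * \<bar>1 / sqrt (chord2 a b \<theta>) ^ 3 - 1 / sqrt (chord2 a' b' \<theta>) ^ 3\<bar>
        \<le> lam * (3 / (2 * \<rho> ^ 5) * D)"
      using g(2)[of \<theta>] \<open>lam > 0\<close> by (intro mult_mono) auto
    then show "norm (g \<theta> / sqrt (chord2 a b \<theta>) ^ 3 - g \<theta> / sqrt (chord2 a' b' \<theta>) ^ 3)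
        \<le> lam * (3 / (2 * \<rho> ^ 5) * D)"
      by (simp flip: abs_mult add: algebra_simps)
  qed (use pos g in \<open>auto intro!: Henstock_Kurzweil_Integration.integrable_diff chord_integrable\<close>)
  also have "integral {0..2*pi} (\<lambda>\<theta>. g \<theta> / sqrt (chord2 a b \<theta>) ^ 3 - g \<theta> / sqrt (chord2 a' b' \<theta>) ^ 3)
     = integral {0..2*pi} (\<lambda>\<theta>. g \<theta> / sqrt (chord2 a b \<theta>) ^ 3) -
       integral {0..2*pi} (\<lambda>\<theta>. g \<theta> / sqrt (chord2 a' b' \<theta>) ^ 3)"
    by (rule Henstock_Kurzweil_Integration.integral_diff[OF chord_integrable[OF pos(1,2) g(1)] chord_integrable[OF pos(3,4) g(1)]])
  also have "integral {0..2*pi} (\<lambda>\<theta>. lam * (3 / (2 * \<rho> ^ 5) * D)) = 3 * pi * lam / \<rho> ^ 5 * D"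
    using \<open>\<rho> > 0\<close> by (simp add: divide_simps)
  finally show ?thesis by (simp add: D_def)
qed

lemma pull_lipschitz:
  assumes "lam > 0" "\<rho> > 0" "a \<ge> \<rho>\<^sup>2" "b \<ge> \<rho>\<^sup>2" "a' \<ge> \<rho>\<^sup>2" "b' \<ge> \<rho>\<^sup>2"
  shows "\<bar>pull lam a b - pull lam a' b'\<bar> \<le> 3 * pi * lam / \<rho> ^ 5 * (\<bar>a - a'\<bar> + \<bar>b - b'\<bar>)"
  unfolding pull_def by (rule chord_integral_lipschitz[OF assms]) (use assms in auto)

lemma tilt_lipschitz:
  assumes "lam > 0" "\<rho> > 0" "a \<ge> \<rho>\<^sup>2" "b \<ge> \<rho>\<^sup>2" "a' \<ge> \<rho>\<^sup>2" "b' \<ge> \<rho>\<^sup>2"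
  shows "\<bar>tilt lam a b - tilt lam a' b'\<bar> \<le> 3 * pi * lam / \<rho> ^ 5 * (\<bar>a - a'\<bar> + \<bar>b - b'\<bar>)"
  unfolding tilt_def
  by (rule chord_integral_lipschitz[OF assms])
    (use assms in \<open>auto intro!: continuous_intros mult_right_le_one_le simp: abs_mult\<close>)

section \<open>The gradient of the potential on a vertical plane\<close>

definition near2 :: "real \<times> real \<Rightarrow> real" where "near2 p = (fst p - 1)\<^sup>2 + (snd p)\<^sup>2"
definition far2 :: "real \<times> real \<Rightarrow> real" where "far2 p = (fst p + 1)\<^sup>2 + (snd p)\<^sup>2"

text \<open>The acceleration \<open>- \<nabla>V\<close> in the coordinates \<open>(x, z)\<close>.\<close>

definition ring_force :: "real \<Rightarrow> real \<times> real \<Rightarrow> real \<times> real" where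
  "ring_force lam p =
     (tilt lam (near2 p) (far2 p) - pull lam (near2 p) (far2 p) * fst p,
      - pull lam (near2 p) (far2 p) * snd p)"

lemma plane_point_nth [simp]:
  "plane_point \<phi> p $ 1 = cos \<phi> * fst p"
  "plane_point \<phi> p $ 2 = sin \<phi> * fst p"
  "plane_point \<phi> p $ 3 = snd p"
  by (simp_all add: plane_point_def rotation_z_def)

lemma vec3_eq_iff: "(x::real^3) = y \<longleftrightarrow> x $ 1 = y $ 1 \<and> x $ 2 = y $ 2 \<and> x $ 3 = y $ 3"
  by (simp add: vec_eq_iff forall_3)

lemma inner_vec3: "(x::real^3) \<bullet> y = x $ 1 * y $ 1 + x $ 2 * y $ 2 + x $ 3 * y $ 3"
  by (simp add: inner_vec_def sum_3)

lemma linear_plane_point: "linear (plane_point \<phi>)"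
  by (rule linearI) (simp_all add: vec3_eq_iff algebra_simps)

lemma bounded_linear_plane_point: "bounded_linear (plane_point \<phi>)"
  by (simp add: linear_plane_point linear_linear)

lemma sin_cos_mult_square: "cos \<phi> * a * (cos \<phi> * b) + sin \<phi> * a * (sin \<phi> * b) = a * (b::real)"
proof -
  have "c * a * (c * b) + s * a * (s * b) = (c\<^sup>2 + s\<^sup>2) * (a * b)" for c s :: real
    by (simp add: power2_eq_square algebra_simps)
  from this[of "cos \<phi>" "sin \<phi>"] show ?thesis by simp
qed

lemma inner_plane_point: "plane_point \<phi> p \<bullet> plane_point \<phi> p' = fst p * fst p' + snd p * snd p'"
  by (simp add: inner_vec3 sin_cos_mult_square)

lemma plane_point_in_unit_circle_iff:
  "plane_point \<phi> p \<in> unit_circle \<longleftrightarrow> near2 p = 0 \<or> far2 p = 0"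
proof -
  have "(cos \<phi> * fst p)\<^sup>2 + (sin \<phi> * fst p)\<^sup>2 = (fst p)\<^sup>2"
    using sin_cos_mult_square[of \<phi> "fst p" "fst p"] by (simp add: power2_eq_square)
  then show ?thesis
    by (auto simp: unit_circle_def near2_def far2_def sum_power2_eq_zero_iff power2_eq_1_iff)
qed

lemma norm_minus_circle_point:
  "norm (plane_point \<phi> p - vector [cos \<theta>, sin \<theta>, 0]) = sqrt (chord2 (near2 p) (far2 p) (\<theta> - \<phi>))"
proof -
  define x where "x = fst p"
  have "(c * x - c')\<^sup>2 + (s * x - s')\<^sup>2 = (c\<^sup>2 + s\<^sup>2) * x\<^sup>2 + (c'\<^sup>2 + s'\<^sup>2) - 2 * x * (c' * c + s' * s)"
    for c c' s s' :: real
    by (simp add: power2_eq_square algebra_simps)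
  from this[of "cos \<phi>" "cos \<theta>" "sin \<phi>" "sin \<theta>"]
  have "(cos \<phi> * x - cos \<theta>)\<^sup>2 + (sin \<phi> * x - sin \<theta>)\<^sup>2 = x\<^sup>2 + 1 - 2 * x * cos (\<theta> - \<phi>)"
    by (simp add: cos_diff)
  then show ?thesis
    unfolding norm_eq_sqrt_inner inner_vec3
    by (simp add: power2_eq_square[symmetric] chord2_def near2_def far2_def flip: x_def)
      (simp add: power2_eq_square field_simps)
qed

lemma circle_potential_plane_point:
  "circle_potential lam (plane_point \<phi> p) =
     - integral {0..2*pi} (\<lambda>\<theta>. lam / sqrt (chord2 (near2 p) (far2 p) (\<theta> - \<phi>)))"
  by (simp add: circle_potential_def norm_minus_circle_point)

lemma circle_param_in_unit_circle: "vector [cos \<theta>, sin \<theta>, 0] \<in> unit_circle"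
  by (simp add: unit_circle_def)

lemma closed_unit_circle: "closed unit_circle"
  unfolding unit_circle_def
  by (intro closed_Collect_conj closed_Collect_eq continuous_intros)

lemma vector_eq_axes:
  "vector [x, y, z] = x *\<^sub>R axis 1 1 + y *\<^sub>R axis 2 1 + z *\<^sub>R (axis 3 1 :: real^3)"
  by (simp add: vec3_eq_iff axis_def)

text \<open>Differentiation under the integral sign on a ball that avoids the circle.\<close>

lemma circle_potential_GDERIV:
  assumes "r \<notin> unit_circle"
  shows "GDERIV (circle_potential lam) r :>
     integral {0..2*pi} (\<lambda>\<theta>. (lam / norm (r - vector [cos \<theta>, sin \<theta>, 0]) ^ 3) *\<^sub>R (r - vector [cos \<theta>, sin \<theta>, 0]))"
proof -
  define u :: "real \<Rightarrow> real^3" where "u \<theta> = vector [cos \<theta>, sin \<theta>, 0]" for \<theta>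
  have contu: "continuous_on S u" for S
    unfolding u_def vector_eq_axes by (intro continuous_intros)
  obtain e where e: "e > 0" "ball r e \<subseteq> - unit_circle"
    using closed_unit_circle assms by (metis ComplI open_Compl open_contains_ball)
  have ne: "s - u \<theta> \<noteq> 0" if "s \<in> ball r e" for s \<theta>
    using e that circle_param_in_unit_circle[of \<theta>] unfolding u_def by auto
  define g where "g s \<theta> = - ((lam / norm (s - u \<theta>) ^ 3) *\<^sub>R (s - u \<theta>))" for s \<theta>
  have "((\<lambda>s. integral (cbox 0 (2*pi)) (\<lambda>\<theta>. lam / norm (s - u \<theta>))) has_derivative
      blinfun_apply (integral (cbox 0 (2*pi)) (\<lambda>\<theta>. blinfun_inner_left (g r \<theta>)))) (at r within ball r e)"
  proof (rule leibniz_rule)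
    fix s \<theta> assume s: "s \<in> ball r e"
    have "((\<lambda>s. lam / norm (s - u \<theta>)) has_derivative
        (\<lambda>h. - lam * (h \<bullet> sgn (s - u \<theta>)) / (norm (s - u \<theta>))\<^sup>2)) (at s within ball r e)"
      using ne[OF s, of \<theta>]
      by (auto intro!: derivative_eq_intros has_derivative_compose[where f="\<lambda>s. s - u \<theta>" and g=norm, OF _ has_derivative_norm] simp: power2_eq_square divide_simps)
    also have "(\<lambda>h. - lam * (h \<bullet> sgn (s - u \<theta>)) / (norm (s - u \<theta>))\<^sup>2) = blinfun_apply (blinfun_inner_left (g s \<theta>))"
      by (rule ext) (simp add: g_def sgn_div_norm power2_eq_square power3_eq_cube divide_simps)
    finally show "((\<lambda>s. lam / norm (s - u \<theta>)) has_derivative blinfun_apply (blinfun_inner_left (g s \<theta>))) (at s within ball r e)" .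
  next
    fix s assume s: "s \<in> ball r e"
    show "(\<lambda>\<theta>. lam / norm (s - u \<theta>)) integrable_on cbox 0 (2 * pi)"
      using ne[OF s] by (intro integrable_continuous continuous_intros contu) auto
  next
    show "continuous_on (ball r e \<times> cbox 0 (2 * pi)) (\<lambda>(x, t). blinfun_inner_left (g x t))"
      unfolding g_def split_beta using ne
      by (intro bounded_linear.continuous_on[OF bounded_linear_blinfun_inner_left] continuous_intros
          continuous_on_compose2[OF contu[of UNIV]]) auto
  qed (use e in auto)
  then have D: "((\<lambda>s. integral {0..2*pi} (\<lambda>\<theta>. lam / norm (s - u \<theta>))) has_derivative
      blinfun_apply (integral {0..2*pi} (\<lambda>\<theta>. blinfun_inner_left (g r \<theta>)))) (at r)"
    using e by (simp add: at_within_ball)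
  have contg: "continuous_on {0..2*pi} (g r)"
    unfolding g_def using ne[of r] e by (intro continuous_intros contu) auto
  have "blinfun_apply (integral {0..2*pi} (\<lambda>\<theta>. blinfun_inner_left (g r \<theta>))) h = h \<bullet> integral {0..2*pi} (g r)" for h
  proof -
    have "integral {0..2*pi} (blinfun_inner_left \<circ> g r) = blinfun_inner_left (integral {0..2*pi} (g r))"
      by (intro integral_linear bounded_linear_blinfun_inner_left integrable_continuous_real contg)
    then show ?thesis by (simp add: o_def)
  qed
  then have "GDERIV (\<lambda>s. integral {0..2*pi} (\<lambda>\<theta>. lam / norm (s - u \<theta>))) r :> integral {0..2*pi} (g r)"
    unfolding gderiv_def by (intro has_derivative_eq_rhs[OF D] ext)
  then have "GDERIV (circle_potential lam) r :> - integral {0..2*pi} (g r)"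
    unfolding circle_potential_def[abs_def] u_def by (rule GDERIV_minus)
  moreover have "- integral {0..2*pi} (g r) = integral {0..2*pi} (\<lambda>\<theta>. (lam / norm (r - u \<theta>) ^ 3) *\<^sub>R (r - u \<theta>))"
    unfolding g_def by simp
  ultimately show ?thesis unfolding u_def by simp
qed

text \<open>After a shift of the angle by \<open>\<phi>\<close> the component of the force orthogonal to the vertical plane is an
  integral of an odd function, so it vanishes.\<close>

lemma circle_potential_gradient_plane:
  assumes "plane_point \<phi> p \<notin> unit_circle"
  shows "GDERIV (circle_potential lam) (plane_point \<phi> p) :> - plane_point \<phi> (ring_force lam p)"
proof -
  define x where "x = fst p"
  define w where "w \<theta> = sqrt (chord2 (near2 p) (far2 p) \<theta>) ^ 3" for \<theta>
  have ab: "near2 p > 0" "far2 p > 0"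
  proof -
    have "near2 p \<ge> 0" "far2 p \<ge> 0" by (auto simp: near2_def far2_def)
    then show "near2 p > 0" "far2 p > 0"
      using assms unfolding plane_point_in_unit_circle_iff by auto
  qed
  have wne: "w \<theta> \<noteq> 0" for \<theta> using chord2_pos[OF ab, of \<theta>] by (simp add: w_def)
  have wp: "w (\<theta> + 2*pi) = w \<theta>" for \<theta> by (simp add: w_def chord2_def)
  have contw: "continuous_on S w" for S unfolding w_def by (intro continuous_intros)
  define F where "F \<theta> = (lam / norm (plane_point \<phi> p - vector [cos \<theta>, sin \<theta>, 0]) ^ 3) *\<^sub>R (plane_point \<phi> p - vector [cos \<theta>, sin \<theta>, 0])" for \<theta>
  have F: "F \<theta> = (lam / w (\<theta> - \<phi>)) *\<^sub>R (plane_point \<phi> p - vector [cos \<theta>, sin \<theta>, 0])" for \<theta>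
    unfolding F_def w_def norm_minus_circle_point ..
  have contF: "continuous_on S F" for S
    unfolding F vector_eq_axes using wne
    by (intro continuous_intros continuous_on_compose2[OF contw[of UNIV]]) auto
  have shift: "integral {0..2*pi} F = integral {0..2*pi} (\<lambda>\<theta>. F (\<theta> + \<phi>))"
    by (rule integral_periodic_shift[symmetric, OF contF]) (simp add: F wp diff_add_eq[symmetric])
  have intF: "(\<lambda>\<theta>. F (\<theta> + \<phi>)) integrable_on {0..2*pi}"
    by (intro integrable_continuous_real continuous_on_compose2[OF contF[of UNIV]] continuous_intros) auto
  have P: "((\<lambda>\<theta>. lam / w \<theta>) has_integral pull lam (near2 p) (far2 p)) {0..2*pi}"
    and T: "((\<lambda>\<theta>. lam * cos \<theta> / w \<theta>) has_integral tilt lam (near2 p) (far2 p)) {0..2*pi}"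
    unfolding pull_def tilt_def w_def[symmetric]
    by (intro integrable_integral integrable_continuous_real continuous_intros contw; use wne in auto)+
  have S: "((\<lambda>\<theta>. lam * sin \<theta> / w \<theta>) has_integral 0) {0..2*pi}"
  proof -
    define f where "f \<theta> = lam * sin \<theta> / w \<theta>" for \<theta>
    have contf: "continuous_on S f" for S
      unfolding f_def using wne by (intro continuous_intros contw) auto
    have odd: "f (- \<theta>) = - f \<theta>" for \<theta> by (simp add: f_def w_def chord2_def)
    have per: "f (\<theta> + 2*pi) = f \<theta>" for \<theta> by (simp add: f_def wp)
    have "integral {0..2*pi} f = integral {- (2*pi)..0} (\<lambda>\<theta>. f (- \<theta>))"
      using Henstock_Kurzweil_Integration.integral_reflect_real[where a=0 and b="2*pi" and f=f] by (simp only: minus_zero)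
    also have "\<dots> = - integral {- (2*pi)..0} f" by (simp add: odd)
    also have "integral {- (2*pi)..0} f = integral {0 - 2*pi..2*pi - 2*pi} (\<lambda>\<theta>. f (\<theta> + 2*pi))"
      by (simp add: per)
    also have "\<dots> = integral {0..2*pi} f" by (rule integral_shift_real_ivl)
    finally have "integral {0..2*pi} f = 0" by simp
    then show ?thesis
      using integrable_integral[OF integrable_continuous_real[OF contf]] unfolding f_def by metis
  qed
  have "integral {0..2*pi} F = - plane_point \<phi> (ring_force lam p)"
    unfolding shift vec3_eq_iff
  proof (intro conjI)
    have "((\<lambda>\<theta>. cos \<phi> * (x * (lam / w \<theta>)) - cos \<phi> * (lam * cos \<theta> / w \<theta>) + sin \<phi> * (lam * sin \<theta> / w \<theta>)) has_integral
        cos \<phi> * (x * pull lam (near2 p) (far2 p)) - cos \<phi> * tilt lam (near2 p) (far2 p) + sin \<phi> * 0) {0..2*pi}"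
      by (intro has_integral_add has_integral_diff has_integral_mult_right P T S)
    then have "((\<lambda>\<theta>. F (\<theta> + \<phi>) $ 1) has_integral
        cos \<phi> * (x * pull lam (near2 p) (far2 p)) - cos \<phi> * tilt lam (near2 p) (far2 p)) {0..2*pi}"
      by (rule has_integral_eq_rhs[OF has_integral_eq, rotated])
        (simp_all add: F cos_add x_def wne field_simps)
    then show "integral {0..2*pi} (\<lambda>\<theta>. F (\<theta> + \<phi>)) $ 1 = (- plane_point \<phi> (ring_force lam p)) $ 1"
      using intF by (simp flip: integral_component_eq_cart add: integral_unique ring_force_def x_def algebra_simps)
    have "((\<lambda>\<theta>. sin \<phi> * (x * (lam / w \<theta>)) - sin \<phi> * (lam * cos \<theta> / w \<theta>) - cos \<phi> * (lam * sin \<theta> / w \<theta>)) has_integral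
        sin \<phi> * (x * pull lam (near2 p) (far2 p)) - sin \<phi> * tilt lam (near2 p) (far2 p) - cos \<phi> * 0) {0..2*pi}"
      by (intro has_integral_add has_integral_diff has_integral_mult_right P T S)
    then have "((\<lambda>\<theta>. F (\<theta> + \<phi>) $ 2) has_integral
        sin \<phi> * (x * pull lam (near2 p) (far2 p)) - sin \<phi> * tilt lam (near2 p) (far2 p)) {0..2*pi}"
      by (rule has_integral_eq_rhs[OF has_integral_eq, rotated])
        (simp_all add: F sin_add x_def wne field_simps)
    then show "integral {0..2*pi} (\<lambda>\<theta>. F (\<theta> + \<phi>)) $ 2 = (- plane_point \<phi> (ring_force lam p)) $ 2"
      using intF by (simp flip: integral_component_eq_cart add: integral_unique ring_force_def x_def algebra_simps)
    have "((\<lambda>\<theta>. snd p * (lam / w \<theta>)) has_integral snd p * pull lam (near2 p) (far2 p)) {0..2*pi}"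
      by (intro has_integral_mult_right P)
    then have "((\<lambda>\<theta>. F (\<theta> + \<phi>) $ 3) has_integral snd p * pull lam (near2 p) (far2 p)) {0..2*pi}"
      by (rule has_integral_eq_rhs[OF has_integral_eq, rotated])
        (simp_all add: F wne field_simps)
    then show "integral {0..2*pi} (\<lambda>\<theta>. F (\<theta> + \<phi>)) $ 3 = (- plane_point \<phi> (ring_force lam p)) $ 3"
      using intF by (simp flip: integral_component_eq_cart add: integral_unique ring_force_def algebra_simps)
  qed
  then show ?thesis using circle_potential_GDERIV[OF assms, of lam] by (simp add: F_def[abs_def])
qed

section \<open>Orbits under a pull towards the axis and a tilt\<close>

lemma mvt_half_line:
  fixes f :: "real \<Rightarrow> real"
  assumes "0 \<le> a" "a < b"
    and "\<And>t. a \<le> t \<Longrightarrow> t \<le> b \<Longrightarrow> (f has_real_derivative f' t) (at t within {0..})"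
  obtains \<xi> where "a < \<xi>" "\<xi> < b" "f b - f a = f' \<xi> * (b - a)"
proof -
  have "\<exists>\<xi>\<in>{a<..<b}. f b - f a = (\<lambda>h. f' \<xi> * h) (b - a)"
  proof (rule mvt_simple[OF assms(2)])
    fix t assume "a \<le> t" "t \<le> b"
    then show "(f has_derivative (*) (f' t)) (at t within {a..b})"
      using assms(1)
      by (intro has_derivative_subset[OF assms(3)[unfolded has_field_derivative_def]]) auto
  qed
  then show thesis using that by auto
qed

lemma first_zero_in:
  fixes f :: "real \<Rightarrow> real"
  assumes "a \<le> b" "continuous_on {a..b} f" "f a > 0" "f b \<le> 0"
  obtains t where "a < t" "t \<le> b" "f t = 0" "\<And>s. a \<le> s \<Longrightarrow> s < t \<Longrightarrow> f s > 0"
proof -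
  define S where "S = {s \<in> {a..b}. f s = 0}"
  have S_ne: "\<exists>s. a \<le> s \<and> s \<le> t \<and> f s = 0" if "a \<le> t" "t \<le> b" "f t \<le> 0" for t
    using IVT2'[of f t 0 a] that assms continuous_on_subset[OF assms(2), of "{a..t}"] by auto
  have "closed S"
    unfolding S_def by (rule continuous_closed_preimage_constant[OF assms(2)]) auto
  moreover have "S \<noteq> {}" using S_ne[of b] assms unfolding S_def by auto
  moreover have bdd: "bdd_below S" unfolding S_def by (intro bdd_belowI[of _ a]) auto
  ultimately have "Inf S \<in> S" by (intro closed_contains_Inf)
  then have i: "Inf S \<in> {a..b}" "f (Inf S) = 0" by (auto simp: S_def)
  show thesis
  proof (rule that[OF _ _ i(2)])
    show "a < Inf S" using i assms by (cases "Inf S = a") auto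
    show "Inf S \<le> b" using i by simp
    fix s assume s: "a \<le> s" "s < Inf S"
    show "f s > 0"
    proof (rule ccontr)
      assume "\<not> f s > 0"
      then obtain r where "a \<le> r" "r \<le> s" "f r = 0" using S_ne[of s] s i by auto
      then have "r \<in> S" using s i by (auto simp: S_def)
      then have "Inf S \<le> r" using bdd by (rule cInf_lower)
      then show False using \<open>r \<le> s\<close> s by simp
    qed
  qed
qed

lemma last_zero_in:
  fixes f :: "real \<Rightarrow> real"
  assumes "a \<le> b" "continuous_on {a..b} f" "f a \<le> 0" "f b > 0"
  obtains t where "a \<le> t" "t < b" "f t = 0" "\<And>s. t < s \<Longrightarrow> s \<le> b \<Longrightarrow> f s > 0"
proof -
  have "continuous_on {- b..- a} (\<lambda>s. f (- s))"
    by (rule continuous_on_compose2[OF assms(2)]) (auto intro!: continuous_intros)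
  then obtain t where t: "- b < t" "t \<le> - a" "f (- t) = 0" "\<And>s. - b \<le> s \<Longrightarrow> s < t \<Longrightarrow> f (- s) > 0"
    using first_zero_in[of "- b" "- a" "\<lambda>s. f (- s)"] assms by auto
  show thesis
    by (rule that[of "- t"]) (use t t(4)[of "- s" for s] in auto)
qed

text \<open>The usual bootstrap: a bound that can be improved to a strict one for as long as it holds is never lost.\<close>

lemma continuation_positive:
  fixes f :: "real \<Rightarrow> real"
  assumes cont: "continuous_on {a..b} f" and "f a > 0"
    and step: "\<And>t. a < t \<Longrightarrow> t \<le> b \<Longrightarrow> (\<And>s. a \<le> s \<Longrightarrow> s \<le> t \<Longrightarrow> f s \<ge> 0) \<Longrightarrow> f t > 0"
    and "a \<le> t" "t \<le> b"
  shows "f t > 0"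
proof (rule ccontr)
  assume "\<not> f t > 0"
  then obtain s where s: "a < s" "s \<le> t" "f s = 0" "\<And>r. a \<le> r \<Longrightarrow> r < s \<Longrightarrow> f r > 0"
    using first_zero_in[of a t f] continuous_on_subset[OF cont, of "{a..t}"] assms by auto
  have "f s > 0"
  proof (rule step)
    fix r assume "a \<le> r" "r \<le> s"
    then show "f r \<ge> 0" using s(3) s(4)[of r] by (cases "r = s") auto
  qed (use s assms in auto)
  then show False using s by simp
qed

text \<open>The arguments about signs need the coefficients of the force only as functions of time along the orbit.
  So they apply both to the true and to the modified force.\<close>

locale planar_motion =
  fixes x z u w q m :: "real \<Rightarrow> real" and c :: real
  assumes dx: "\<And>t. t \<ge> 0 \<Longrightarrow> (x has_real_derivative u t) (at t within {0..})"
    and dz: "\<And>t. t \<ge> 0 \<Longrightarrow> (z has_real_derivative w t) (at t within {0..})"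
    and du: "\<And>t. t \<ge> 0 \<Longrightarrow> (u has_real_derivative (m t - q t * x t)) (at t within {0..})"
    and dw: "\<And>t. t \<ge> 0 \<Longrightarrow> (w has_real_derivative (- q t * z t)) (at t within {0..})"
    and start: "x 0 > 1" "u 0 = 0" "z 0 = 0" "w 0 > 0"
    and c_pos: "c > 0" and q_ge: "\<And>t. t \<ge> 0 \<Longrightarrow> q t \<ge> c"
    and m_less_q: "\<And>t. t \<ge> 0 \<Longrightarrow> m t < q t"
    and m_sign: "\<And>t. t \<ge> 0 \<Longrightarrow> x t \<ge> 0 \<Longrightarrow> m t \<ge> 0" "\<And>t. t \<ge> 0 \<Longrightarrow> x t \<le> 0 \<Longrightarrow> m t \<le> 0"
begin

lemma continuous_motion:
  assumes "S \<subseteq> {0..}"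
  shows "continuous_on S x" "continuous_on S z" "continuous_on S u" "continuous_on S w"
proof -
  have c: "continuous_on {0..} x" "continuous_on {0..} z" "continuous_on {0..} u" "continuous_on {0..} w"
    unfolding continuous_on_eq_continuous_within
    by (auto intro: DERIV_continuous[OF dx] DERIV_continuous[OF dz] DERIV_continuous[OF du] DERIV_continuous[OF dw])
  then show "continuous_on S x" "continuous_on S z" "continuous_on S u" "continuous_on S w"
    using assms continuous_on_subset by blast+
qed

text \<open>If \<open>z\<close> stayed positive, its derivative would be nonnegative, since a concave function that
  decreases somewhere reaches zero. But then \<open>z\<close> is bounded below by a positive number, so
  \<open>w' \<le> - c z\<close> makes \<open>w\<close> negative after all.\<close>

lemma exists_return:
  obtains T where "T > 0" "z T = 0" "\<And>t. 0 < t \<Longrightarrow> t < T \<Longrightarrow> z t > 0"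
proof -
  have "\<exists>d>0. \<forall>h>0. 0 + h \<in> {0..} \<longrightarrow> h < d \<longrightarrow> z 0 < z (0 + h)"
    using has_real_derivative_pos_inc_right[OF dz[of 0]] start by auto
  then obtain d where d: "d > 0" "\<And>h. 0 < h \<Longrightarrow> h < d \<Longrightarrow> z h > 0"
    using start by auto
  have "\<exists>t \<ge> d/2. z t \<le> 0"
  proof (rule ccontr)
    assume "\<not> ?thesis"
    then have zpos: "z t > 0" if "t > 0" for t
    proof (cases "t < d")
      case False
      then have "t \<ge> d/2" using d by simp
      then show ?thesis using \<open>\<not> (\<exists>t\<ge>d/2. z t \<le> 0)\<close> not_le by blast
    qed (use that d in auto)
    have wmono: "w b \<le> w a" if ab: "0 \<le> a" "a < b" for a b
    proof -
      obtain \<xi> where \<xi>: "a < \<xi>" "\<xi> < b" "w b - w a = (- q \<xi> * z \<xi>) * (b - a)"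
        using mvt_half_line[OF ab dw] ab by auto
      have "q \<xi> * z \<xi> > 0" using q_ge[of \<xi>] zpos[of \<xi>] \<xi> ab c_pos by auto
      then have "(q \<xi> * z \<xi>) * (b - a) \<ge> 0"
        using ab mult_pos_pos[of "q \<xi> * z \<xi>" "b - a"] by simp
      then show ?thesis using \<xi> by simp
    qed
    show False
    proof (cases "\<exists>s>0. w s < 0")
      case True
      then obtain s where s: "s > 0" "w s < 0" by blast
      \<comment> \<open>where the tangent line at \<open>s\<close> meets the time axis\<close>
      define r where "r = s + z s / (- w s)"
      have r: "r > s" unfolding r_def using s zpos[of s] by (simp add: divide_pos_neg)
      obtain \<xi> where \<xi>: "s < \<xi>" "\<xi> < r" "z r - z s = w \<xi> * (r - s)"
        using mvt_half_line[OF _ r dz] s r by auto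
      have "w \<xi> * (r - s) \<le> w s * (r - s)" using wmono[of s \<xi>] \<xi> s r by (intro mult_right_mono) auto
      also have "w s * (r - s) = - z s" unfolding r_def using s by simp
      finally have "z r \<le> 0" using \<xi> by simp
      then show False using zpos[of r] s r by simp
    next
      case False
      then have wnn: "w s \<ge> 0" if "s > 0" for s using that False not_less by blast
      have z1: "z s \<ge> z 1" if s: "s > 1" for s
      proof -
        obtain \<xi> where \<xi>: "1 < \<xi>" "\<xi> < s" "z s - z 1 = w \<xi> * (s - 1)"
          using mvt_half_line[OF _ s dz] s by auto
        moreover have "w \<xi> * (s - 1) \<ge> 0" using wnn[of \<xi>] s \<xi> by (intro mult_nonneg_nonneg) auto
        ultimately show ?thesis by simp
      qed
      define r where "r = 1 + (w 1 + 1) / (c * z 1)"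
      have cz: "c * z 1 > 0" using c_pos zpos[of 1] by simp
      have r: "r > 1" unfolding r_def using wnn[of 1] cz by auto
      obtain \<xi> where \<xi>: "1 < \<xi>" "\<xi> < r" "w r - w 1 = (- q \<xi> * z \<xi>) * (r - 1)"
        using mvt_half_line[OF _ r dw] r by auto
      have "c * z 1 \<le> q \<xi> * z \<xi>" using q_ge[of \<xi>] z1[of \<xi>] \<xi> c_pos zpos[of 1] by (intro mult_mono) auto
      then have "c * z 1 * (r - 1) \<le> q \<xi> * z \<xi> * (r - 1)" using r by (intro mult_right_mono) auto
      moreover have "c * z 1 * (r - 1) = w 1 + 1" unfolding r_def using c_pos zpos[of 1] by simp
      ultimately have "w r < 0" using \<xi> by simp
      then show False using wnn[of r] r by simp
    qed
  qed
  then obtain s where s: "s \<ge> d/2" "z s \<le> 0" by blast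
  obtain T where T: "d/2 < T" "T \<le> s" "z T = 0" "\<And>r. d/2 \<le> r \<Longrightarrow> r < T \<Longrightarrow> z r > 0"
    using first_zero_in[of "d/2" s z] s d continuous_motion(2)[of "{d/2..s}"] by auto
  show thesis
  proof (rule that[of T])
    show "T > 0" "z T = 0" using T d by auto
    show "z t > 0" if "0 < t" "t < T" for t
      using that T(4)[of t] d(2)[of t] d(1) by (cases "t < d/2") auto
  qed
qed

text \<open>The attraction to \<open>(1, 0)\<close> has no moment about that point; what is left is the moment of the attraction
  to \<open>(- 1, 0)\<close>.\<close>

lemma angular_momentum_circle_deriv:
  assumes "t \<ge> 0"
  shows "((\<lambda>t. (x t - 1) * w t - z t * u t) has_real_derivative z t * (q t - m t)) (at t within {0..})"
  using assms by (auto intro!: derivative_eq_intros dx dz du dw simp: algebra_simps)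

lemma angular_momentum_center_deriv:
  assumes "t \<ge> 0"
  shows "((\<lambda>t. x t * w t - z t * u t) has_real_derivative - z t * m t) (at t within {0..})"
  using assms by (auto intro!: derivative_eq_intros dx dz du dw simp: algebra_simps)

end

locale planar_arc = planar_motion +
  fixes T :: real
  assumes T_pos: "T > 0" and z_T: "z T = 0" and z_pos: "\<And>t. 0 < t \<Longrightarrow> t < T \<Longrightarrow> z t > 0"
begin

lemma z_nonneg: "0 \<le> t \<Longrightarrow> t \<le> T \<Longrightarrow> z t \<ge> 0"
  using z_pos[of t] z_T start by (cases "t = 0"; cases "t = T") (auto simp: less_imp_le)

lemma w_decreasing:
  assumes ab: "0 \<le> a" "a < b" "b \<le> T"
  shows "w b < w a"
proof -
  obtain \<xi> where \<xi>: "a < \<xi>" "\<xi> < b" "w b - w a = (- q \<xi> * z \<xi>) * (b - a)"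
    using mvt_half_line[OF ab(1,2) dw] ab by auto
  have "q \<xi> * z \<xi> > 0" using q_ge[of \<xi>] z_pos[of \<xi>] \<xi> ab c_pos by auto
  then have "(q \<xi> * z \<xi>) * (b - a) > 0" using ab mult_pos_pos[of "q \<xi> * z \<xi>" "b - a"] by simp
  then show ?thesis using \<xi> by simp
qed

lemma w_T_neg: "w T < 0"
proof -
  obtain \<xi> where \<xi>: "T/2 < \<xi>" "\<xi> < T" "z T - z (T/2) = w \<xi> * (T - T/2)"
    using mvt_half_line[of "T/2" T z w] dz T_pos by auto
  have "w \<xi> * (T - T/2) < 0" using \<xi>(3) z_pos[of "T/2"] z_T T_pos by simp
  then have "w \<xi> < 0" using T_pos by (simp add: mult_less_0_iff)
  then show ?thesis using w_decreasing[of \<xi> T] \<xi> T_pos by simp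
qed

lemma angular_momentum_circle_ge:
  assumes t: "0 \<le> t" "t \<le> T"
  shows "(x t - 1) * w t - z t * u t \<ge> (x 0 - 1) * w 0"
proof (cases "t = 0")
  case False
  then have t0: "0 < t" using t by simp
  obtain \<xi> where \<xi>: "0 < \<xi>" "\<xi> < t"
    "((x t - 1) * w t - z t * u t) - ((x 0 - 1) * w 0 - z 0 * u 0) = z \<xi> * (q \<xi> - m \<xi>) * (t - 0)"
    using mvt_half_line[OF _ t0 angular_momentum_circle_deriv] by auto
  have "z \<xi> * (q \<xi> - m \<xi>) * (t - 0) \<ge> 0"
    using m_less_q[of \<xi>] z_pos[of \<xi>] \<xi> t by (intro mult_nonneg_nonneg) auto
  then show ?thesis using \<xi>(3) start by simp
qed (use start in auto)

lemma angular_momentum_circle_pos: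
  assumes t: "0 \<le> t" "t \<le> T"
  shows "(x t - 1) * w t - z t * u t > 0"
  using angular_momentum_circle_ge[OF t] start by (smt (verit) mult_pos_pos)

text \<open>At the return the angular momentum about \<open>(1, 0)\<close> is \<open>(x - 1) w\<close>, which is positive, while the orbit is
  descending.\<close>

lemma x_T_less: "x T < 1"
proof -
  have "(x T - 1) * w T > 0" using angular_momentum_circle_pos[of T] T_pos z_T by simp
  then show ?thesis using w_T_neg by (simp add: zero_less_mult_iff)
qed

lemma velocity_nonzero: "0 \<le> t \<Longrightarrow> t \<le> T \<Longrightarrow> u t \<noteq> 0 \<or> w t \<noteq> 0"
  using angular_momentum_circle_pos[of t] by auto

text \<open>The cotangent \<open>(x - 1) / z\<close> of the polar angle about \<open>(1, 0)\<close> has derivative \<open>- l / z\<^sup>2\<close>, where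
  \<open>l > 0\<close> is the angular momentum, so no point is visited twice.\<close>

lemma inj_arc: "inj_on (\<lambda>t. (x t, z t)) {0..T}"
proof (rule linorder_inj_onI)
  fix a b assume ab: "a < b" "a \<in> {0..T}" "b \<in> {0..T}"
  show "(x a, z a) \<noteq> (x b, z b)"
  proof
    assume eq: "(x a, z a) = (x b, z b)"
    show False
    proof (cases "a = 0 \<or> b = T")
      case True
      then show False
        using eq ab x_T_less start z_T z_pos[of a] z_pos[of b] by (cases "a = 0"; cases "b = T") auto
    next
      case False
      then have ab': "0 < a" "b < T" using ab by auto
      have d: "((\<lambda>t. (x t - 1) / z t) has_real_derivative
          - (((x t - 1) * w t - z t * u t) / (z t)\<^sup>2)) (at t within {0..})" if "a \<le> t" "t \<le> b" for t
      proof -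
        have "z t > 0" using z_pos[of t] that ab' by auto
        then show ?thesis using that ab'
          by (auto intro!: derivative_eq_intros dx dz simp: field_simps power2_eq_square)
      qed
      obtain \<xi> where \<xi>: "a < \<xi>" "\<xi> < b" "(x b - 1) / z b - (x a - 1) / z a =
         - (((x \<xi> - 1) * w \<xi> - z \<xi> * u \<xi>) / (z \<xi>)\<^sup>2) * (b - a)"
        using mvt_half_line[OF _ ab(1) d] ab' by auto
      have "((x \<xi> - 1) * w \<xi> - z \<xi> * u \<xi>) / (z \<xi>)\<^sup>2 > 0"
        using angular_momentum_circle_pos[of \<xi>] z_pos[of \<xi>] \<xi> ab ab' by auto
      then have "- (((x \<xi> - 1) * w \<xi> - z \<xi> * u \<xi>) / (z \<xi>)\<^sup>2) * (b - a) < 0"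
        using ab by (intro mult_neg_pos) auto
      then have "(x b - 1) / z b - (x a - 1) / z a < 0" unfolding \<xi>(3) by simp
      then show False using eq by simp
    qed
  qed
qed auto

lemma z_le: 
  assumes "0 \<le> t" "t \<le> T"
  shows "z t \<le> w 0 * t"
proof (cases "t = 0")
  case False
  then have t: "0 < t" using assms by simp
  obtain \<eta> where \<eta>: "0 < \<eta>" "\<eta> < t" "z t - z 0 = w \<eta> * (t - 0)"
    using mvt_half_line[OF _ t dz] by auto
  then show ?thesis using start w_decreasing[of 0 \<eta>] assms by (simp add: mult_right_mono)
qed (use start in simp)

text \<open>A lower bound for the return time that does not depend on the initial speed. It keeps the return time
  from collapsing to \<open>0\<close> under small changes of that speed.\<close>

lemma return_time_ge:
  assumes q_le: "\<And>t. t \<ge> 0 \<Longrightarrow> q t \<le> Q"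
  shows "Q * T\<^sup>2 \<ge> 1"
proof -
  obtain \<xi> where \<xi>: "0 < \<xi>" "\<xi> < T" "w T - w 0 = (- q \<xi> * z \<xi>) * (T - 0)"
    using mvt_half_line[OF _ T_pos dw] by auto
  have "z \<xi> \<le> w 0 * \<xi>" using z_le \<xi> by simp
  also have "\<dots> \<le> w 0 * T" using \<xi> start by simp
  finally have "z \<xi> \<le> w 0 * T" .
  moreover have "0 \<le> q \<xi>" using q_ge[of \<xi>] c_pos \<xi> by simp
  ultimately have "q \<xi> * z \<xi> \<le> Q * (w 0 * T)"
    using q_le[of \<xi>] z_pos[of \<xi>] \<xi> by (intro mult_mono) auto
  then have "q \<xi> * z \<xi> * T \<le> Q * (w 0 * T) * T" using T_pos by (intro mult_right_mono) auto
  then have "w 0 < w 0 * (Q * T\<^sup>2)"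
    using \<xi>(3) w_T_neg by (simp add: power2_eq_square algebra_simps)
  then show ?thesis using start by simp
qed

text \<open>During an excursion to \<open>x < 0\<close> the angular momentum about the centre is nondecreasing. It is nonnegative
  when the excursion begins, since then \<open>x\<close> is not increasing, and nonpositive when it ends, since then
  \<open>x\<close> is not decreasing. So it vanishes throughout, the orbit moves on a ray through the
  centre, and \<open>x\<close> is constantly \<open>0\<close>. The excursion may end at the return time itself, where \<open>z = 0\<close>.\<close>

lemma no_excursion:
  assumes ab: "0 \<le> a" "a < b" "b \<le> T" and zero: "x a = 0" "x b = 0"
    and neg: "\<And>t. a < t \<Longrightarrow> t < b \<Longrightarrow> x t < 0"
  shows False
proof -
  define l where "l t = x t * w t - z t * u t" for t
  have a0: "a > 0" using ab zero start by (cases "a = 0") auto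
  have lmono: "l s \<le> l r" if sr: "a \<le> s" "s \<le> r" "r \<le> b" for s r
  proof (cases "s = r")
    case False
    then have sr': "s < r" using sr by simp
    obtain \<xi> where \<xi>: "s < \<xi>" "\<xi> < r" "l r - l s = - z \<xi> * m \<xi> * (r - s)"
      unfolding l_def using mvt_half_line[OF _ sr' angular_momentum_center_deriv] sr a0 by auto
    have "z \<xi> * m \<xi> * (r - s) \<le> 0"
      using \<xi> sr ab a0 m_sign(2)[of \<xi>] neg[of \<xi>] z_pos[of \<xi>]
      by (intro mult_nonpos_nonneg mult_nonneg_nonpos) auto
    then show ?thesis using \<xi> by simp
  qed simp
  have "u a \<le> 0"
  proof (rule ccontr)
    assume "\<not> u a \<le> 0"
    then have "\<exists>d>0. \<forall>h>0. a + h \<in> {0..} \<longrightarrow> h < d \<longrightarrow> x a < x (a + h)"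
      using has_real_derivative_pos_inc_right[OF dx[of a]] ab by auto
    then obtain d where d: "d > 0" "\<And>h. 0 < h \<Longrightarrow> h < d \<Longrightarrow> x (a + h) > 0"
      using zero a0 by auto
    have "min (d/2) ((b - a)/2) > 0" "min (d/2) ((b - a)/2) < d" "min (d/2) ((b - a)/2) < b - a"
      using d(1) ab by (auto simp: min_def)
    then show False using d(2)[of "min (d/2) ((b - a)/2)"] neg[of "a + min (d/2) ((b - a)/2)"] ab by auto
  qed
  moreover have "u b \<ge> 0"
  proof (rule ccontr)
    assume "\<not> u b \<ge> 0"
    then have "\<exists>d>0. \<forall>h>0. b - h \<in> {0..} \<longrightarrow> h < d \<longrightarrow> x b < x (b - h)"
      using has_real_derivative_neg_dec_left[OF dx[of b]] ab by auto
    then obtain d where d: "d > 0" "\<And>h. 0 < h \<Longrightarrow> h < d \<Longrightarrow> h \<le> b \<Longrightarrow> x (b - h) > 0"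
      using zero by auto
    have "min (d/2) ((b - a)/2) > 0" "min (d/2) ((b - a)/2) < d" "min (d/2) ((b - a)/2) < b - a"
      using d(1) ab by (auto simp: min_def)
    then show False using d(2)[of "min (d/2) ((b - a)/2)"] neg[of "b - min (d/2) ((b - a)/2)"] ab by auto
  qed
  ultimately have "l a \<ge> 0" "l b \<le> 0"
    unfolding l_def zero using z_nonneg[of a] z_nonneg[of b] ab
    by (auto simp: mult_nonneg_nonpos)
  then have l0: "l t = 0" if "a \<le> t" "t \<le> b" for t
    using lmono[of a t] lmono[of t b] that by auto
  define s where "s = (a + b) / 2"
  have s: "a < s" "s < b" unfolding s_def using ab by auto
  have d: "((\<lambda>t. x t / z t) has_real_derivative 0) (at t within {0..})" if "a \<le> t" "t \<le> s" for t
  proof -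
    have "z t > 0" using z_pos[of t] that a0 s ab by auto
    moreover have "u t * z t = x t * w t" using l0[of t] that s by (simp add: l_def mult.commute)
    ultimately show ?thesis using that a0
      by (auto intro!: derivative_eq_intros dx dz)
  qed
  obtain \<xi> where "x s / z s - x a / z a = 0 * (s - a)"
    using mvt_half_line[OF _ s(1) d] a0 by auto
  then have "x s = 0" using zero z_pos[of s] s ab a0 by auto
  then show False using neg[of s] s by simp
qed

lemma x_nonneg:
  assumes "x T \<ge> 0" and t: "0 \<le> t" "t \<le> T"
  shows "x t \<ge> 0"
proof (rule ccontr)
  assume "\<not> x t \<ge> 0"
  then have neg: "x t < 0" by simp
  obtain b where b: "t < b" "b \<le> T" "- x b = 0" "\<And>s. t \<le> s \<Longrightarrow> s < b \<Longrightarrow> - x s > 0"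
    using first_zero_in[of t T "\<lambda>t. - x t"] t neg assms(1)
      continuous_on_minus[OF continuous_motion(1)[of "{t..T}"]] by auto
  obtain a where a: "0 \<le> a" "a < t" "- x a = 0" "\<And>s. a < s \<Longrightarrow> s \<le> t \<Longrightarrow> - x s > 0"
    using last_zero_in[of 0 t "\<lambda>t. - x t"] t neg start
      continuous_on_minus[OF continuous_motion(1)[of "{0..t}"]] by auto
  show False
  proof (rule no_excursion[of a b])
    fix s assume "a < s" "s < b"
    then show "x s < 0" using a(4)[of s] b(4)[of s] by (cases "s \<le> t") auto
  qed (use a b in auto)
qed

end

section \<open>The force with cut-off distances\<close>

lemma near2_dist: "near2 p = (dist p (1, 0))\<^sup>2"
  and far2_dist: "far2 p = (dist p (- 1, 0))\<^sup>2"
  by (cases p; simp add: near2_def far2_def dist_Pair_Pair dist_real_def)+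

text \<open>The square of the distance \<open>d\<close> clamped to \<open>[\<rho>, R]\<close>.\<close>

definition cutoff2 :: "real \<Rightarrow> real \<Rightarrow> real \<Rightarrow> real" where
  "cutoff2 \<rho> R d = (max \<rho> (min R d))\<^sup>2"

definition soft_pull :: "real \<Rightarrow> real \<Rightarrow> real \<Rightarrow> real \<times> real \<Rightarrow> real" where
  "soft_pull lam \<rho> R p = pull lam (cutoff2 \<rho> R (dist p (1, 0))) (cutoff2 \<rho> R (dist p (- 1, 0)))"

definition soft_tilt :: "real \<Rightarrow> real \<Rightarrow> real \<Rightarrow> real \<times> real \<Rightarrow> real" where
  "soft_tilt lam \<rho> R p = tilt lam (cutoff2 \<rho> R (dist p (1, 0))) (cutoff2 \<rho> R (dist p (- 1, 0)))"

lemma cutoff2_bounds: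
  assumes "0 < \<rho>" "\<rho> \<le> R"
  shows "\<rho>\<^sup>2 \<le> cutoff2 \<rho> R d" "cutoff2 \<rho> R d \<le> R\<^sup>2" "cutoff2 \<rho> R d > 0"
  using assms by (auto simp: cutoff2_def intro!: power_mono zero_less_power)

lemma cutoff2_mono: "0 < \<rho> \<Longrightarrow> d \<le> d' \<Longrightarrow> cutoff2 \<rho> R d \<le> cutoff2 \<rho> R d'"
  by (auto simp: cutoff2_def intro!: power_mono)

lemma cutoff2_eq: "\<rho> \<le> d \<Longrightarrow> d \<le> R \<Longrightarrow> cutoff2 \<rho> R d = d\<^sup>2"
  by (simp add: cutoff2_def)

lemma cutoff2_lipschitz:
  assumes "0 < \<rho>" "\<rho> \<le> R"
  shows "\<bar>cutoff2 \<rho> R d - cutoff2 \<rho> R d'\<bar> \<le> 2 * R * \<bar>d - d'\<bar>"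
proof -
  define a b where "a = max \<rho> (min R d)" and "b = max \<rho> (min R d')"
  have ab: "0 < a" "a \<le> R" "0 < b" "b \<le> R" "\<bar>a - b\<bar> \<le> \<bar>d - d'\<bar>"
    using assms unfolding a_def b_def by auto
  have "\<bar>a\<^sup>2 - b\<^sup>2\<bar> = (a + b) * \<bar>a - b\<bar>"
    using ab by (simp add: power2_eq_square square_diff_square_factored abs_mult)
  also have "\<dots> \<le> (2 * R) * \<bar>d - d'\<bar>" using ab by (intro mult_mono) auto
  finally show ?thesis by (simp add: cutoff2_def a_def b_def)
qed

lemma soft_coefficients:
  assumes "lam > 0" "0 < \<rho>" "\<rho> \<le> R"
  shows "soft_pull lam \<rho> R p \<ge> 2 * pi * lam / R ^ 3"
    and "soft_pull lam \<rho> R p - soft_tilt lam \<rho> R p \<ge> 2 * pi * lam / R ^ 3"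
    and "soft_pull lam \<rho> R p \<le> 2 * pi * lam / \<rho> ^ 3"
    and "\<bar>soft_tilt lam \<rho> R p\<bar> \<le> soft_pull lam \<rho> R p"
  unfolding soft_pull_def soft_tilt_def
  using assms by (auto intro!: pull_ge_const pull_minus_tilt_ge pull_le abs_tilt_le_pull simp: cutoff2_bounds)

lemma dist_near_le_far_iff: "dist p (1, 0) \<le> dist p (- 1, 0 :: real) \<longleftrightarrow> 0 \<le> (fst p :: real)"
proof -
  have "dist p (1, 0) \<le> dist p (- 1, 0) \<longleftrightarrow> near2 p \<le> far2 p"
    unfolding near2_dist far2_dist by (simp add: power_mono_iff)
  also have "\<dots> \<longleftrightarrow> 0 \<le> fst p" by (simp add: near2_def far2_def power2_eq_square algebra_simps)
  finally show ?thesis .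
qed

text \<open>Clamping is monotone and the same for both distances, so the nearer point still attracts more.\<close>

lemma soft_tilt_sign:
  assumes "lam > 0" "0 < \<rho>" "\<rho> \<le> R"
  shows "fst p \<ge> 0 \<Longrightarrow> soft_tilt lam \<rho> R p \<ge> 0" "fst p \<le> 0 \<Longrightarrow> soft_tilt lam \<rho> R p \<le> 0"
proof -
  assume "fst p \<ge> 0"
  then show "soft_tilt lam \<rho> R p \<ge> 0"
    unfolding soft_tilt_def using assms
    by (intro tilt_nonneg cutoff2_mono) (auto simp: cutoff2_bounds dist_near_le_far_iff)
next
  assume "fst p \<le> 0"
  then have "dist p (- 1, 0) \<le> dist p (1, 0)"
    using dist_near_le_far_iff[of "- p"] dist_minus[of p "(1, 0)"] dist_minus[of p "(-1, 0)"] by simp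
  then have "tilt lam (cutoff2 \<rho> R (dist p (- 1, 0))) (cutoff2 \<rho> R (dist p (1, 0))) \<ge> 0"
    using assms by (intro tilt_nonneg cutoff2_mono) (auto simp: cutoff2_bounds)
  then show "soft_tilt lam \<rho> R p \<le> 0"
    unfolding soft_tilt_def using assms
    by (subst (asm) tilt_commute) (auto simp: cutoff2_bounds)
qed

lemma soft_lipschitz:
  assumes "lam > 0" "0 < \<rho>" "\<rho> \<le> R"
  defines "M \<equiv> 3 * pi * lam / \<rho> ^ 5 * (4 * R)"
  shows "\<bar>soft_pull lam \<rho> R p - soft_pull lam \<rho> R p'\<bar> \<le> M * norm (p - p')"
    and "\<bar>soft_tilt lam \<rho> R p - soft_tilt lam \<rho> R p'\<bar> \<le> M * norm (p - p')"
proof -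
  define D where "D = \<bar>cutoff2 \<rho> R (dist p (1, 0)) - cutoff2 \<rho> R (dist p' (1, 0))\<bar> +
      \<bar>cutoff2 \<rho> R (dist p (- 1, 0)) - cutoff2 \<rho> R (dist p' (- 1, 0))\<bar>"
  have c: "\<bar>cutoff2 \<rho> R (dist p a) - cutoff2 \<rho> R (dist p' a)\<bar> \<le> 2 * R * norm (p - p')" for a
  proof -
    have "\<bar>cutoff2 \<rho> R (dist p a) - cutoff2 \<rho> R (dist p' a)\<bar> \<le> 2 * R * \<bar>dist p a - dist p' a\<bar>"
      using assms by (intro cutoff2_lipschitz) auto
    also have "\<bar>dist p a - dist p' a\<bar> \<le> dist p p'" by (metis abs_dist_diff_le dist_commute)
    finally show ?thesis using assms by (simp add: dist_norm)
  qed
  have "D \<le> 4 * R * norm (p - p')" unfolding D_def using c[of "(1, 0)"] c[of "(- 1, 0)"] by simp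
  then have "3 * pi * lam / \<rho> ^ 5 * D \<le> 3 * pi * lam / \<rho> ^ 5 * (4 * R * norm (p - p'))"
    using assms by (intro mult_left_mono) auto
  then have D: "3 * pi * lam / \<rho> ^ 5 * D \<le> M * norm (p - p')" by (simp add: M_def)
  show "\<bar>soft_pull lam \<rho> R p - soft_pull lam \<rho> R p'\<bar> \<le> M * norm (p - p')"
    unfolding soft_pull_def
    by (rule order_trans[OF pull_lipschitz[of lam \<rho>] D[unfolded D_def]]) (use assms in \<open>auto simp: cutoff2_bounds\<close>)
  show "\<bar>soft_tilt lam \<rho> R p - soft_tilt lam \<rho> R p'\<bar> \<le> M * norm (p - p')"
    unfolding soft_tilt_def
    by (rule order_trans[OF tilt_lipschitz[of lam \<rho>] D[unfolded D_def]]) (use assms in \<open>auto simp: cutoff2_bounds\<close>)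
qed

lemma soft_pull_far:
  assumes "0 < \<rho>" "\<rho> \<le> R" "norm p \<ge> R + 1"
  shows "soft_pull lam \<rho> R p = pull lam (R\<^sup>2) (R\<^sup>2)"
proof -
  have "dist p a \<ge> R" if "norm a = 1" for a
    using norm_triangle_ineq2[of p a] that assms by (simp add: dist_norm)
  then have "dist p (1, 0) \<ge> R" "dist p (- 1, 0) \<ge> R" by (auto simp: norm_Pair)
  then show ?thesis using assms by (simp add: soft_pull_def cutoff2_def)
qed

text \<open>The force is a coefficient times a coordinate, and the coordinate is unbounded. The upper cutoff saves the
  Lipschitz bound: it makes the coefficient constant far away.\<close>

lemma lipschitz_mult_const_outside:
  fixes f g :: "'a::real_normed_vector \<Rightarrow> real"
  assumes f: "\<And>p p'. \<bar>f p - f p'\<bar> \<le> M * norm (p - p')" "\<And>p. \<bar>f p\<bar> \<le> Q"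
    and g: "\<And>p p'. \<bar>g p - g p'\<bar> \<le> norm (p - p')" "\<And>p. \<bar>g p\<bar> \<le> norm p"
    and out: "\<And>p. norm p \<ge> r \<Longrightarrow> f p = C" and "r > 0" "M \<ge> 0"
  shows "\<bar>f p * g p - f p' * g p'\<bar> \<le> (Q + M * r) * norm (p - p')"
proof -
  have *: "\<bar>f p * g p - f p' * g p'\<bar> \<le> (Q + M * r) * norm (p - p')" if "norm p' \<le> norm p" for p p'
  proof -
    have "f p * g p - f p' * g p' = f p * (g p - g p') + (f p - f p') * g p'"
      by (simp add: algebra_simps)
    then have "\<bar>f p * g p - f p' * g p'\<bar> \<le> \<bar>f p\<bar> * \<bar>g p - g p'\<bar> + \<bar>f p - f p'\<bar> * \<bar>g p'\<bar>"
      by (metis abs_mult abs_triangle_ineq)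
    also have "\<bar>f p\<bar> * \<bar>g p - g p'\<bar> \<le> Q * norm (p - p')"
      using f(2)[of p] g(1)[of p p'] by (intro mult_mono) auto
    also have "\<bar>f p - f p'\<bar> * \<bar>g p'\<bar> \<le> M * norm (p - p') * r"
    proof (cases "norm p' \<ge> r")
      case True
      then show ?thesis using out[of p] out[of p'] that assms(6,7) by simp
    next
      case False
      then show ?thesis using f(1)[of p p'] g(2)[of p'] assms(7) by (intro mult_mono) auto
    qed
    finally show ?thesis by (simp add: algebra_simps)
  qed
  show ?thesis
    using *[of p' p] *[of p p'] by (cases "norm p' \<le> norm p") (auto simp: norm_minus_commute abs_minus_commute)
qed

lemma abs_components_le_norm:
  fixes p :: "real \<times> real"
  shows "\<bar>fst p\<bar> \<le> norm p" "\<bar>snd p\<bar> \<le> norm p"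
  by (metis norm_fst_le prod.collapse real_norm_def, metis norm_snd_le prod.collapse real_norm_def)

lemma soft_field_lipschitz:
  assumes "lam > 0" "0 < \<rho>" "\<rho> \<le> R"
  obtains L where "L > 0"
    "\<And>y y' :: (real \<times> real) \<times> (real \<times> real).
      norm ((snd y, (soft_tilt lam \<rho> R (fst y) - soft_pull lam \<rho> R (fst y) * fst (fst y),
                     - soft_pull lam \<rho> R (fst y) * snd (fst y))) -
            (snd y', (soft_tilt lam \<rho> R (fst y') - soft_pull lam \<rho> R (fst y') * fst (fst y'),
                     - soft_pull lam \<rho> R (fst y') * snd (fst y')))) \<le> L * norm (y - y')"
proof -
  define M where "M = 3 * pi * lam / \<rho> ^ 5 * (4 * R)"
  define Q where "Q = 2 * pi * lam / \<rho> ^ 3"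
  define K where "K = Q + M * (R + 1)"
  have M: "M \<ge> 0" and Q: "Q \<ge> 0" using assms by (auto simp: M_def Q_def)
  have absQ: "\<bar>soft_pull lam \<rho> R p\<bar> \<le> Q" for p
    using soft_coefficients(3,4)[OF assms, of p] unfolding Q_def by linarith
  have prod: "\<bar>soft_pull lam \<rho> R p * g p - soft_pull lam \<rho> R p' * g p'\<bar> \<le> K * norm (p - p')"
    if "g = fst \<or> g = snd" for g and p p' :: "real \<times> real"
    unfolding K_def
  proof (rule lipschitz_mult_const_outside[where f="soft_pull lam \<rho> R"])
    show "\<bar>g p - g p'\<bar> \<le> norm (p - p')" "\<bar>g p\<bar> \<le> norm p" for p p'
      using that abs_components_le_norm[of p] abs_components_le_norm[of "p - p'"] by auto
  qed (use assms absQ M soft_lipschitz[OF assms] soft_pull_far in \<open>auto simp: M_def\<close>)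
  have K: "K \<ge> 0" unfolding K_def using M Q assms by simp
  show thesis
  proof (rule that[of "1 + M + 2 * K"])
    show "1 + M + 2 * K > 0" using M K by simp
    fix y y' :: "(real \<times> real) \<times> (real \<times> real)"
    define p p' where "p = fst y" and "p' = fst y'"
    have pp: "norm (p - p') \<le> norm (y - y')" "norm (snd y - snd y') \<le> norm (y - y')"
      unfolding p_def p'_def by (metis fst_diff norm_fst_le prod.collapse, metis snd_diff norm_snd_le prod.collapse)
    let ?a = "soft_tilt lam \<rho> R p - soft_pull lam \<rho> R p * fst p - (soft_tilt lam \<rho> R p' - soft_pull lam \<rho> R p' * fst p')"
    let ?b = "- soft_pull lam \<rho> R p * snd p - (- soft_pull lam \<rho> R p' * snd p')"
    have "norm ((snd y, (soft_tilt lam \<rho> R p - soft_pull lam \<rho> R p * fst p, - soft_pull lam \<rho> R p * snd p)) -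
            (snd y', (soft_tilt lam \<rho> R p' - soft_pull lam \<rho> R p' * fst p', - soft_pull lam \<rho> R p' * snd p')))
       = norm (snd y - snd y', (?a, ?b))" by simp
    also have "\<dots> \<le> norm (snd y - snd y') + norm (?a, ?b)" by (rule norm_Pair_le)
    also have "norm (?a, ?b) \<le> norm ?a + norm ?b" by (rule norm_Pair_le)
    also have "norm ?a \<le> (M + K) * norm (p - p')"
      using prod[of fst p p'] soft_lipschitz(2)[OF assms, of p p'] unfolding M_def[symmetric]
      by (simp add: algebra_simps)
    also have "norm ?b \<le> K * norm (p - p')"
      using prod[of snd p p'] by (simp add: abs_minus_commute)
    finally have "norm ((snd y, (soft_tilt lam \<rho> R p - soft_pull lam \<rho> R p * fst p, - soft_pull lam \<rho> R p * snd p)) -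
            (snd y', (soft_tilt lam \<rho> R p' - soft_pull lam \<rho> R p' * fst p', - soft_pull lam \<rho> R p' * snd p')))
       \<le> norm (snd y - snd y') + (M + 2 * K) * norm (p - p')" by (simp add: algebra_simps)
    also have "\<dots> \<le> norm (y - y') + (M + 2 * K) * norm (y - y')"
      using pp M K by (intro add_mono mult_left_mono) auto
    finally show "norm ((snd y, (soft_tilt lam \<rho> R (fst y) - soft_pull lam \<rho> R (fst y) * fst (fst y),
                     - soft_pull lam \<rho> R (fst y) * snd (fst y))) -
            (snd y', (soft_tilt lam \<rho> R (fst y') - soft_pull lam \<rho> R (fst y') * fst (fst y'),
                     - soft_pull lam \<rho> R (fst y') * snd (fst y')))) \<le> (1 + M + 2 * K) * norm (y - y')"
      unfolding p_def p'_def by (simp add: algebra_simps)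
  qed
qed

lemma soft_flow:
  assumes "lam > 0" "0 < \<rho>" "\<rho> \<le> R"
  obtains L and x z u w :: "real \<Rightarrow> real \<Rightarrow> real" where "L > 0"
    "\<And>v. x v 0 = x0" "\<And>v. z v 0 = 0" "\<And>v. u v 0 = 0" "\<And>v. w v 0 = v"
    "\<And>v t. t \<ge> 0 \<Longrightarrow> (x v has_real_derivative u v t) (at t within {0..})"
    "\<And>v t. t \<ge> 0 \<Longrightarrow> (z v has_real_derivative w v t) (at t within {0..})"
    "\<And>v t. t \<ge> 0 \<Longrightarrow> (u v has_real_derivative
        (soft_tilt lam \<rho> R (x v t, z v t) - soft_pull lam \<rho> R (x v t, z v t) * x v t)) (at t within {0..})"
    "\<And>v t. t \<ge> 0 \<Longrightarrow> (w v has_real_derivative - soft_pull lam \<rho> R (x v t, z v t) * z v t) (at t within {0..})"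
    "\<And>v v' t. t \<ge> 0 \<Longrightarrow> \<bar>x v t - x v' t\<bar> \<le> 2 * exp (2 * L * t) * \<bar>v - v'\<bar>"
    "\<And>v v' t. t \<ge> 0 \<Longrightarrow> \<bar>z v t - z v' t\<bar> \<le> 2 * exp (2 * L * t) * \<bar>v - v'\<bar>"
proof -
  define G where "G y = (snd y, (soft_tilt lam \<rho> R (fst y) - soft_pull lam \<rho> R (fst y) * fst (fst y),
      - soft_pull lam \<rho> R (fst y) * snd (fst y)))"
    for y :: "(real \<times> real) \<times> (real \<times> real)"
  obtain L where L: "L > 0" "\<And>y y'. norm (G y - G y') \<le> L * norm (y - y')"
    using soft_field_lipschitz[OF assms] unfolding G_def by blast
  obtain \<Phi> where \<Phi>: "\<And>y. \<Phi> y 0 = y"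
    "\<And>y t. t \<ge> 0 \<Longrightarrow> (\<Phi> y has_vector_derivative G (\<Phi> y t)) (at t within {0..})"
    "\<And>y y' t. t \<ge> 0 \<Longrightarrow> norm (\<Phi> y t - \<Phi> y' t) \<le> 2 * exp (2 * L * t) * norm (y - y')"
    using lipschitz_flow[OF L] by blast
  define y :: "real \<Rightarrow> (real \<times> real) \<times> (real \<times> real)" where "y v = ((x0, 0), (0, v))" for v
  have proj: "((\<lambda>t. h (\<Phi> (y v) t)) has_real_derivative h (G (\<Phi> (y v) t))) (at t within {0..})"
    if "bounded_linear h" "t \<ge> 0" for h :: "_ \<Rightarrow> real" and v t
    unfolding has_real_derivative_iff_has_vector_derivative
    by (rule bounded_linear.has_vector_derivative[OF that(1) \<Phi>(2)[OF that(2)]])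
  have yd: "norm (y v - y v') = \<bar>v - v'\<bar>" for v v' by (simp add: y_def norm_Pair)
  have bl: "bounded_linear (\<lambda>y::(real\<times>real)\<times>(real\<times>real). fst (fst y))"
    "bounded_linear (\<lambda>y::(real\<times>real)\<times>(real\<times>real). snd (fst y))"
    "bounded_linear (\<lambda>y::(real\<times>real)\<times>(real\<times>real). fst (snd y))"
    "bounded_linear (\<lambda>y::(real\<times>real)\<times>(real\<times>real). snd (snd y))"
    by (auto intro!: bounded_linear_intros bounded_linear_fst_comp bounded_linear_snd_comp)
  have c1: "\<bar>fst (fst a) - fst (fst b)\<bar> \<le> norm (a - b)" "\<bar>snd (fst a) - snd (fst b)\<bar> \<le> norm (a - b)"
    for a b :: "(real \<times> real) \<times> (real \<times> real)"
  proof -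
    have 2: "norm (fst c) \<le> norm c" for c :: "(real \<times> real) \<times> (real \<times> real)"
      by (metis norm_fst_le prod.collapse)
    show "\<bar>fst (fst a) - fst (fst b)\<bar> \<le> norm (a - b)" "\<bar>snd (fst a) - snd (fst b)\<bar> \<le> norm (a - b)"
      using abs_components_le_norm[of "fst (a - b)"] 2[of "a - b"] by auto
  qed
  show thesis
    by (rule that[of L "\<lambda>v t. fst (fst (\<Phi> (y v) t))" "\<lambda>v t. snd (fst (\<Phi> (y v) t))"
          "\<lambda>v t. fst (snd (\<Phi> (y v) t))" "\<lambda>v t. snd (snd (\<Phi> (y v) t))"])
      (use L(1) proj[OF bl(1)] proj[OF bl(2)] proj[OF bl(3)] proj[OF bl(4)]
           order_trans[OF c1(1) \<Phi>(3)] order_trans[OF c1(2) \<Phi>(3)]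
        in \<open>auto simp: \<Phi>(1) G_def yd[symmetric]\<close>, auto simp: y_def)
qed

section \<open>Confinement by energy and angular momentum\<close>

text \<open>For \<open>x \<ge> 0\<close> the nearest point of the circle is \<open>(1, 0)\<close>. This crude bound, weaker than the true
  logarithmic one, suffices everywhere.\<close>

lemma circle_potential_ge:
  assumes "lam > 0" "fst p \<ge> 0" "d > 0" "d = dist p (1, 0)"
  shows "circle_potential lam (plane_point 0 p) \<ge> - (2 * pi * lam / d)"
proof -
  have ab: "near2 p > 0" "near2 p \<le> far2 p" "d\<^sup>2 = near2 p"
    using assms dist_near_le_far_iff[of p] unfolding near2_dist far2_dist by (auto intro!: power_mono)
  have ne: "chord2 (near2 p) (far2 p) \<theta> > 0" for \<theta> using ab by (intro chord2_pos) auto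
  have "integral {0..2*pi} (\<lambda>\<theta>. lam / sqrt (chord2 (near2 p) (far2 p) (\<theta> - 0)))
      \<le> integral {0..2*pi} (\<lambda>\<theta>. lam / d)"
  proof (rule integral_le)
    fix \<theta> :: real
    have "d\<^sup>2 \<le> chord2 (near2 p) (far2 p) (\<theta> - 0)" using ab by (intro chord2_lower) auto
    then have "d \<le> sqrt (chord2 (near2 p) (far2 p) (\<theta> - 0))" using assms by (intro real_le_rsqrt) auto
    then show "lam / sqrt (chord2 (near2 p) (far2 p) (\<theta> - 0)) \<le> lam / d"
      using assms ne[of "\<theta> - 0"] by (intro divide_left_mono mult_pos_pos) auto
  qed (use ne in \<open>auto intro!: integrable_continuous_real continuous_intros simp: less_imp_neq[symmetric]\<close>)
  then show ?thesis unfolding circle_potential_plane_point by (simp add: field_simps)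
qed

lemma circle_potential_start_le:
  assumes "lam > 0" "x0 > 1"
  shows "circle_potential lam (plane_point 0 (x0, 0)) \<le> - (2 * pi * lam / (x0 + 1))"
proof -
  let ?p = "(x0, 0 :: real)"
  have ab: "near2 ?p > 0" "near2 ?p \<le> far2 ?p" "far2 ?p = (x0 + 1)\<^sup>2"
    using assms by (auto simp: near2_def far2_def intro!: power_mono)
  have ne: "chord2 (near2 ?p) (far2 ?p) \<theta> > 0" for \<theta> using ab by (intro chord2_pos) auto
  have "integral {0..2*pi} (\<lambda>\<theta>. lam / (x0 + 1)) \<le>
      integral {0..2*pi} (\<lambda>\<theta>. lam / sqrt (chord2 (near2 ?p) (far2 ?p) (\<theta> - 0)))"
  proof (rule integral_le)
    fix \<theta> :: real
    have "chord2 (near2 ?p) (far2 ?p) (\<theta> - 0) \<le> (x0 + 1)\<^sup>2" using ab by (intro chord2_upper) auto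
    then have "sqrt (chord2 (near2 ?p) (far2 ?p) (\<theta> - 0)) \<le> x0 + 1" using assms by (intro real_le_lsqrt) auto
    then show "lam / (x0 + 1) \<le> lam / sqrt (chord2 (near2 ?p) (far2 ?p) (\<theta> - 0))"
      using assms ne[of "\<theta> - 0"] by (intro divide_left_mono mult_pos_pos) auto
  qed (use ne in \<open>auto intro!: integrable_continuous_real continuous_intros simp: less_imp_neq[symmetric]\<close>)
  then show ?thesis unfolding circle_potential_plane_point by (simp add: field_simps)
qed

lemma plane_point_curve_deriv:
  assumes "(x has_real_derivative u) (at t within S)" "(z has_real_derivative w) (at t within S)"
  shows "((\<lambda>t. plane_point \<phi> (x t, z t)) has_vector_derivative plane_point \<phi> (u, w)) (at t within S)"
  using assms unfolding has_real_derivative_iff_has_vector_derivative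
  by (intro bounded_linear.has_vector_derivative[OF bounded_linear_plane_point] has_vector_derivative_Pair)

lemma potential_along_curve_deriv:
  assumes x: "(x has_real_derivative u) (at t within S)" and z: "(z has_real_derivative w) (at t within S)"
    and off: "plane_point \<phi> (x t, z t) \<notin> unit_circle"
  shows "((\<lambda>t. circle_potential lam (plane_point \<phi> (x t, z t))) has_real_derivative
     - (fst (ring_force lam (x t, z t)) * u + snd (ring_force lam (x t, z t)) * w)) (at t within S)"
proof -
  have "((\<lambda>t. circle_potential lam (plane_point \<phi> (x t, z t))) has_derivative
     (\<lambda>h. (h *\<^sub>R plane_point \<phi> (u, w)) \<bullet> (- plane_point \<phi> (ring_force lam (x t, z t))))) (at t within S)"
    using has_derivative_compose[OF plane_point_curve_deriv[OF x z, of \<phi>, unfolded has_vector_derivative_def]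
      circle_potential_gradient_plane[OF off, of lam, unfolded gderiv_def]] .
  then show ?thesis
    unfolding has_field_derivative_def
    by (rule has_derivative_eq_rhs) (auto simp: inner_plane_point fun_eq_iff algebra_simps)
qed

text \<open>An orbit of the modified force up to its return to \<open>z = 0\<close>. The bound on the initial speed makes the
  energy negative. The conditions on \<open>\<rho>\<close> and \<open>R\<close> are chosen so that conservation of energy and growth of
  the angular momentum about \<open>(1, 0)\<close> keep the distances to \<open>(\<plusminus>1, 0)\<close> strictly between \<open>\<rho>\<close> and \<open>R\<close>
  while \<open>x \<ge> 0\<close>.\<close>

locale soft_arc =
  planar_arc x z u w "\<lambda>t. soft_pull lam \<rho> R (x t, z t)" "\<lambda>t. soft_tilt lam \<rho> R (x t, z t)"
    "2 * pi * lam / R ^ 3" T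
  for x z u w lam \<rho> R T +
  assumes lam_pos: "lam > 0" and rho_pos: "\<rho> > 0" and x0_ge: "x 0 \<ge> 300"
    and energy_le: "(w 0)\<^sup>2 \<le> lam / x 0"
    and rho_less: "\<rho> < 1" "4 * pi * lam * \<rho> < ((x 0 - 1) * w 0)\<^sup>2"
    and R_gt: "R > pi * x 0 + 2"
begin

definition near where "near t = dist (x t, z t) (1, 0)"
definition far where "far t = dist (x t, z t) (- 1, 0)"

definition energy where
  "energy t = ((u t)\<^sup>2 + (w t)\<^sup>2) / 2 + circle_potential lam (plane_point 0 (x t, z t))"

lemma near_far_sq: "(near t)\<^sup>2 = (x t - 1)\<^sup>2 + (z t)\<^sup>2" "(far t)\<^sup>2 = (x t + 1)\<^sup>2 + (z t)\<^sup>2"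
  unfolding near_def far_def near2_dist[symmetric] far2_dist[symmetric]
  by (simp_all add: near2_def far2_def)

lemma near_far_nonneg [simp]: "near t \<ge> 0" "far t \<ge> 0"
  by (simp_all add: near_def far_def)

lemma near_sq_le_far_sq: "x t \<ge> 0 \<Longrightarrow> (near t)\<^sup>2 \<le> (far t)\<^sup>2"
  unfolding near_far_sq by (simp add: power2_eq_square algebra_simps)

lemma far_le: "far t \<le> near t + 2"
proof -
  have "far t \<le> near t + dist (1::real, 0::real) (- 1, 0)"
    unfolding near_def far_def
    by (rule dist_triangle)
  then show ?thesis by (simp add: dist_Pair_Pair dist_real_def)
qed

lemma abs_x_minus_one_le_near: "\<bar>x t - 1\<bar> \<le> near t"
  by (rule power2_le_imp_le) (auto simp: near_far_sq)

text \<open>The position at time \<open>t\<close> is one where the modified force is the true one.\<close>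

definition genuine where "genuine t \<longleftrightarrow> \<rho> \<le> near t \<and> \<rho> \<le> far t \<and> near t \<le> R \<and> far t \<le> R"

lemma genuine_coefficients:
  assumes "genuine t"
  shows "soft_pull lam \<rho> R (x t, z t) = pull lam ((near t)\<^sup>2) ((far t)\<^sup>2)"
    "soft_tilt lam \<rho> R (x t, z t) = tilt lam ((near t)\<^sup>2) ((far t)\<^sup>2)"
  using assms unfolding soft_pull_def soft_tilt_def genuine_def near_def far_def
  by (simp_all add: cutoff2_eq)

lemma genuine_ring_force:
  assumes "genuine t"
  shows "ring_force lam (x t, z t) =
    (soft_tilt lam \<rho> R (x t, z t) - soft_pull lam \<rho> R (x t, z t) * x t,
     - soft_pull lam \<rho> R (x t, z t) * z t)"
  unfolding genuine_coefficients[OF assms]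
  by (simp add: ring_force_def near2_dist far2_dist near_def far_def)

lemma genuine_off_circle:
  assumes "genuine t"
  shows "plane_point \<phi> (x t, z t) \<notin> unit_circle"
proof -
  have "near t > 0" "far t > 0" using assms rho_pos by (auto simp: genuine_def)
  then show ?thesis
    unfolding plane_point_in_unit_circle_iff near2_dist far2_dist by (auto simp: near_def far_def)
qed

lemma energy_const:
  assumes "0 \<le> t" and gen: "\<And>s. 0 \<le> s \<Longrightarrow> s \<le> t \<Longrightarrow> genuine s"
  shows "energy t = energy 0"
proof (cases "t = 0")
  case False
  then have t: "0 < t" using assms by simp
  have d: "(energy has_real_derivative 0) (at s within {0..})" if s: "0 \<le> s" "s \<le> t" for s
  proof -
    have P: "((\<lambda>t. circle_potential lam (plane_point 0 (x t, z t))) has_real_derivative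
     - (fst (ring_force lam (x s, z s)) * u s + snd (ring_force lam (x s, z s)) * w s)) (at s within {0..})"
      by (intro potential_along_curve_deriv dx dz genuine_off_circle gen s)
    have "((\<lambda>t. ((u t)\<^sup>2 + (w t)\<^sup>2) / 2) has_real_derivative
      (fst (ring_force lam (x s, z s)) * u s + snd (ring_force lam (x s, z s)) * w s)) (at s within {0..})"
      unfolding genuine_ring_force[OF gen[OF s]]
      using s by (auto intro!: derivative_eq_intros du dw simp: field_simps)
    from DERIV_add[OF this P] show ?thesis unfolding energy_def[abs_def] by simp
  qed
  obtain \<xi> where "energy t - energy 0 = 0 * (t - 0)"
    using mvt_half_line[OF _ t d] by auto
  then show ?thesis by simp
qed simp

lemma energy_start: "energy 0 \<le> - (2 * lam / x 0)"
proof -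
  have "energy 0 \<le> lam / x 0 / 2 - 2 * pi * lam / (x 0 + 1)"
    using circle_potential_start_le[OF lam_pos, of "x 0"] energy_le start x0_ge
    unfolding energy_def by simp
  moreover define k where "k = lam / x 0"
  moreover have "5 / 2 * k \<le> 2 * pi * lam / (x 0 + 1)"
  proof -
    have "5 * lam * (x 0 + 1) \<le> 12 * lam * x 0"
      using lam_pos x0_ge by (simp add: algebra_simps)
    also have "\<dots> \<le> 4 * pi * lam * x 0" using lam_pos x0_ge pi_gt3 by simp
    finally show ?thesis using x0_ge by (simp add: k_def field_simps)
  qed
  moreover have "2 * lam / x 0 = 2 * k" by (simp add: k_def)
  ultimately show ?thesis by simp
qed

text \<open>The energy is at most \<open>- 2 lam / x0\<close>, while the potential is at least \<open>- 2 pi lam / d\<close> at distance \<open>d\<close>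
  from \<open>(1, 0)\<close>. So the speed is \<open>O(1 / sqrt d)\<close> and \<open>d\<close> is bounded. The angular momentum about \<open>(1, 0)\<close> is at
  most \<open>d\<close> times the speed, hence \<open>O(sqrt d)\<close>; as it never falls below its initial value, \<open>d\<close> is
  bounded below.\<close>

lemma genuine_bounds:
  assumes t: "0 \<le> t" "t \<le> T" and gen: "\<And>s. 0 \<le> s \<Longrightarrow> s \<le> t \<Longrightarrow> genuine s" and xt: "x t \<ge> 0"
  shows "(u t)\<^sup>2 + (w t)\<^sup>2 \<le> 4 * pi * lam / near t"
    and "near t \<le> pi * x 0" and "((x 0 - 1) * w 0)\<^sup>2 \<le> 4 * pi * lam * near t"
proof -
  have n: "near t > 0" using gen[of t] t rho_pos unfolding genuine_def by simp
  have V: "circle_potential lam (plane_point 0 (x t, z t)) \<ge> - (2 * pi * lam / near t)"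
    using n xt by (intro circle_potential_ge[OF lam_pos]) (auto simp: near_def)
  have E: "energy t \<le> - (2 * lam / x 0)" using energy_const[OF t(1) gen] energy_start by simp
  have "2 * lam / x 0 > 0" using lam_pos x0_ge by simp
  then have "((u t)\<^sup>2 + (w t)\<^sup>2) / 2 \<le> 2 * pi * lam / near t"
    using V E unfolding energy_def by linarith
  then show sp: "(u t)\<^sup>2 + (w t)\<^sup>2 \<le> 4 * pi * lam / near t" by simp
  have "((u t)\<^sup>2 + (w t)\<^sup>2) / 2 \<ge> 0" by simp
  then have "2 * lam / x 0 \<le> 2 * pi * lam / near t"
    using V E unfolding energy_def by linarith
  then show "near t \<le> pi * x 0" using n lam_pos x0_ge by (simp add: field_simps)
  let ?l = "(x t - 1) * w t - z t * u t"
  have "(x 0 - 1) * w 0 \<le> ?l" by (rule angular_momentum_circle_ge[OF t])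
  then have "((x 0 - 1) * w 0)\<^sup>2 \<le> ?l\<^sup>2" using start by (intro power_mono) auto
  also have "?l\<^sup>2 \<le> (near t)\<^sup>2 * ((u t)\<^sup>2 + (w t)\<^sup>2)"
  proof -
    have "0 \<le> ((x t - 1) * u t + z t * w t)\<^sup>2" by simp
    then show ?thesis unfolding near_far_sq by (simp add: power2_eq_square algebra_simps)
  qed
  also have "\<dots> \<le> (near t)\<^sup>2 * (4 * pi * lam / near t)" using sp by (intro mult_left_mono) auto
  also have "\<dots> = 4 * pi * lam * near t" using n by (simp add: power2_eq_square)
  finally show "((x 0 - 1) * w 0)\<^sup>2 \<le> 4 * pi * lam * near t" .
qed

text \<open>Bootstrap: while the modified force is the true one the energy is conserved, and the resulting bounds on
  the distances are strictly inside the range of the cutoff.\<close>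

lemma genuine_while_x_nonneg:
  assumes t: "0 \<le> t" "t \<le> T" and x: "\<And>s. 0 \<le> s \<Longrightarrow> s \<le> t \<Longrightarrow> x s \<ge> 0"
  shows "genuine t"
proof -
  \<comment> \<open>for \<open>x \<ge> 0\<close> the point \<open>(1, 0)\<close> is the nearer one, so these two of the four bounds suffice\<close>
  define f where "f s = min (near s - \<rho>) (R - far s)" for s
  have gen: "genuine s" if "f s \<ge> 0" "0 \<le> s" "s \<le> t" for s
  proof -
    have "near s \<le> far s" using x[of s] that dist_near_le_far_iff[of "(x s, z s)"]
      by (simp add: near_def far_def)
    then show ?thesis using that unfolding genuine_def f_def by auto
  qed
  have "f t > 0"
  proof (rule continuation_positive[of 0 t f])
    show "continuous_on {0..t} f"
      unfolding f_def near_def far_def by (intro continuous_intros continuous_motion) auto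
    have "near 0 = x 0 - 1" "far 0 = x 0 + 1"
      using start x0_ge by (auto simp: near_def far_def dist_Pair_Pair dist_real_def)
    moreover have "3 * x 0 \<le> pi * x 0" using pi_gt3 x0_ge by (intro mult_right_mono) auto
    ultimately show "f 0 > 0"
      using rho_less(1) R_gt x0_ge unfolding f_def min_less_iff_conj by linarith
    fix r assume r: "0 < r" "r \<le> t" and nn: "\<And>s. 0 \<le> s \<Longrightarrow> s \<le> r \<Longrightarrow> f s \<ge> 0"
    have gens: "genuine s" if "0 \<le> s" "s \<le> r" for s using gen nn that r by auto
    note b = genuine_bounds[of r, OF _ _ gens x[of r]]
    have "4 * pi * lam * \<rho> < 4 * pi * lam * near r" using b(3) rho_less(2) r t by linarith
    then have "\<rho> < near r" using lam_pos by simp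
    moreover have "far r < R" using b(2) far_le[of r] R_gt r t by simp
    ultimately show "f r > 0" unfolding f_def by simp
  qed (use t in auto)
  then show ?thesis using gen[of t] t by simp
qed

lemma bounds:
  assumes t: "0 \<le> t" "t \<le> T" and x: "\<And>s. 0 \<le> s \<Longrightarrow> s \<le> t \<Longrightarrow> x s \<ge> 0"
  shows "genuine t" "(u t)\<^sup>2 + (w t)\<^sup>2 \<le> 4 * pi * lam / near t"
  using genuine_while_x_nonneg[OF t x]
    genuine_bounds[OF t genuine_while_x_nonneg x] t x by auto

end

section \<open>Fast and slow launches\<close>

context soft_arc begin

text \<open>It suffices that the angular momentum \<open>l\<close> about the centre stays positive for as long as \<open>x \<ge> 0\<close>:
  returning with \<open>x \<ge> 0\<close> would mean \<open>l = x w \<le> 0\<close>. At distance \<open>r \<ge> 2\<close> from the centre the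
  tilt is at most \<open>16 pi lam / r\<^sup>3\<close>, and \<open>(x / r)' = - z l / r\<^sup>3\<close>; therefore
  \<open>l\<^sup>2 / 2 - 16 pi lam x / r\<close> does not decrease. As \<open>x / r\<close> stays between \<open>0\<close> and \<open>1\<close>, the total loss of
  \<open>l\<^sup>2\<close> is at most \<open>32 pi lam\<close>, little compared to the initial value \<open>lam x0\<close>. What remains of \<open>l\<close> is too
  large for an orbit of negative energy to come down to \<open>r = 2\<close>.\<close>

lemma x_end_neg_if_fast:
  assumes fast: "(w 0)\<^sup>2 = lam / x 0"
  shows "x T < 0"
proof (rule ccontr)
  assume "\<not> x T < 0"
  then have xnn: "x t \<ge> 0" if "0 \<le> t" "t \<le> T" for t using x_nonneg[of t] that by simp
  define l where "l t = x t * w t - z t * u t" for t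
  define n where "n t = (x t)\<^sup>2 + (z t)\<^sup>2" for t
  define f where "f t = min (n t - 4) (l t)" for t
  have l0: "l 0 > 0" "(l 0)\<^sup>2 = lam * x 0"
    using start fast x0_ge by (simp_all add: l_def power_mult_distrib) (simp add: power2_eq_square)
  have "f T > 0"
  proof (rule continuation_positive[of 0 T f])
    show "continuous_on {0..T} f"
      unfolding f_def l_def n_def by (intro continuous_intros continuous_motion) auto
    have "300 * 300 \<le> x 0 * x 0" using x0_ge by (intro mult_mono) auto
    then show "f 0 > 0" unfolding f_def using l0(1) start by (simp add: n_def power2_eq_square)
    fix t assume t: "0 < t" "t \<le> T" and nn: "\<And>s. 0 \<le> s \<Longrightarrow> s \<le> t \<Longrightarrow> f s \<ge> 0"
    have ns: "n s \<ge> 4" "l s \<ge> 0" if "0 \<le> s" "s \<le> t" for s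
      using nn[OF that] by (auto simp: f_def)
    have near_ge: "near s \<ge> sqrt (n s) / 2" "near s \<ge> sqrt (n s) - 1" if s: "0 \<le> s" "s \<le> t" for s
    proof -
      have r: "sqrt (n s) \<ge> 2" using ns[OF s] by (intro real_le_rsqrt) auto
      have "sqrt (n s) = dist (x s, z s) (0, 0)" by (simp add: n_def dist_Pair_Pair dist_real_def)
      also have "\<dots> \<le> near s + dist (1 :: real, 0 :: real) (0, 0)" unfolding near_def by (rule dist_triangle)
      also have "dist (1 :: real, 0 :: real) (0, 0) = 1" by (simp add: dist_Pair_Pair)
      finally show "near s \<ge> sqrt (n s) - 1" by simp
      then show "near s \<ge> sqrt (n s) / 2" using r by linarith
    qed
    \<comment> \<open>the monotone quantity; \<open>16\<close> is \<open>2\<close> from the length of the circle times \<open>8\<close> from \<open>r - 1 \<ge> r / 2\<close>\<close>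
    define J where "J s = (l s)\<^sup>2 / 2 - 16 * pi * lam * (x s / sqrt (n s))" for s
    have dJ: "(J has_real_derivative z s * l s * (16 * pi * lam / (n s * sqrt (n s)) - soft_tilt lam \<rho> R (x s, z s)))
        (at s within {0..})" if s: "0 \<le> s" "s \<le> t" for s
    proof -
      have np: "n s > 0" using ns[OF s] by simp
      have dn: "(n has_real_derivative 2 * (x s * u s + z s * w s)) (at s within {0..})"
        unfolding n_def[abs_def] using s by (auto intro!: derivative_eq_intros dx dz)
      have dl: "(l has_real_derivative - z s * soft_tilt lam \<rho> R (x s, z s)) (at s within {0..})"
        unfolding l_def[abs_def] by (rule angular_momentum_center_deriv[OF s(1)])
      have dsq: "((\<lambda>s. sqrt (n s)) has_real_derivative (x s * u s + z s * w s) / sqrt (n s)) (at s within {0..})"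
        by (rule DERIV_cong[OF DERIV_chain2[OF DERIV_real_sqrt[OF np] dn]]) (simp add: divide_simps)
      define r where "r = sqrt (n s)"
      have r: "r > 0" "r * r = n s" unfolding r_def using np by auto
      have "u s * (r * r) - x s * (x s * u s + z s * w s) = - z s * l s"
        unfolding r by (simp add: n_def l_def power2_eq_square algebra_simps)
      moreover have "u s * r - x s * ((x s * u s + z s * w s) / r) = (u s * (r * r) - x s * (x s * u s + z s * w s)) / r"
        using r(1) by (simp add: diff_divide_distrib)
      ultimately have "u s * r - x s * ((x s * u s + z s * w s) / r) = - z s * l s / r"
        by simp
      then have "(u s * sqrt (n s) - x s * ((x s * u s + z s * w s) / sqrt (n s))) / (sqrt (n s) * sqrt (n s))
         = - z s * l s / (n s * sqrt (n s))"
        unfolding r_def[symmetric] r(2) by simp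
      then have dq: "((\<lambda>s. x s / sqrt (n s)) has_real_derivative - z s * l s / (n s * sqrt (n s))) (at s within {0..})"
        using DERIV_divide[OF dx[OF s(1)] dsq] np by simp
      have "((\<lambda>s. (l s)\<^sup>2 / 2) has_real_derivative l s * (- z s * soft_tilt lam \<rho> R (x s, z s))) (at s within {0..})"
        by (auto intro!: derivative_eq_intros dl)
      from DERIV_diff[OF this DERIV_cmult[OF dq, of "16 * pi * lam"]]
      have "(J has_real_derivative l s * (- z s * soft_tilt lam \<rho> R (x s, z s))
          - 16 * pi * lam * (- z s * l s / (n s * sqrt (n s)))) (at s within {0..})"
        unfolding J_def[abs_def] .
      then show ?thesis by (simp add: algebra_simps)
    qed
    obtain \<xi> where \<xi>: "0 < \<xi>" "\<xi> < t" "J t - J 0 = z \<xi> * l \<xi> *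
        (16 * pi * lam / (n \<xi> * sqrt (n \<xi>)) - soft_tilt lam \<rho> R (x \<xi>, z \<xi>)) * (t - 0)"
      using mvt_half_line[OF _ t(1) dJ] by auto
    have gen: "genuine \<xi>" using genuine_while_x_nonneg[of \<xi>] xnn \<xi> t by simp
    have np: "n \<xi> > 0" using ns[of \<xi>] \<xi> by simp
    have "soft_tilt lam \<rho> R (x \<xi>, z \<xi>) \<le> pull lam ((near \<xi>)\<^sup>2) ((far \<xi>)\<^sup>2)"
      using m_less_q[of \<xi>] \<xi> unfolding genuine_coefficients(1)[OF gen] by simp
    also have "\<dots> \<le> 2 * pi * lam / (sqrt (n \<xi>) / 2) ^ 3"
    proof (rule pull_le[OF lam_pos])
      show "(sqrt (n \<xi>) / 2)\<^sup>2 \<le> (near \<xi>)\<^sup>2" using near_ge(1)[of \<xi>] \<xi> np by (intro power_mono) auto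
      also have "(near \<xi>)\<^sup>2 \<le> (far \<xi>)\<^sup>2" using xnn[of \<xi>] \<xi> t by (intro near_sq_le_far_sq) simp
      finally show "(sqrt (n \<xi>) / 2)\<^sup>2 \<le> (far \<xi>)\<^sup>2" .
    qed (use np in simp)
    also have "\<dots> = 16 * pi * lam / (n \<xi> * sqrt (n \<xi>))"
      using np by (simp add: power3_eq_cube field_simps)
    finally have "16 * pi * lam / (n \<xi> * sqrt (n \<xi>)) - soft_tilt lam \<rho> R (x \<xi>, z \<xi>) \<ge> 0" by simp
    moreover have "z \<xi> \<ge> 0" "l \<xi> \<ge> 0" using ns(2)[of \<xi>] z_pos[of \<xi>] \<xi> t by auto
    ultimately have "J t - J 0 \<ge> 0"
      unfolding \<xi>(3) using t by (intro mult_nonneg_nonneg) auto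
    then have "J t \<ge> J 0" by simp
    moreover have "J 0 = lam * x 0 / 2 - 16 * pi * lam"
      using l0 start by (simp add: J_def n_def)
    moreover have "16 * pi * lam * (x t / sqrt (n t)) \<ge> 0"
      using xnn[of t] ns[of t] t lam_pos by simp
    ultimately have lt2: "(l t)\<^sup>2 \<ge> lam * x 0 - 32 * pi * lam"
      unfolding J_def by linarith
    \<comment> \<open>\<open>x0 \<ge> 300\<close> is more than enough for \<open>lam x0 - 32 pi lam > 16 pi lam\<close>\<close>
    define P X where "P = pi * lam" and "X = lam * x 0"
    have "300 * lam \<le> X" unfolding X_def using x0_ge lam_pos by simp
    moreover have "P < 4 * lam" unfolding P_def using lam_pos pi_less_4 by (intro mult_strict_right_mono) auto
    moreover have "(l t)\<^sup>2 \<ge> X - 32 * P" using lt2 by (simp add: P_def X_def)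
    ultimately have "(l t)\<^sup>2 > 16 * P" using lam_pos by linarith
    then have l2: "(l t)\<^sup>2 > 4 * 4 * pi * lam" by (simp add: P_def)
    then have "(l t)\<^sup>2 > 0" using lam_pos by (smt (verit) pi_gt_zero mult_pos_pos)
    then have lpos: "l t > 0" using ns(2)[of t] t by (cases "l t = 0") auto
    have "n t > 4"
    proof (rule ccontr)
      \<comment> \<open>at \<open>r = 2\<close> negative energy allows only \<open>l\<^sup>2 \<le> r\<^sup>2 (4 pi lam) = 16 pi lam\<close>\<close>
      assume "\<not> n t > 4"
      then have n4: "n t = 4" using ns[of t] t by simp
      have n1: "near t \<ge> 1" using near_ge(2)[of t] t n4 by simp
      have "(l t)\<^sup>2 \<le> n t * ((u t)\<^sup>2 + (w t)\<^sup>2)"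
      proof -
        have "0 \<le> (x t * u t + z t * w t)\<^sup>2" by simp
        then show ?thesis unfolding l_def n_def by (simp add: power2_eq_square algebra_simps)
      qed
      also have "\<dots> \<le> 4 * (4 * pi * lam / near t)"
        unfolding n4 using bounds(2)[of t] xnn t by (intro mult_left_mono) auto
      also have "\<dots> \<le> 4 * (4 * pi * lam)"
        using n1 lam_pos divide_left_mono[of 1 "near t" "4 * pi * lam"] by simp
      finally show False using l2 by simp
    qed
    then show "f t > 0" using lpos by (simp add: f_def)
  qed (use T_pos in auto)
  then have "x T * w T > 0" using z_T by (simp add: f_def l_def)
  then show False using w_T_neg xnn[of T] T_pos by (simp add: zero_less_mult_iff)
qed

text \<open>Suppose the orbit reached \<open>x = 0\<close> first. Fix a small \<open>\<delta>\<close>. A slow orbit is still lower than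
  \<open>\<delta>\<close> when \<open>x\<close> runs through the window from \<open>1 + 2 \<delta>\<close> to \<open>1 + \<delta>\<close>. There the pull is of order \<open>lam / \<delta>\<^sup>2\<close>
  while the speed is only \<open>O(1 / sqrt \<delta>)\<close>, so the time spent is at least of order \<open>\<delta> sqrt \<delta>\<close>. By the Riccati equation
  \<open>s' = - q - s\<^sup>2\<close> for \<open>s = w / z\<close>, the passage lowers \<open>s\<close> by an amount of order \<open>1 / sqrt \<delta>\<close>, to a large
  negative value. As \<open>z\<close> is concave, the orbit must be down shortly afterwards. But on the way from
  \<open>x = 3/4\<close> to \<open>x = 1/4\<close> it is far from the circle and moves at bounded speed, so it needs
  too long to get there.\<close>

lemma x_end_pos_if_slow:
  assumes slow: "w 0 * sqrt (2 * x 0 / (2 * pi * lam / R ^ 3)) \<le> 1 / 2000 ^ 2"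
  shows "x T > 0"
proof (rule ccontr)
  \<comment> \<open>smaller than \<open>1 / (540 pi)\<close>, so that the passage lowers \<open>w / z\<close> by at least \<open>5 \<mu>\<close>\<close>
  define \<sigma> :: real where "\<sigma> = 1 / 2000"
  define \<delta> where "\<delta> = \<sigma>\<^sup>2"
  \<comment> \<open>the speed at distance \<open>d\<close> from \<open>(1, 0)\<close> is at most \<open>\<mu> / sqrt d\<close>\<close>
  define \<mu> where "\<mu> = sqrt (4 * pi * lam)"
  define c where "c = 2 * pi * lam / R ^ 3"
  have \<sigma>: "\<sigma> > 0" and \<delta>: "\<delta> > 0" "\<delta> \<le> 1/1000" and \<mu>: "\<mu> > 0" "\<mu>\<^sup>2 = 4 * pi * lam"
    using lam_pos by (auto simp: \<sigma>_def \<delta>_def \<mu>_def power2_eq_square)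
  have c: "c > 0" using c_pos by (simp add: c_def)
  assume "\<not> x T > 0"
  then have xT: "x T \<le> 0" by simp
  note cont = continuous_motion
  have cx: "continuous_on S (\<lambda>t. x t - k)" if "S \<subseteq> {0..}" for S k
    using that by (intro continuous_intros cont)
  obtain td where td: "0 < td" "td \<le> T" "x td = 1/4" "\<And>s. 0 \<le> s \<Longrightarrow> s < td \<Longrightarrow> x s > 1/4"
    using first_zero_in[of 0 T "\<lambda>t. x t - 1/4"] cx[of "{0..T}"] xT x0_ge T_pos by auto
  have tdT: "td < T" using td xT by (cases "td = T") auto
  obtain tb where tb: "0 < tb" "tb \<le> td" "x tb = 1 + \<delta>" "\<And>s. 0 \<le> s \<Longrightarrow> s < tb \<Longrightarrow> x s > 1 + \<delta>"
    using first_zero_in[of 0 td "\<lambda>t. x t - (1 + \<delta>)"] cx[of "{0..td}"] td x0_ge \<delta> by auto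
  obtain ta where ta: "0 < ta" "ta \<le> tb" "x ta = 1 + 2 * \<delta>" "\<And>s. 0 \<le> s \<Longrightarrow> s < ta \<Longrightarrow> x s > 1 + 2 * \<delta>"
    using first_zero_in[of 0 tb "\<lambda>t. x t - (1 + 2 * \<delta>)"] cx[of "{0..tb}"] tb x0_ge \<delta> by auto
  obtain te where te: "0 < te" "te \<le> ta" "x te = 2" "\<And>s. 0 \<le> s \<Longrightarrow> s < te \<Longrightarrow> x s > 2"
    using first_zero_in[of 0 ta "\<lambda>t. x t - 2"] cx[of "{0..ta}"] ta x0_ge \<delta> by auto
  have tab: "ta < tb" using ta tb \<delta> by (cases "ta = tb") auto
  have tbd: "tb < td" using tb td \<delta> by (cases "tb = td") auto
  have xnn: "x s \<ge> 1/4" if "0 \<le> s" "s \<le> td" for s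
    using td(3) td(4)[of s] that by (cases "s = td") auto
  have gen: "genuine s" and sp: "(u s)\<^sup>2 + (w s)\<^sup>2 \<le> \<mu>\<^sup>2 / near s" if s: "0 \<le> s" "s \<le> td" for s
  proof -
    have "x r \<ge> 0" if "0 \<le> r" "r \<le> s" for r using xnn[of r] that s by linarith
    moreover have "s \<le> T" using s td by linarith
    ultimately show "genuine s" "(u s)\<^sup>2 + (w s)\<^sup>2 \<le> \<mu>\<^sup>2 / near s"
      unfolding \<mu>(2) using s(1) by (blast intro: bounds)+
  qed
  have abs_u: "\<bar>u s\<bar> \<le> \<mu> / d" if "0 \<le> s" "s \<le> td" "d > 0" "d\<^sup>2 \<le> \<bar>x s - 1\<bar>" for s d
  proof (rule power2_le_imp_le)
    have n: "d\<^sup>2 \<le> near s" using abs_x_minus_one_le_near[of s] that by simp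
    have d2: "d\<^sup>2 > 0" using that by simp
    have "(u s)\<^sup>2 \<le> (u s)\<^sup>2 + (w s)\<^sup>2" by simp
    also have "\<dots> \<le> \<mu>\<^sup>2 / near s" using sp that by simp
    also have "\<dots> \<le> \<mu>\<^sup>2 / d\<^sup>2"
      using n d2 less_le_trans[OF d2 n] by (intro divide_left_mono mult_pos_pos) auto
    finally show "\<bar>u s\<bar>\<^sup>2 \<le> (\<mu> / d)\<^sup>2" by (simp add: power_divide)
  qed (use that \<mu> in simp)
  \<comment> \<open>the window is not reached early, which bounds \<open>w / z \<le> 1 / t\<close> on entering it\<close>
  have "\<mu> * ta \<ge> 1"
  proof -
    obtain \<xi> where \<xi>: "0 < \<xi>" "\<xi> < te" "x te - x 0 = u \<xi> * (te - 0)"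
      using mvt_half_line[OF _ te(1) dx] by auto
    have "x \<xi> > 2" using te(4)[of \<xi>] \<xi> by simp
    moreover have "\<xi> \<le> td" using \<xi> te(2) ta(2) tb(2) by linarith
    ultimately have "\<bar>u \<xi>\<bar> \<le> \<mu>" using abs_u[of \<xi> 1] \<xi> by simp
    then have "\<bar>u \<xi> * te\<bar> \<le> \<mu> * te" using te by (simp add: abs_mult)
    also have "\<dots> \<le> \<mu> * ta" using te \<mu> by simp
    finally show ?thesis using \<xi> te x0_ge by simp
  qed
  have u_le: "u s \<le> - c * s" if s: "0 \<le> s" "s \<le> tb" for s
  proof (cases "s = 0")
    case False
    then have s0: "0 < s" using s by simp
    obtain \<xi> where \<xi>: "0 < \<xi>" "\<xi> < s" "u s - u 0 =
       (soft_tilt lam \<rho> R (x \<xi>, z \<xi>) - soft_pull lam \<rho> R (x \<xi>, z \<xi>) * x \<xi>) * (s - 0)"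
      using mvt_half_line[OF _ s0 du] by auto
    have x1: "x \<xi> \<ge> 1" using tb(4)[of \<xi>] \<xi> s \<delta> by simp
    have "0 \<le> soft_pull lam \<rho> R (x \<xi>, z \<xi>)" using q_ge[of \<xi>] c \<xi> by (simp add: c_def)
    then have "soft_pull lam \<rho> R (x \<xi>, z \<xi>) * 1 \<le> soft_pull lam \<rho> R (x \<xi>, z \<xi>) * x \<xi>"
      using x1 by (intro mult_left_mono)
    moreover have "soft_pull lam \<rho> R (x \<xi>, z \<xi>) - soft_tilt lam \<rho> R (x \<xi>, z \<xi>) \<ge> c"
    proof -
      have "\<rho> \<le> R" using gen[of 0] td by (simp add: genuine_def)
      then show ?thesis unfolding c_def by (rule soft_coefficients(2)[OF lam_pos rho_pos])
    qed
    ultimately have "soft_tilt lam \<rho> R (x \<xi>, z \<xi>) - soft_pull lam \<rho> R (x \<xi>, z \<xi>) * x \<xi> \<le> - c" by simp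
    then have "(soft_tilt lam \<rho> R (x \<xi>, z \<xi>) - soft_pull lam \<rho> R (x \<xi>, z \<xi>) * x \<xi>) * s \<le> - c * s"
      using s by (intro mult_right_mono)
    then show ?thesis using \<xi> start by simp
  qed (use start in simp)
  have tb_le: "tb \<le> sqrt (2 * x 0 / c)"
  proof -
    have d: "((\<lambda>s. x s + c * s\<^sup>2 / 2) has_real_derivative u s + c * s) (at s within {0..})" if "0 \<le> s" "s \<le> tb" for s
      using that by (auto intro!: derivative_eq_intros dx)
    obtain \<xi> where \<xi>: "0 < \<xi>" "\<xi> < tb" "(x tb + c * tb\<^sup>2 / 2) - (x 0 + c * 0\<^sup>2 / 2) = (u \<xi> + c * \<xi>) * (tb - 0)"
      using mvt_half_line[OF _ tb(1) d] by auto
    have "(u \<xi> + c * \<xi>) * tb \<le> 0" using u_le[of \<xi>] \<xi> tb by (intro mult_nonpos_nonneg) auto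
    then have "c * tb\<^sup>2 / 2 \<le> x 0" using \<xi> tb(3) \<delta> by simp
    then have "tb\<^sup>2 \<le> 2 * x 0 / c" using c by (simp add: field_simps)
    then show ?thesis by (rule real_le_rsqrt)
  qed
  \<comment> \<open>the only use of the slow start: the orbit is in the window soon, and still low\<close>
  have zs: "z s \<le> \<delta>" if "0 \<le> s" "s \<le> tb" for s
  proof -
    have "z s \<le> w 0 * s" using z_le[of s] that tb td by simp
    also have "\<dots> \<le> w 0 * sqrt (2 * x 0 / c)" using that tb_le start by (intro mult_left_mono) auto
    also have "\<dots> \<le> \<delta>" using slow by (simp add: c_def \<delta>_def \<sigma>_def power2_eq_square)
    finally show ?thesis .
  qed
  have xs: "1 + \<delta> \<le> x s" "x s \<le> 1 + 2 * \<delta>" if s: "ta \<le> s" "s \<le> tb" for s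
  proof -
    show "1 + \<delta> \<le> x s" using tb(3) tb(4)[of s] s ta by (cases "s = tb") auto
    show "x s \<le> 1 + 2 * \<delta>"
    proof (cases "s = ta")
      case False
      then have s': "ta < s" using s by simp
      obtain \<xi> where \<xi>: "ta < \<xi>" "\<xi> < s" "x s - x ta = u \<xi> * (s - ta)"
        using mvt_half_line[OF _ s' dx] ta by auto
      have "u \<xi> \<le> - c * \<xi>" using u_le[of \<xi>] \<xi> s ta by simp
      also have "\<dots> \<le> 0" using c \<xi> ta by simp
      finally have "u \<xi> * (s - ta) \<le> 0" using s' by (intro mult_nonpos_nonneg) auto
      then show ?thesis using \<xi> ta by simp
    qed (use ta in simp)
  qed
  have q_big: "soft_pull lam \<rho> R (x s, z s) \<ge> lam / (27 * \<delta>\<^sup>2)" if s: "ta \<le> s" "s \<le> tb" for s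
  proof -
    have s0: "0 \<le> s" "s \<le> td" using s ta tb by auto
    have z: "0 \<le> z s" "z s \<le> \<delta>" using z_nonneg[of s] zs[of s] s s0 td by auto
    have zz: "(z s)\<^sup>2 \<le> \<delta>\<^sup>2" using z by (intro power_mono) auto
    have xx: "(x s - 1)\<^sup>2 \<le> (2 * \<delta>)\<^sup>2" using xs[OF s] \<delta> by (intro power_mono) auto
    have "(x s + 1)\<^sup>2 \<le> (2 + 2 * \<delta>)\<^sup>2" using xs[OF s] \<delta> by (intro power_mono) auto
    also have "\<dots> \<le> (2 + 2 * (1/1000))\<^sup>2" using \<delta> by (intro power_mono) auto
    finally have x1: "(x s + 1)\<^sup>2 \<le> (2 + 2 * (1/1000))\<^sup>2" .
    have d1: "\<delta>\<^sup>2 \<le> (1/1000)\<^sup>2" using \<delta> by (intro power_mono) auto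
    show ?thesis
      unfolding genuine_coefficients(1)[OF gen[OF s0]]
    proof (rule pull_ge_near_circle[OF lam_pos \<delta>(1)])
      show "0 < (near s)\<^sup>2" using gen[OF s0] rho_pos by (simp add: genuine_def)
      show "(near s)\<^sup>2 \<le> 5 * \<delta>\<^sup>2" using zz xx by (simp add: near_far_sq power_mult_distrib)
      show "(near s)\<^sup>2 \<le> (far s)\<^sup>2" using xnn[OF s0] by (intro near_sq_le_far_sq) simp
      have "(far s)\<^sup>2 \<le> (2 + 2 * (1/1000))\<^sup>2 + (1/1000)\<^sup>2"
        unfolding near_far_sq using x1 zz d1 by linarith
      also have "\<dots> \<le> (5::real)" by (simp add: power2_eq_square)
      finally show "(far s)\<^sup>2 \<le> 5" .
      show "\<delta> \<le> 1" using \<delta> by simp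
    qed
  qed
  \<comment> \<open>the window has width \<open>\<delta> = \<sigma>\<^sup>2\<close> and is crossed at speed at most \<open>\<mu> / \<sigma>\<close>\<close>
  have long: "tb - ta \<ge> \<sigma> ^ 3 / \<mu>"
  proof -
    obtain \<xi> where \<xi>: "ta < \<xi>" "\<xi> < tb" "x tb - x ta = u \<xi> * (tb - ta)"
      using mvt_half_line[OF _ tab dx] ta by auto
    have "\<xi> \<le> td" "0 \<le> \<xi>" using \<xi> ta(1) tb(2) by linarith+
    moreover have "\<sigma>\<^sup>2 \<le> \<bar>x \<xi> - 1\<bar>" using xs(1)[of \<xi>] \<xi> by (simp add: \<delta>_def)
    ultimately have "\<bar>u \<xi>\<bar> \<le> \<mu> / \<sigma>" using \<sigma> by (intro abs_u)
    then have "\<bar>u \<xi>\<bar> * \<bar>tb - ta\<bar> \<le> \<mu> / \<sigma> * \<bar>tb - ta\<bar>" by (intro mult_right_mono) auto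
    then have "\<bar>u \<xi> * (tb - ta)\<bar> \<le> \<mu> / \<sigma> * (tb - ta)"
      unfolding abs_mult using tab by simp
    then have "\<delta> \<le> \<mu> / \<sigma> * (tb - ta)" using \<xi> ta tb \<delta> by simp
    then show ?thesis using \<sigma> \<mu> by (simp add: \<delta>_def field_simps power2_eq_square power3_eq_cube)
  qed
  have zp: "z s > 0" if "0 < s" "s \<le> td" for s using z_pos[of s] that tdT by simp
  have "w ta / z ta \<le> \<mu>"
  proof -
    obtain \<xi> where \<xi>: "0 < \<xi>" "\<xi> < ta" "z ta - z 0 = w \<xi> * (ta - 0)"
      using mvt_half_line[OF _ ta(1) dz] by auto
    have zta: "z ta > 0" using zp[of ta] ta tb by simp
    have "w ta * ta \<le> w \<xi> * ta" using w_decreasing[of \<xi> ta] \<xi> ta tb td by (intro mult_right_mono) auto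
    then have le: "w ta * ta \<le> z ta" using \<xi> start by simp
    have "w ta \<le> \<mu> * z ta"
    proof (cases "w ta \<le> 0")
      case True
      then show ?thesis using zta \<mu> by (meson less_imp_le mult_nonneg_nonneg order_trans)
    next
      case False
      then have "w ta \<le> w ta * (\<mu> * ta)" using \<open>\<mu> * ta \<ge> 1\<close> by simp
      also have "\<dots> \<le> \<mu> * z ta" using mult_left_mono[OF le, of \<mu>] \<mu> by (simp add: ac_simps)
      finally show ?thesis .
    qed
    then show ?thesis using zta by (simp add: divide_le_eq)
  qed
  moreover have "w tb / z tb - w ta / z ta \<le> - (5 * \<mu>)"
  proof -
    have d: "((\<lambda>s. w s / z s) has_real_derivative
        - (soft_pull lam \<rho> R (x s, z s) + (w s / z s)\<^sup>2)) (at s within {0..})" if "ta \<le> s" "s \<le> tb" for s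
    proof -
      have "z s > 0" using zp[of s] that ta tb by simp
      then show ?thesis using that ta
        by (auto intro!: derivative_eq_intros dw dz simp: field_simps power2_eq_square)
    qed
    obtain \<xi> where \<xi>: "ta < \<xi>" "\<xi> < tb" "w tb / z tb - w ta / z ta =
         - (soft_pull lam \<rho> R (x \<xi>, z \<xi>) + (w \<xi> / z \<xi>)\<^sup>2) * (tb - ta)"
      using mvt_half_line[OF _ tab d] ta by auto
    have "lam / (27 * \<delta>\<^sup>2) \<le> soft_pull lam \<rho> R (x \<xi>, z \<xi>) + (w \<xi> / z \<xi>)\<^sup>2"
      using q_big[of \<xi>] \<xi> by (intro add_increasing2) auto
    moreover have "lam / (27 * \<delta>\<^sup>2) \<ge> 0" using lam_pos by simp
    ultimately have "lam / (27 * \<delta>\<^sup>2) * (\<sigma> ^ 3 / \<mu>)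
        \<le> (soft_pull lam \<rho> R (x \<xi>, z \<xi>) + (w \<xi> / z \<xi>)\<^sup>2) * (tb - ta)"
      using long \<sigma> \<mu>(1) by (intro mult_mono) auto
    moreover have "lam / (27 * \<delta>\<^sup>2) * (\<sigma> ^ 3 / \<mu>) = \<mu> * (2000 / (108 * pi))"
    proof -
      have "lam = \<mu>\<^sup>2 / (4 * pi)" using \<mu> by simp
      then show ?thesis using \<mu>(1) unfolding \<delta>_def \<sigma>_def
        by (simp add: field_simps power2_eq_square power3_eq_cube)
    qed
    moreover have "5 * \<mu> \<le> \<mu> * (2000 / (108 * pi))"
    proof -
      have "5 \<le> 2000 / (108 * pi)" using pi_less_4 pi_approx by (simp add: field_simps)
      then have "\<mu> * 5 \<le> \<mu> * (2000 / (108 * pi))" using \<mu>(1) by (intro mult_left_mono) auto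
      then show ?thesis by (simp only: mult.commute[of 5])
    qed
    moreover have "w tb / z tb - w ta / z ta = - ((soft_pull lam \<rho> R (x \<xi>, z \<xi>) + (w \<xi> / z \<xi>)\<^sup>2) * (tb - ta))"
      by (simp only: \<xi>(3) mult_minus_left)
    ultimately show ?thesis by linarith
  qed
  ultimately have "w tb / z tb \<le> - (4 * \<mu>)" by simp
  then have wtb: "w tb \<le> - (4 * \<mu>) * z tb" using zp[of tb] tb by (simp add: divide_le_eq)
  \<comment> \<open>after the last time with \<open>x = 3/4\<close> the speed is at most \<open>2 \<mu>\<close>\<close>
  obtain tc where tc: "tb \<le> tc" "tc < td" "x tc = 3/4" "\<And>s. tc < s \<Longrightarrow> s \<le> td \<Longrightarrow> x s < 3/4"
    using last_zero_in[of tb td "\<lambda>t. 3/4 - x t"] tb td \<delta>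
      continuous_on_diff[OF continuous_on_const cont(1)[of "{tb..td}"], of "3/4"] by auto
  obtain \<xi> where \<xi>: "tc < \<xi>" "\<xi> < td" "x td - x tc = u \<xi> * (td - tc)"
    using mvt_half_line[OF _ tc(2) dx] tc tb by auto
  have "(1/2)\<^sup>2 \<le> \<bar>x \<xi> - 1\<bar>" using tc(4)[of \<xi>] \<xi> by (simp add: power2_eq_square)
  then have "\<bar>u \<xi>\<bar> \<le> \<mu> / (1/2)" using \<xi> tc(1) tb(1) by (intro abs_u) auto
  then have "\<bar>u \<xi>\<bar> * \<bar>td - tc\<bar> \<le> \<mu> / (1/2) * \<bar>td - tc\<bar>" by (intro mult_right_mono) auto
  then have "\<bar>u \<xi> * (td - tc)\<bar> \<le> 2 * \<mu> * (td - tc)"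
    unfolding abs_mult using tc by simp
  then have "1 \<le> 4 * \<mu> * (td - tc)" using \<xi> td tc by simp
  also have "\<dots> \<le> 4 * \<mu> * (td - tb)" using tc \<mu> by simp
  finally have time: "1 \<le> 4 * \<mu> * (td - tb)" .
  obtain \<eta> where \<eta>: "tb < \<eta>" "\<eta> < td" "z td - z tb = w \<eta> * (td - tb)"
    using mvt_half_line[OF _ tbd dz] tb by auto
  have "w \<eta> * (td - tb) \<le> w tb * (td - tb)"
    using w_decreasing[of tb \<eta>] \<eta> tb td by (intro mult_right_mono) auto
  also have "\<dots> \<le> - (4 * \<mu>) * z tb * (td - tb)" using wtb tbd by (intro mult_right_mono) auto
  also have "\<dots> = - (4 * \<mu> * (td - tb)) * z tb" by simp
  also have "\<dots> \<le> - 1 * z tb" using time zp[of tb] tb by (intro mult_right_mono) auto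
  finally have "z td \<le> 0" using \<eta> by simp
  then show False using zp[of td] td by simp
qed

end

section \<open>Shooting at the centre\<close>

lemma const_mult_dist_tendsto:
  "((\<lambda>v'. k * \<bar>v' - v\<bar>) \<longlongrightarrow> 0) (at (v::real) within S)"
  using tendsto_mult[OF tendsto_const tendsto_rabs[OF tendsto_diff[OF tendsto_ident_at tendsto_const]],
      of k v v S] by simp

text \<open>The orbit crosses \<open>z = 0\<close> transversally at its return, so \<open>z < 0\<close> shortly afterwards; up to shortly
  before, \<open>z\<close> is bounded away from \<open>0\<close> except near the start, where the uniform lower bound for the return
  time takes over. All this survives a small change of \<open>v\<close>.\<close>

lemma return_time_tendsto:
  fixes x z u w q m :: "real \<Rightarrow> real \<Rightarrow> real" and T K :: "real \<Rightarrow> real"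
  assumes arc: "\<And>v. v \<in> S \<Longrightarrow> planar_arc (x v) (z v) (u v) (w v) (q v) (m v) c (T v)"
    and q_le: "\<And>v t. v \<in> S \<Longrightarrow> t \<ge> 0 \<Longrightarrow> q v t \<le> Q"
    and dep: "\<And>v v' t. 0 \<le> t \<Longrightarrow> \<bar>z v t - z v' t\<bar> \<le> K t * \<bar>v - v'\<bar>"
    and K_mono: "mono K" and v: "v \<in> S"
  shows "(T \<longlongrightarrow> T v) (at v within S)"
proof -
  interpret A: planar_arc "x v" "z v" "u v" "w v" "q v" "m v" c "T v" by (rule arc[OF v])
  have Q: "Q > 0" using A.q_ge[of 0] A.c_pos q_le[OF v, of 0] by simp
  have z_tendsto: "((\<lambda>v'. z v' t) \<longlongrightarrow> z v t) (at v within S)" if "0 \<le> t" for t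
  proof -
    have "((\<lambda>v'. z v' t - z v t) \<longlongrightarrow> 0) (at v within S)"
      by (rule Lim_null_comparison[OF _ const_mult_dist_tendsto[of "K t" v]])
        (use dep[OF that, of _ v] in simp)
    then show ?thesis by (rule LIM_zero_cancel)
  qed
  show ?thesis
  proof (rule order_tendstoI)
    fix a assume a: "T v < a"
    have "\<exists>d>0. \<forall>h>0. T v + h \<in> {0..} \<longrightarrow> h < d \<longrightarrow> z v (T v) > z v (T v + h)"
      using has_real_derivative_neg_dec_right[OF A.dz[of "T v"] A.w_T_neg] A.T_pos by auto
    then obtain d where d: "d > 0" "\<And>h. 0 < h \<Longrightarrow> h < d \<Longrightarrow> z v (T v + h) < 0"
      using A.z_T A.T_pos by auto
    \<comment> \<open>a time shortly after the return at which \<open>z < 0\<close>\<close>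
    define b where "b = T v + min (d / 2) ((a - T v) / 2)"
    have b: "T v < b" "b < a" "z v b < 0"
      using d(1) a d(2)[of "min (d / 2) ((a - T v) / 2)"] unfolding b_def by (auto simp: min_def field_simps)
    then have b0: "b > 0" using A.T_pos by simp
    have "eventually (\<lambda>v'. z v' b < 0) (at v within S)"
      using order_tendstoD(2)[OF z_tendsto b(3)] b0 by simp
    moreover have "eventually (\<lambda>v'. v' \<in> S) (at v within S)"
      by (simp add: eventually_at_filter)
    ultimately show "eventually (\<lambda>v'. T v' < a) (at v within S)"
    proof eventually_elim
      case (elim v')
      interpret B: planar_arc "x v'" "z v'" "u v'" "w v'" "q v'" "m v'" c "T v'" by (rule arc[OF elim(2)])
      show ?case
        using B.z_pos[of b] B.z_T b0 b elim(1) by (cases "T v' = b"; cases "T v' < b") auto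
    qed
  next
    fix a assume a: "a < T v"
    define e where "e = sqrt (1 / Q)"
    have e: "e > 0" using Q by (simp add: e_def)
    have T_ge: "T v' \<ge> e" if "v' \<in> S" for v'
    proof -
      interpret B: planar_arc "x v'" "z v'" "u v'" "w v'" "q v'" "m v'" c "T v'" by (rule arc[OF that])
      have "Q * (T v')\<^sup>2 \<ge> 1" by (rule B.return_time_ge[OF q_le[OF that]])
      then have "1 / Q \<le> (T v')\<^sup>2" using Q by (simp add: divide_le_eq mult.commute)
      then show ?thesis unfolding e_def using B.T_pos by (intro real_le_lsqrt) auto
    qed
    have ev_S: "eventually (\<lambda>v'. v' \<in> S) (at v within S)" by (simp add: eventually_at_filter)
    show "eventually (\<lambda>v'. a < T v') (at v within S)"
    proof (cases "a < e")
      case True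
      show ?thesis proof (rule eventually_mono[OF ev_S])
        fix v' assume "v' \<in> S"
        then show "a < T v'" using T_ge[of v'] True by linarith
      qed
    next
      case False
      have "{e..a} \<noteq> {}" using False by simp
      moreover have "continuous_on {e..a} (z v)"
        by (rule A.continuous_motion(2)) (use e in auto)
      ultimately have "\<exists>s\<in>{e..a}. \<forall>t\<in>{e..a}. z v s \<le> z v t"
        by (intro continuous_attains_inf compact_Icc)
      then obtain s where s: "s \<in> {e..a}" "\<And>t. t \<in> {e..a} \<Longrightarrow> z v s \<le> z v t" by metis
      have zs: "z v s > 0" using A.z_pos[of s] s(1) e a by auto
      have "eventually (\<lambda>v'. K a * \<bar>v' - v\<bar> < z v s) (at v within S)"
        by (rule order_tendstoD(2)[OF const_mult_dist_tendsto zs])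
      then show ?thesis using ev_S
      proof eventually_elim
        case (elim v')
        interpret B: planar_arc "x v'" "z v'" "u v'" "w v'" "q v'" "m v'" c "T v'" by (rule arc[OF elim(2)])
        show ?case
        proof (rule ccontr)
          assume "\<not> a < T v'"
          then have t: "T v' \<in> {e..a}" using T_ge[OF elim(2)] by simp
          have "\<bar>z v' (T v') - z v (T v')\<bar> \<le> K (T v') * \<bar>v' - v\<bar>" using B.T_pos by (intro dep) simp
          also have "\<dots> \<le> K a * \<bar>v' - v\<bar>" using monoD[OF K_mono, of "T v'" a] t by (intro mult_right_mono) auto
          finally show False using elim(1) s(2)[OF t] B.z_T by simp
        qed
      qed
    qed
  qed
qed

text \<open>The intermediate value theorem for the abscissa of the return, as a function of the launching speed
  between \<open>v0\<close> (slow) and \<open>v1\<close> (fast). An orbit that returns at \<open>x = 0\<close> has \<open>x \<ge> 0\<close> all along, so it lies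
  where the modified force is the true one.\<close>

lemma exists_shot_to_center:
  assumes lam: "lam > 0" and x0: "x0 \<ge> 300"
  obtains \<tau> x z u w where "\<tau> > 0" "x 0 = x0" "z 0 = 0" "u 0 = 0" "x \<tau> = 0" "z \<tau> = 0"
    "\<And>t. 0 < t \<Longrightarrow> t < \<tau> \<Longrightarrow> z t > 0"
    "\<And>t. t \<in> {0..\<tau>} \<Longrightarrow> (x has_real_derivative u t) (at t within {0..\<tau>})"
    "\<And>t. t \<in> {0..\<tau>} \<Longrightarrow> (z has_real_derivative w t) (at t within {0..\<tau>})"
    "\<And>t. t \<in> {0..\<tau>} \<Longrightarrow> (u has_real_derivative fst (ring_force lam (x t, z t))) (at t within {0..\<tau>})"
    "\<And>t. t \<in> {0..\<tau>} \<Longrightarrow> (w has_real_derivative snd (ring_force lam (x t, z t))) (at t within {0..\<tau>})"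
    "\<And>t \<phi>. t \<in> {0..\<tau>} \<Longrightarrow> plane_point \<phi> (x t, z t) \<notin> unit_circle"
    "inj_on (\<lambda>t. (x t, z t)) {0..\<tau>}"
    "\<And>t. t \<in> {0..\<tau>} \<Longrightarrow> u t \<noteq> 0 \<or> w t \<noteq> 0"
proof -
  \<comment> \<open>the choice of \<open>R\<close> must precede that of \<open>v0\<close>, and \<open>\<rho>\<close> comes last since it depends on \<open>v0\<close>\<close>
  define R where "R = pi * x0 + 3"
  define c where "c = 2 * pi * lam / R ^ 3"
  define v1 where "v1 = sqrt (lam / x0)"
  define v0 where "v0 = min v1 (1 / 2000 ^ 2 / sqrt (2 * x0 / c))"
  define \<rho> where "\<rho> = min (1/2) (((x0 - 1) * v0)\<^sup>2 / (8 * pi * lam))"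
  have R: "R > 3" unfolding R_def using x0 by simp
  have c: "c > 0" unfolding c_def using lam R by simp
  have v1: "v1 > 0" "v1\<^sup>2 = lam / x0" unfolding v1_def using lam x0 by auto
  have v0: "v0 > 0" "v0 \<le> v1" "v0 * sqrt (2 * x0 / c) \<le> 1 / 2000 ^ 2"
  proof -
    have s: "sqrt (2 * x0 / c) > 0" using x0 c by simp
    then show "v0 > 0" "v0 \<le> v1" unfolding v0_def using v1 by auto
    have "v0 \<le> 1 / 2000 ^ 2 / sqrt (2 * x0 / c)" unfolding v0_def by (rule min.cobounded2)
    then show "v0 * sqrt (2 * x0 / c) \<le> 1 / 2000 ^ 2" using s by (simp add: pos_le_divide_eq)
  qed
  have \<rho>: "\<rho> > 0" "\<rho> < 1" "\<rho> \<le> R" "4 * pi * lam * \<rho> < ((x0 - 1) * v0)\<^sup>2"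
  proof -
    have p: "((x0 - 1) * v0)\<^sup>2 > 0" using x0 v0 by simp
    then show "\<rho> > 0" "\<rho> < 1" "\<rho> \<le> R" unfolding \<rho>_def using lam R by auto
    have "\<rho> \<le> ((x0 - 1) * v0)\<^sup>2 / (8 * pi * lam)" unfolding \<rho>_def by simp
    then have "8 * pi * lam * \<rho> \<le> ((x0 - 1) * v0)\<^sup>2" using lam by (simp add: field_simps)
    then show "4 * pi * lam * \<rho> < ((x0 - 1) * v0)\<^sup>2" using p by linarith
  qed
  obtain L and x z u w :: "real \<Rightarrow> real \<Rightarrow> real" where flow: "L > 0"
    "\<And>v. x v 0 = x0" "\<And>v. z v 0 = 0" "\<And>v. u v 0 = 0" "\<And>v. w v 0 = v"
    "\<And>v t. t \<ge> 0 \<Longrightarrow> (x v has_real_derivative u v t) (at t within {0..})"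
    "\<And>v t. t \<ge> 0 \<Longrightarrow> (z v has_real_derivative w v t) (at t within {0..})"
    "\<And>v t. t \<ge> 0 \<Longrightarrow> (u v has_real_derivative
        (soft_tilt lam \<rho> R (x v t, z v t) - soft_pull lam \<rho> R (x v t, z v t) * x v t)) (at t within {0..})"
    "\<And>v t. t \<ge> 0 \<Longrightarrow> (w v has_real_derivative - soft_pull lam \<rho> R (x v t, z v t) * z v t) (at t within {0..})"
    "\<And>v v' t. t \<ge> 0 \<Longrightarrow> \<bar>x v t - x v' t\<bar> \<le> 2 * exp (2 * L * t) * \<bar>v - v'\<bar>"
    "\<And>v v' t. t \<ge> 0 \<Longrightarrow> \<bar>z v t - z v' t\<bar> \<le> 2 * exp (2 * L * t) * \<bar>v - v'\<bar>"
    using soft_flow[OF lam \<rho>(1,3), of x0 thesis] by blast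
  define q m where "q v t = soft_pull lam \<rho> R (x v t, z v t)" and "m v t = soft_tilt lam \<rho> R (x v t, z v t)" for v t
  have motion: "planar_motion (x v) (z v) (u v) (w v) (q v) (m v) c" if "v > 0" for v
  proof
    fix t
    show "m v t < q v t"
      using soft_coefficients(2)[OF lam \<rho>(1,3), of "(x v t, z v t)"] c unfolding q_def m_def c_def by linarith
    show "c \<le> q v t" unfolding q_def c_def by (rule soft_coefficients(1)[OF lam \<rho>(1,3)])
    show "x v t \<ge> 0 \<Longrightarrow> m v t \<ge> 0" "x v t \<le> 0 \<Longrightarrow> m v t \<le> 0"
      unfolding m_def by (rule soft_tilt_sign[OF lam \<rho>(1,3)], simp)+
    assume t: "t \<ge> 0"
    show "(x v has_real_derivative u v t) (at t within {0..})" by (rule flow(6)[OF t])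
    show "(z v has_real_derivative w v t) (at t within {0..})" by (rule flow(7)[OF t])
    show "(u v has_real_derivative m v t - q v t * x v t) (at t within {0..})"
      unfolding q_def m_def by (rule flow(8)[OF t])
    show "(w v has_real_derivative - q v t * z v t) (at t within {0..})"
      unfolding q_def by (rule flow(9)[OF t])
  qed (simp_all only: flow(2-5), use that x0 c in simp_all)
  have "\<exists>T>0. z v T = 0 \<and> (\<forall>t. 0 < t \<longrightarrow> t < T \<longrightarrow> z v t > 0)" if "v > 0" for v
    using planar_motion.exists_return[OF motion[OF that]] by metis
  then obtain T where T: "\<And>v. v > 0 \<Longrightarrow> T v > 0" "\<And>v. v > 0 \<Longrightarrow> z v (T v) = 0"
    "\<And>v t. v > 0 \<Longrightarrow> 0 < t \<Longrightarrow> t < T v \<Longrightarrow> z v t > 0" by metis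
  have arc: "planar_arc (x v) (z v) (u v) (w v) (q v) (m v) c (T v)" if "v > 0" for v
    using motion[OF that] T[OF that] by (auto simp: planar_arc_def planar_arc_axioms_def)
  have soft: "soft_arc (x v) (z v) (u v) (w v) lam \<rho> R (T v)" if v: "v \<in> {v0..v1}" for v
  proof -
    have vpos: "v > 0" using v v0 by simp
    have "v\<^sup>2 \<le> lam / x0" using v v0 power_mono[of v v1 2] v1 by simp
    moreover have "((x0 - 1) * v0)\<^sup>2 \<le> ((x0 - 1) * v)\<^sup>2" using v v0 x0 by (intro power_mono mult_left_mono) auto
    then have "4 * pi * lam * \<rho> < ((x0 - 1) * v)\<^sup>2" using \<rho> by linarith
    ultimately show ?thesis
      using arc[OF vpos] flow(2,5) lam \<rho> x0
      unfolding soft_arc_def soft_arc_axioms_def c_def q_def m_def R_def by simp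
  qed
  define S where "S = {v0..v1}"
  have T_tendsto: "(T \<longlongrightarrow> T v) (at v within S)" if "v \<in> S" for v
  proof (rule return_time_tendsto[where K="\<lambda>t. 2 * exp (2 * L * t)" and Q="2 * pi * lam / \<rho> ^ 3"])
    show "planar_arc (x v) (z v) (u v) (w v) (q v) (m v) c (T v)" if "v \<in> S" for v
      using that v0 by (intro arc) (simp add: S_def)
    show "mono (\<lambda>t. 2 * exp (2 * L * t))" using flow(1) by (intro monoI) auto
    show "q v t \<le> 2 * pi * lam / \<rho> ^ 3" for v t
      unfolding q_def by (rule soft_coefficients(3)[OF lam \<rho>(1,3)])
  qed (use flow(11) that in auto)
  have cont: "continuous_on {v0..v1} (\<lambda>v. x v (T v))"
    unfolding continuous_on_def S_def[symmetric]
  proof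
    fix v assume v: "v \<in> S"
    then have vpos: "v > 0" using v0 by (simp add: S_def)
    interpret A: planar_arc "x v" "z v" "u v" "w v" "q v" "m v" c "T v" by (rule arc[OF vpos])
    have "{0<..} \<subseteq> {0::real..}" by auto
    from A.continuous_motion(1)[OF this] have "isCont (x v) (T v)"
      using T(1)[OF vpos] by (simp add: continuous_on_eq_continuous_at)
    then have 1: "((\<lambda>v'. x v (T v')) \<longlongrightarrow> x v (T v)) (at v within S)"
      by (rule isCont_tendsto_compose[OF _ T_tendsto[OF v]])
    have "((\<lambda>v'. 2 * exp (2 * L * T v') * \<bar>v' - v\<bar>) \<longlongrightarrow> 2 * exp (2 * L * T v) * 0) (at v within S)"
      using const_mult_dist_tendsto[of 1 v S]
      by (intro tendsto_mult[of _ "2 * exp (2 * L * T v)"] tendsto_mult[of _ 2] tendsto_exp tendsto_mult[of _ "2 * L"]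
          tendsto_const T_tendsto v) simp
    then have lim0: "((\<lambda>v'. 2 * exp (2 * L * T v') * \<bar>v' - v\<bar>) \<longlongrightarrow> 0) (at v within S)" by simp
    have le: "eventually (\<lambda>v'. norm (x v' (T v') - x v (T v')) \<le> 2 * exp (2 * L * T v') * \<bar>v' - v\<bar>) (at v within S)"
    proof -
      have "eventually (\<lambda>v'. v' \<in> S) (at v within S)" by (simp add: eventually_at_filter)
      then show ?thesis
      proof eventually_elim
        case (elim v')
        then have "T v' \<ge> 0" using T(1)[of v'] v0 by (simp add: S_def)
        then show ?case using flow(10) by simp
      qed
    qed
    have "((\<lambda>v'. x v' (T v') - x v (T v')) \<longlongrightarrow> 0) (at v within S)"
      by (rule Lim_null_comparison[OF le lim0])
    from tendsto_add[OF this 1] show "((\<lambda>v. x v (T v)) \<longlongrightarrow> x v (T v)) (at v within S)" by simp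
  qed
  have "x v0 (T v0) > 0"
    using soft_arc.x_end_pos_if_slow[OF soft[of v0]] v0 flow(2,5) unfolding c_def by simp
  moreover have "x v1 (T v1) < 0"
    using soft_arc.x_end_neg_if_fast[OF soft[of v1]] v0 v1 flow(2,5) by simp
  ultimately obtain v where v: "v0 \<le> v" "v \<le> v1" "x v (T v) = 0"
    using IVT2'[of "\<lambda>v. x v (T v)" v1 0 v0] cont v0(2) by auto
  interpret A: soft_arc "x v" "z v" "u v" "w v" lam \<rho> R "T v" by (rule soft) (use v in auto)
  have gen: "A.genuine t" if "t \<in> {0..T v}" for t
    using A.genuine_while_x_nonneg[of t] A.x_nonneg that v(3) by auto
  show thesis
  proof (rule that[of "T v" "x v" "z v" "u v" "w v"])
    show "inj_on (\<lambda>t. (x v t, z v t)) {0..T v}" by (rule A.inj_arc)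
    fix t assume t: "t \<in> {0..T v}"
    show "plane_point \<phi> (x v t, z v t) \<notin> unit_circle" for \<phi> by (rule A.genuine_off_circle[OF gen[OF t]])
    show "u v t \<noteq> 0 \<or> w v t \<noteq> 0" using A.velocity_nonzero[of t] t by auto
    show "(x v has_real_derivative u v t) (at t within {0..T v})"
      "(z v has_real_derivative w v t) (at t within {0..T v})"
      "(u v has_real_derivative fst (ring_force lam (x v t, z v t))) (at t within {0..T v})"
      "(w v has_real_derivative snd (ring_force lam (x v t, z v t))) (at t within {0..T v})"
      unfolding A.genuine_ring_force[OF gen[OF t]] fst_conv snd_conv
      using t by (auto intro: DERIV_subset[OF A.dx] DERIV_subset[OF A.dz])
        (auto intro: DERIV_subset[OF A.du], auto intro: DERIV_subset[OF A.dw, simplified])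
  qed (use A.T_pos A.z_T A.z_pos v flow in auto)
qed

section \<open>Vertical planes and reflections\<close>

lemma inj_plane_point: "inj (plane_point \<phi>)"
proof (rule injI)
  fix p p' assume "plane_point \<phi> p = plane_point \<phi> p'"
  then have "plane_point \<phi> (p - p') = 0" by (simp add: linear_diff[OF linear_plane_point])
  then have "plane_point \<phi> (p - p') \<bullet> plane_point \<phi> (p - p') = 0" by simp
  then show "p = p'" by (simp add: inner_plane_point prod_eq_iff sum_squares_eq_zero_iff)
qed

text \<open>Such a plane is a linear subspace of dimension \<open>2\<close>; normalising the horizontal part of a vector off the
  \<open>z\<close>-axis gives the angle.\<close>

lemma vertical_plane_eq_range:
  assumes "vertical_plane \<Lambda>"
  obtains \<phi> where "range (plane_point \<phi>) = \<Lambda>"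
proof -
  have aff: "affine \<Lambda>" "aff_dim \<Lambda> = 2" "z_axis \<subseteq> \<Lambda>" using assms by (auto simp: vertical_plane_def)
  have 0: "0 \<in> \<Lambda>" using aff(3) by (auto simp: z_axis_def)
  then have sub: "subspace \<Lambda>" using aff(1) subspace_affine by blast
  have dim: "dim \<Lambda> = 2" using aff_dim_subspace[OF sub] aff(2) by simp
  have "\<not> \<Lambda> \<subseteq> z_axis"
  proof
    assume "\<Lambda> \<subseteq> z_axis"
    then have "\<Lambda> \<subseteq> span {axis 3 1}"
    proof (intro subsetI)
      fix y assume "y \<in> \<Lambda>"
      with \<open>\<Lambda> \<subseteq> z_axis\<close> have "y = (y $ 3) *\<^sub>R axis 3 1"
        by (auto simp: z_axis_def vec3_eq_iff axis_def)
      then show "y \<in> span {axis 3 1}" by (metis insertI1 span_base span_scale)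
    qed
    then have "dim \<Lambda> \<le> card {axis 3 1 :: real^3}" by (intro dim_le_card) auto
    then show False using dim by simp
  qed
  then obtain a where a: "a \<in> \<Lambda>" "a \<notin> z_axis" by blast
  define d where "d = sqrt ((a $ 1)\<^sup>2 + (a $ 2)\<^sup>2)"
  have d2: "d\<^sup>2 = (a $ 1)\<^sup>2 + (a $ 2)\<^sup>2" by (simp add: d_def)
  have d: "d > 0" using a(2) unfolding d_def z_axis_def by (auto simp: sum_power2_gt_zero_iff)
  have "(a $ 1 / d)\<^sup>2 + (a $ 2 / d)\<^sup>2 = 1"
    unfolding power_divide add_divide_distrib[symmetric] d2[symmetric] using d by simp
  then obtain \<phi> where \<phi>: "a $ 1 / d = cos \<phi>" "a $ 2 / d = sin \<phi>" using sincos_total_2pi by metis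
  have pp: "plane_point \<phi> (x, z) = (x / d) *\<^sub>R a + (z - x / d * (a $ 3)) *\<^sub>R axis 3 1" for x z
    using d by (simp add: vec3_eq_iff axis_def \<phi>[symmetric])
  have e3: "axis 3 1 \<in> \<Lambda>" using aff(3) by (auto simp: z_axis_def axis_def)
  have sub_range: "range (plane_point \<phi>) \<subseteq> \<Lambda>"
  proof
    fix y assume "y \<in> range (plane_point \<phi>)"
    then obtain x z where "y = plane_point \<phi> (x, z)" by auto
    then show "y \<in> \<Lambda>" unfolding pp using sub a(1) e3 by (auto intro!: subspace_add subspace_scale)
  qed
  have "dim (range (plane_point \<phi>)) = dim (UNIV :: (real \<times> real) set)"
    by (rule dim_image_eq[OF linear_plane_point]) (simp add: inj_plane_point)
  then have "dim (range (plane_point \<phi>)) = dim \<Lambda>" using dim by simp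
  then have "range (plane_point \<phi>) = \<Lambda>"
    using sub sub_range by (intro subspace_dim_equal) (auto intro: linear_subspace_image linear_plane_point)
  then show thesis by (rule that)
qed

text \<open>The reflection \<open>x \<mapsto> - x\<close> exchanges the two distances, which preserves the pull and reverses the tilt.\<close>

lemma ring_force_reflect:
  assumes "near2 p > 0" "far2 p > 0"
  shows "ring_force lam (- fst p, snd p) = (- fst (ring_force lam p), snd (ring_force lam p))"
    and "ring_force lam (fst p, - snd p) = (fst (ring_force lam p), - snd (ring_force lam p))"
proof -
  have "near2 (- fst p, snd p) = far2 p" "far2 (- fst p, snd p) = near2 p"
    by (simp_all add: near2_def far2_def power2_eq_square algebra_simps)
  then show "ring_force lam (- fst p, snd p) = (- fst (ring_force lam p), snd (ring_force lam p))"
    unfolding ring_force_def using assms by (simp add: pull_commute[of "near2 p"] tilt_commute[of "near2 p"])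
  have "near2 (fst p, - snd p) = near2 p" "far2 (fst p, - snd p) = far2 p"
    by (simp_all add: near2_def far2_def)
  then show "ring_force lam (fst p, - snd p) = (fst (ring_force lam p), - snd (ring_force lam p))"
    unfolding ring_force_def by simp
qed

text \<open>At a multiple of \<open>\<tau>\<close> the two one-sided derivatives agree, because \<open>v\<close> is one function for all pieces.\<close>

lemma derivative_from_pieces:
  fixes f :: "real \<Rightarrow> 'a::real_normed_vector"
  assumes "\<tau> > 0"
    and piece: "\<And>k::int. \<And>t. t \<in> {of_int k * \<tau>..of_int (k + 1) * \<tau>} \<Longrightarrow>
       (f has_vector_derivative v t) (at t within {of_int k * \<tau>..of_int (k + 1) * \<tau>})"
  shows "(f has_vector_derivative v t) (at t)"
proof -
  define k where "k = \<lfloor>t / \<tau>\<rfloor>"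
  have "of_int k \<le> t / \<tau>" "t / \<tau> < of_int k + 1" unfolding k_def by linarith+
  then have k: "of_int k * \<tau> \<le> t" "t < of_int (k + 1) * \<tau>"
    using \<open>\<tau> > 0\<close> by (auto simp: pos_le_divide_eq pos_divide_less_eq)
  let ?A = "{of_int k * \<tau>..of_int (k + 1) * \<tau>}"
  let ?B = "{of_int (k - 1) * \<tau>..of_int k * \<tau>}"
  have A: "(f has_vector_derivative v t) (at t within ?A)" using piece[of t k] k by simp
  show ?thesis
  proof (cases "t = of_int k * \<tau>")
    case False
    then have "t \<in> interior ?A" using k by simp
    then have "at t within ?A = at t" by (rule at_within_interior)
    then show ?thesis using A by simp
  next
    case True
    then have "t \<in> ?B" using \<open>\<tau> > 0\<close> by (simp add: algebra_simps)
    then have B: "(f has_vector_derivative v t) (at t within ?B)" using piece[of t "k - 1"] by simp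
    have "(f has_vector_derivative v t) (at t within (?A \<union> ?B))"
      using A B unfolding has_vector_derivative_def has_derivative_within
      by (auto simp: at_within_union intro: filterlim_sup)
    moreover have "at t within (?A \<union> ?B) = at t"
    proof (rule at_within_interior)
      have "t \<in> {of_int (k - 1) * \<tau><..<of_int (k + 1) * \<tau>}"
        using True \<open>\<tau> > 0\<close> by (simp add: algebra_simps)
      moreover have "{of_int (k - 1) * \<tau><..<of_int (k + 1) * \<tau>} \<subseteq> ?A \<union> ?B" by auto
      ultimately show "t \<in> interior (?A \<union> ?B)" by (meson interiorI open_greaterThanLessThan)
    qed
    ultimately show ?thesis by simp
  qed
qed

text \<open>The signs of the two coordinates on the \<open>k\<close>-th quarter of the figure eight, in the order
  \<open>(+,+), (-,-), (-,+), (+,-)\<close>.\<close>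

definition sgn_x :: "int \<Rightarrow> real" where "sgn_x k = (if k mod 4 = 0 \<or> k mod 4 = 3 then 1 else - 1)"
definition sgn_z :: "int \<Rightarrow> real" where "sgn_z k = (if even k then 1 else - 1)"
text \<open>The essential part is traversed forwards on even quarters and backwards on odd ones.\<close>

definition fold_time :: "real \<Rightarrow> int \<Rightarrow> real \<Rightarrow> real" where
  "fold_time \<tau> k t = (if even k then t - of_int k * \<tau> else of_int (k + 1) * \<tau> - t)"

definition mirror_extension :: "real \<Rightarrow> (int \<Rightarrow> real) \<Rightarrow> (real \<Rightarrow> real) \<Rightarrow> real \<Rightarrow> real" where
  "mirror_extension \<tau> s f t = s \<lfloor>t / \<tau>\<rfloor> * f (fold_time \<tau> \<lfloor>t / \<tau>\<rfloor> t)"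

lemma fold_time_bounds:
  assumes "t \<in> {of_int k * \<tau>..of_int (k + 1) * \<tau>}"
  shows "fold_time \<tau> k t \<in> {0..\<tau>}"
  using assms by (auto simp: fold_time_def algebra_simps)

text \<open>The pieces are joined at time \<open>\<tau>\<close> of the essential part if \<open>k\<close> is even and at time \<open>0\<close> if \<open>k\<close> is odd. The
  sign may change there only if \<open>f\<close> vanishes; hence the form of the last hypothesis.\<close>

lemma mirror_extension_piece:
  assumes \<tau>: "\<tau> > 0" and t: "t \<in> {of_int k * \<tau>..of_int (k + 1) * \<tau>}"
    and join: "\<forall>k. s (k + 1) * f (if even k then \<tau> else 0) = s k * f (if even k then \<tau> else 0)"
  shows "mirror_extension \<tau> s f t = s k * f (fold_time \<tau> k t)"
proof (cases "t = of_int (k + 1) * \<tau>")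
  case True
  then have "\<lfloor>t / \<tau>\<rfloor> = k + 1" using \<tau> by simp
  then have "mirror_extension \<tau> s f t = s (k + 1) * f (fold_time \<tau> (k + 1) t)" by (simp add: mirror_extension_def)
  also have "\<dots> = s k * f (fold_time \<tau> k t)"
    using join[rule_format, of k] True by (auto simp: fold_time_def algebra_simps split: if_splits)
  finally show ?thesis .
next
  case False
  then have "of_int k \<le> t / \<tau>" "t / \<tau> < of_int k + 1"
    using t \<tau> by (auto simp: pos_le_divide_eq pos_divide_less_eq)
  then have "\<lfloor>t / \<tau>\<rfloor> = k" by (rule floor_unique)
  then show ?thesis by (simp add: mirror_extension_def)
qed

text \<open>Reversed time contributes the factor \<open>sgn_z k\<close>: the odd quarters, which are run backwards, are exactly
  those below the horizontal plane.\<close>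

lemma mirror_extension_deriv:
  assumes \<tau>: "\<tau> > 0" and t: "t \<in> {of_int k * \<tau>..of_int (k + 1) * \<tau>}"
    and f: "\<And>s. s \<in> {0..\<tau>} \<Longrightarrow> (f has_real_derivative f' s) (at s within {0..\<tau>})"
    and join: "\<forall>k. s (k + 1) * f (if even k then \<tau> else 0) = s k * f (if even k then \<tau> else 0)"
  shows "(mirror_extension \<tau> s f has_real_derivative (s k * sgn_z k) * f' (fold_time \<tau> k t))
     (at t within {of_int k * \<tau>..of_int (k + 1) * \<tau>})"
proof -
  let ?A = "{of_int k * \<tau>..of_int (k + 1) * \<tau>}"
  have "fold_time \<tau> k ` ?A \<subseteq> {0..\<tau>}" using fold_time_bounds by blast
  then have "(f has_real_derivative f' (fold_time \<tau> k t)) (at (fold_time \<tau> k t) within fold_time \<tau> k ` ?A)"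
    using f[OF fold_time_bounds[OF t]] by (rule DERIV_subset[rotated])
  moreover have "(fold_time \<tau> k has_real_derivative sgn_z k) (at t within ?A)"
    unfolding fold_time_def[abs_def] sgn_z_def by (cases "even k") (auto intro!: derivative_eq_intros)
  ultimately have "((\<lambda>t. f (fold_time \<tau> k t)) has_real_derivative f' (fold_time \<tau> k t) * sgn_z k) (at t within ?A)"
    using DERIV_image_chain by (fastforce simp: o_def)
  then have "((\<lambda>t. s k * f (fold_time \<tau> k t)) has_real_derivative s k * (f' (fold_time \<tau> k t) * sgn_z k)) (at t within ?A)"
    by (rule DERIV_cmult)
  then have "(mirror_extension \<tau> s f has_real_derivative s k * (f' (fold_time \<tau> k t) * sgn_z k)) (at t within ?A)"
    unfolding has_real_derivative_iff_has_vector_derivative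
    using t mirror_extension_piece[OF \<tau> _ join]
    by (intro has_vector_derivative_transform[where g="mirror_extension \<tau> s f"]) auto
  then show ?thesis by (simp add: ac_simps)
qed

lemma sgn_x_join: "odd k \<Longrightarrow> sgn_x (k + 1) = sgn_x k"
proof -
  assume "odd k"
  then have "(k + 1) mod 4 = 0 \<longleftrightarrow> k mod 4 = 3" "(k + 1) mod 4 \<noteq> 3" "k mod 4 \<noteq> 0" by presburger+
  then show ?thesis by (simp add: sgn_x_def)
qed

lemma sgn_xz_join: "even k \<Longrightarrow> sgn_x (k + 1) * sgn_z (k + 1) = sgn_x k * sgn_z k"
proof -
  assume even: "even k"
  then have "(k + 1) mod 4 = 3 \<longleftrightarrow> k mod 4 \<noteq> 0" "(k + 1) mod 4 \<noteq> 0" "k mod 4 \<noteq> 3" by presburger+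
  with even show ?thesis by (simp add: sgn_x_def sgn_z_def)
qed

lemma sgn_cases: "sgn_x k = 1 \<or> sgn_x k = - 1" "sgn_z k = 1 \<or> sgn_z k = - 1"
  by (auto simp: sgn_x_def sgn_z_def)

text \<open>Of the reflected pieces, position and velocity agree where they meet: at the centre because \<open>x\<close> and \<open>z\<close>
  vanish and both signs change together, on the horizontal axis because \<open>z\<close> and \<open>u\<close> vanish there. The
  last two conclusions recover \<open>x 0\<close> from the trace.\<close>

lemma symmetric_figure_eight_from_arc:
  assumes \<Lambda>: "range (plane_point \<phi>) = \<Lambda>" and \<tau>: "\<tau> > 0"
    and start: "x 0 > 1" "z 0 = 0" "u 0 = 0" and stop: "x \<tau> = 0" "z \<tau> = 0"
    and z_pos: "\<And>t. 0 < t \<Longrightarrow> t < \<tau> \<Longrightarrow> z t > 0"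
    and dx: "\<And>t. t \<in> {0..\<tau>} \<Longrightarrow> (x has_real_derivative u t) (at t within {0..\<tau>})"
    and dz: "\<And>t. t \<in> {0..\<tau>} \<Longrightarrow> (z has_real_derivative w t) (at t within {0..\<tau>})"
    and du: "\<And>t. t \<in> {0..\<tau>} \<Longrightarrow> (u has_real_derivative fst (ring_force lam (x t, z t))) (at t within {0..\<tau>})"
    and dw: "\<And>t. t \<in> {0..\<tau>} \<Longrightarrow> (w has_real_derivative snd (ring_force lam (x t, z t))) (at t within {0..\<tau>})"
    and off: "\<And>t \<phi>. t \<in> {0..\<tau>} \<Longrightarrow> plane_point \<phi> (x t, z t) \<notin> unit_circle"
  obtains R where "symmetric_figure_eight lam \<Lambda> \<phi> \<tau> (\<lambda>t. (x t, z t)) R"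
    "plane_point \<phi> (x 0, 0) \<in> range R"
    "\<And>a. a > 0 \<Longrightarrow> plane_point \<phi> (a, 0) \<in> range R \<Longrightarrow> a = x 0"
proof -
  define X Z U W where "X = mirror_extension \<tau> sgn_x x" and "Z = mirror_extension \<tau> sgn_z z"
    and "U = mirror_extension \<tau> (\<lambda>k. sgn_x k * sgn_z k) u" and "W = mirror_extension \<tau> (\<lambda>_. 1) w"
  define \<rho> where "\<rho> t = (X t, Z t)" for t
  define R where "R = plane_point \<phi> \<circ> \<rho>"
  have jx: "\<forall>k. sgn_x (k + 1) * x (if even k then \<tau> else 0) = sgn_x k * x (if even k then \<tau> else 0)"
    using stop sgn_x_join by auto
  have jz: "\<forall>k. sgn_z (k + 1) * z (if even k then \<tau> else 0) = sgn_z k * z (if even k then \<tau> else 0)"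
    using start stop by auto
  have ju: "\<forall>k. sgn_x (k + 1) * sgn_z (k + 1) * u (if even k then \<tau> else 0)
      = sgn_x k * sgn_z k * u (if even k then \<tau> else 0)"
    using start sgn_xz_join by auto
  have jw: "\<forall>k::int. 1 * w (if even k then \<tau> else 0) = 1 * w (if even k then \<tau> else 0)" by simp
  let ?I = "\<lambda>k::int. {of_int k * \<tau>..of_int (k + 1) * \<tau>}"
  note pX = mirror_extension_piece[where f=x and s=sgn_x, OF \<tau> _ jx, folded X_def]
    and pZ = mirror_extension_piece[where f=z and s=sgn_z, OF \<tau> _ jz, folded Z_def]
    and pU = mirror_extension_piece[where f=u and s="\<lambda>k. sgn_x k * sgn_z k", OF \<tau> _ ju, folded U_def]
    and pW = mirror_extension_piece[where f=w and s="\<lambda>_. 1", OF \<tau> _ jw, folded W_def]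
  have sz2: "sgn_z k * sgn_z k = 1" for k using sgn_cases(2)[of k] by auto
  have force: "ring_force lam (\<rho> t) = (sgn_x k * fst (ring_force lam (x (fold_time \<tau> k t), z (fold_time \<tau> k t))),
      sgn_z k * snd (ring_force lam (x (fold_time \<tau> k t), z (fold_time \<tau> k t))))"
    and off_R: "plane_point \<phi>' (\<rho> t) \<notin> unit_circle" if t: "t \<in> ?I k" for t k \<phi>'
  proof -
    let ?p = "(x (fold_time \<tau> k t), z (fold_time \<tau> k t))"
    have rho: "\<rho> t = (sgn_x k * fst ?p, sgn_z k * snd ?p)" unfolding \<rho>_def pX[OF t] pZ[OF t] by simp
    have nz: "near2 ?p \<noteq> 0" "far2 ?p \<noteq> 0"
      using off[OF fold_time_bounds[OF t], of 0] unfolding plane_point_in_unit_circle_iff by auto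
    then have pos: "near2 ?p > 0" "far2 ?p > 0"
      using sum_power2_ge_zero[of "fst ?p - 1" "snd ?p"] sum_power2_ge_zero[of "fst ?p + 1" "snd ?p"]
      unfolding near2_def far2_def by linarith+
    have r1: "near2 (- fst p, snd p) = far2 p" "far2 (- fst p, snd p) = near2 p"
      "near2 (fst p, - snd p) = near2 p" "far2 (fst p, - snd p) = far2 p" for p
      by (simp_all add: near2_def far2_def power2_eq_square algebra_simps)
    note rf = ring_force_reflect[OF pos] ring_force_reflect(2)[of "(- fst ?p, snd ?p)", unfolded r1, OF pos(2,1)]
    show "ring_force lam (\<rho> t) = (sgn_x k * fst (ring_force lam ?p), sgn_z k * snd (ring_force lam ?p))"
      using rf sgn_cases[of k] unfolding rho by auto
    show "plane_point \<phi>' (\<rho> t) \<notin> unit_circle"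
      using sgn_cases[of k] nz r1[of ?p] r1[of "(- fst ?p, snd ?p)"]
      unfolding plane_point_in_unit_circle_iff rho by auto
  qed
  have dR: "(R has_vector_derivative plane_point \<phi> (U t, W t)) (at t)" for t
  proof (rule derivative_from_pieces[OF \<tau>, where v="\<lambda>t. plane_point \<phi> (U t, W t)"])
    fix k t assume t: "t \<in> ?I k"
    have "(X has_real_derivative U t) (at t within ?I k)"
      unfolding X_def pU[OF t] by (rule mirror_extension_deriv[OF \<tau> t dx jx])
    moreover have "(Z has_real_derivative W t) (at t within ?I k)"
      using mirror_extension_deriv[OF \<tau> t dz jz] unfolding Z_def pW[OF t] sz2 .
    ultimately show "(R has_vector_derivative plane_point \<phi> (U t, W t)) (at t within ?I k)"
      unfolding R_def \<rho>_def o_def by (rule plane_point_curve_deriv)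
  qed
  have dV: "((\<lambda>t. plane_point \<phi> (U t, W t)) has_vector_derivative plane_point \<phi> (ring_force lam (\<rho> t))) (at t)" for t
  proof (rule derivative_from_pieces[OF \<tau>, where v="\<lambda>t. plane_point \<phi> (ring_force lam (\<rho> t))"])
    fix k t assume t: "t \<in> ?I k"
    let ?p = "(x (fold_time \<tau> k t), z (fold_time \<tau> k t))"
    have "(U has_real_derivative sgn_x k * fst (ring_force lam ?p)) (at t within ?I k)"
      using mirror_extension_deriv[where s="\<lambda>k. sgn_x k * sgn_z k", OF \<tau> t du ju] unfolding U_def by (simp add: mult.assoc sz2)
    moreover have "(W has_real_derivative sgn_z k * snd (ring_force lam ?p)) (at t within ?I k)"
      using mirror_extension_deriv[where s="\<lambda>_. 1", OF \<tau> t dw jw] unfolding W_def by simp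
    ultimately show "((\<lambda>t. plane_point \<phi> (U t, W t)) has_vector_derivative plane_point \<phi> (ring_force lam (\<rho> t))) (at t within ?I k)"
      unfolding force[OF t] by (rule plane_point_curve_deriv)
  qed
  have in_piece: "\<exists>k. t \<in> ?I k" for t
  proof -
    have "of_int \<lfloor>t / \<tau>\<rfloor> \<le> t / \<tau>" "t / \<tau> \<le> of_int (\<lfloor>t / \<tau>\<rfloor> + 1)" by linarith+
    then have "t \<in> ?I \<lfloor>t / \<tau>\<rfloor>"
      unfolding pos_le_divide_eq[OF \<tau>] pos_divide_le_eq[OF \<tau>] by simp
    then show ?thesis ..
  qed
  have orbit: "circle_orbit lam UNIV R"
    unfolding circle_orbit_def
  proof (intro conjI exI[of _ "\<lambda>t. plane_point \<phi> (U t, W t)"] ballI)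
    fix t
    have off_t: "plane_point \<phi> (\<rho> t) \<notin> unit_circle" using in_piece[of t] off_R by blast
    then show "R t \<notin> unit_circle" by (simp add: R_def)
    show "(R has_vector_derivative plane_point \<phi> (U t, W t)) (at t within UNIV)" by (rule dR)
    show "\<exists>g. GDERIV (circle_potential lam) (R t) :> g \<and>
        ((\<lambda>t. plane_point \<phi> (U t, W t)) has_vector_derivative - g) (at t within UNIV)"
      using circle_potential_gradient_plane[OF off_t, of lam] dV[of t]
      by (intro exI[of _ "- plane_point \<phi> (ring_force lam (\<rho> t))"]) (simp add: R_def)
  qed
  have essential: "essential_part lam \<phi> \<tau> (\<lambda>t. (x t, z t))"
    unfolding essential_part_def circle_orbit_def
  proof (intro conjI exI[of _ "\<lambda>t. plane_point \<phi> (u t, w t)"] ballI)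
    fix t assume t: "t \<in> {0..\<tau>}"
    show "(plane_point \<phi> \<circ> (\<lambda>t. (x t, z t))) t \<notin> unit_circle" using off[OF t] by simp
    show "(plane_point \<phi> \<circ> (\<lambda>t. (x t, z t)) has_vector_derivative plane_point \<phi> (u t, w t)) (at t within {0..\<tau>})"
      unfolding o_def by (rule plane_point_curve_deriv[OF dx[OF t] dz[OF t]])
    show "\<exists>g. GDERIV (circle_potential lam) ((plane_point \<phi> \<circ> (\<lambda>t. (x t, z t))) t) :> g \<and>
        ((\<lambda>t. plane_point \<phi> (u t, w t)) has_vector_derivative - g) (at t within {0..\<tau>})"
      using circle_potential_gradient_plane[OF off[OF t], of lam] plane_point_curve_deriv[OF du[OF t] dw[OF t], of \<phi>]
      by (intro exI[of _ "- plane_point \<phi> (ring_force lam (x t, z t))"]) simp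
  next
    show "((\<lambda>t. fst (x t, z t)) has_real_derivative 0) (at 0 within {0..\<tau>})"
      using dx[of 0] start \<tau> by simp
  qed (use \<tau> start stop z_pos in auto)
  have extension: "figure_eight_extension \<tau> (\<lambda>t. (x t, z t)) \<rho>"
    unfolding figure_eight_extension_def
  proof (intro allI conjI ballI)
    fix n :: int and t
    assume "t \<in> {4 * of_int n * \<tau>..(4 * of_int n + 1) * \<tau>}"
    then have t: "t \<in> ?I (4 * n)" by (simp add: algebra_simps)
    show "\<rho> t = (x (t - 4 * of_int n * \<tau>), z (t - 4 * of_int n * \<tau>))"
      unfolding \<rho>_def pX[OF t] pZ[OF t] by (simp add: sgn_x_def sgn_z_def fold_time_def)
  next
    fix n :: int and t
    assume "t \<in> {(4 * of_int n + 1) * \<tau>..(4 * of_int n + 2) * \<tau>}"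
    then have t: "t \<in> ?I (4 * n + 1)" by (simp add: algebra_simps)
    have m: "(4 * n + 1) mod 4 = 1" by presburger
    show "\<rho> t = refl1 (refl2 (x ((4 * of_int n + 2) * \<tau> - t), z ((4 * of_int n + 2) * \<tau> - t)))"
      unfolding \<rho>_def pX[OF t] pZ[OF t] by (simp add: sgn_x_def sgn_z_def fold_time_def refl1_def refl2_def m add.commute)
  next
    fix n :: int and t
    assume "t \<in> {(4 * of_int n + 2) * \<tau>..(4 * of_int n + 3) * \<tau>}"
    then have t: "t \<in> ?I (4 * n + 2)" by (simp add: algebra_simps)
    have m: "(4 * n + 2) mod 4 = 2" by presburger
    show "\<rho> t = refl1 (x (t - (4 * of_int n + 2) * \<tau>), z (t - (4 * of_int n + 2) * \<tau>))"
      unfolding \<rho>_def pX[OF t] pZ[OF t] by (simp add: sgn_x_def sgn_z_def fold_time_def refl1_def m add.commute)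
  next
    fix n :: int and t
    assume "t \<in> {(4 * of_int n - 1) * \<tau>..4 * of_int n * \<tau>}"
    then have t: "t \<in> ?I (4 * n - 1)" by (simp add: algebra_simps)
    have m: "(4 * n - 1) mod 4 = 3" by presburger
    show "\<rho> t = refl2 (x (4 * of_int n * \<tau> - t), z (4 * of_int n * \<tau> - t))"
      unfolding \<rho>_def pX[OF t] pZ[OF t] by (simp add: sgn_x_def sgn_z_def fold_time_def refl2_def m add.commute)
  qed
  have periodic: "R (t + 4 * \<tau>) = R t" for t
  proof -
    have "\<lfloor>(t + 4 * \<tau>) / \<tau>\<rfloor> = \<lfloor>t / \<tau>\<rfloor> + 4" using \<tau> by (simp add: add_divide_distrib)
    moreover have "fold_time \<tau> (k + 4) (t + 4 * \<tau>) = fold_time \<tau> k t" for k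
      by (simp add: fold_time_def algebra_simps)
    moreover have "sgn_x (k + 4) = sgn_x k" "sgn_z (k + 4) = sgn_z k" for k
      by (simp_all add: sgn_x_def sgn_z_def)
    ultimately show ?thesis by (simp add: R_def \<rho>_def X_def Z_def mirror_extension_def)
  qed
  show thesis
  proof (rule that[of R])
    show "symmetric_figure_eight lam \<Lambda> \<phi> \<tau> (\<lambda>t. (x t, z t)) R"
      unfolding symmetric_figure_eight_def
      using \<Lambda> essential extension orbit periodic R_def by blast
    have "R 0 = plane_point \<phi> (x 0, 0)"
      using start by (simp add: R_def \<rho>_def X_def Z_def mirror_extension_def fold_time_def sgn_x_def sgn_z_def)
    then show "plane_point \<phi> (x 0, 0) \<in> range R" by (metis rangeI)
    fix a assume a: "a > 0" "plane_point \<phi> (a, 0) \<in> range R"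
    then obtain t where "plane_point \<phi> (a, 0) = plane_point \<phi> (\<rho> t)" by (auto simp: R_def)
    then have rho: "X t = a" "Z t = 0" using injD[OF inj_plane_point] by (fastforce simp: \<rho>_def)+
    obtain k where k: "t \<in> ?I k" using in_piece by blast
    let ?s = "fold_time \<tau> k t"
    have s: "0 \<le> ?s" "?s \<le> \<tau>" using fold_time_bounds[OF k] by auto
    have "z ?s = 0" using rho(2) pZ[OF k] sgn_cases(2)[of k] by auto
    then have "?s = 0 \<or> ?s = \<tau>" using z_pos[of ?s] s by force
    moreover have "sgn_x k * x ?s = a" using rho(1) pX[OF k] by simp
    ultimately show "a = x 0" using a(1) stop start sgn_cases(1)[of k] by auto
  qed
qed

lemma embedded_arc_plane_curve:
  assumes \<Lambda>: "range (plane_point \<phi>) = \<Lambda>"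
    and dx: "\<And>t. t \<in> {0..\<tau>} \<Longrightarrow> (x has_real_derivative u t) (at t within {0..\<tau>})"
    and dz: "\<And>t. t \<in> {0..\<tau>} \<Longrightarrow> (z has_real_derivative w t) (at t within {0..\<tau>})"
    and cont: "continuous_on {0..\<tau>} u" "continuous_on {0..\<tau>} w"
    and inj: "inj_on (\<lambda>t. (x t, z t)) {0..\<tau>}"
    and nz: "\<And>t. t \<in> {0..\<tau>} \<Longrightarrow> u t \<noteq> 0 \<or> w t \<noteq> 0"
  shows "embedded_arc \<Lambda> \<tau> (plane_point \<phi> \<circ> (\<lambda>t. (x t, z t)))"
  unfolding embedded_arc_def
proof (intro conjI exI[of _ "\<lambda>t. plane_point \<phi> (u t, w t)"] ballI)
  have cx: "continuous_on {0..\<tau>} x" "continuous_on {0..\<tau>} z"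
    unfolding continuous_on_eq_continuous_within by (auto intro: DERIV_continuous[OF dx] DERIV_continuous[OF dz])
  have pp: "continuous_on S (plane_point \<phi>)" for S
    using bounded_linear_plane_point by (rule linear_continuous_on)
  show "embedding_map (top_of_set {0..\<tau>}) (top_of_set \<Lambda>) (plane_point \<phi> \<circ> (\<lambda>t. (x t, z t)))"
  proof (rule continuous_imp_embedding_map)
    have "continuous_on {0..\<tau>} (plane_point \<phi> \<circ> (\<lambda>t. (x t, z t)))"
      by (intro continuous_on_compose continuous_on_Pair cx pp)
    then show "continuous_map (top_of_set {0..\<tau>}) (top_of_set \<Lambda>) (plane_point \<phi> \<circ> (\<lambda>t. (x t, z t)))"
      using \<Lambda> by (auto simp: continuous_map_in_subtopology)
    show "inj_on (plane_point \<phi> \<circ> (\<lambda>t. (x t, z t))) (topspace (top_of_set {0..\<tau>}))"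
      using inj inj_plane_point by (auto intro!: comp_inj_on inj_on_subset[OF inj_plane_point])
  qed (auto simp: compact_space_subtopology Hausdorff_space_subtopology)
  show "continuous_on {0..\<tau>} (\<lambda>t. plane_point \<phi> (u t, w t))"
    by (intro continuous_on_compose2[OF pp[of UNIV]] continuous_on_Pair cont) auto
  fix t assume t: "t \<in> {0..\<tau>}"
  show "(plane_point \<phi> \<circ> (\<lambda>t. (x t, z t)) has_vector_derivative plane_point \<phi> (u t, w t)) (at t within {0..\<tau>})"
    unfolding o_def by (rule plane_point_curve_deriv[OF dx[OF t] dz[OF t]])
  show "plane_point \<phi> (u t, w t) \<noteq> 0"
  proof
    assume "plane_point \<phi> (u t, w t) = 0"
    then have "plane_point \<phi> (u t, w t) = plane_point \<phi> (0, 0)"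
      by (simp add: vec3_eq_iff)
    then show False using injD[OF inj_plane_point] nz[OF t] by blast
  qed
qed

theorem theoremB:
  fixes lam :: real and \<Lambda> :: "(real^3) set"
  assumes "lam > 0"
    and "vertical_plane \<Lambda>"
  shows "infinite {range R | R.
           \<exists>\<phi> \<tau> r. symmetric_figure_eight lam \<Lambda> \<phi> \<tau> r R \<and>
                     embedded_arc \<Lambda> \<tau> (plane_point \<phi> \<circ> r)}"
proof -
  obtain \<phi> where \<phi>: "range (plane_point \<phi>) = \<Lambda>" using vertical_plane_eq_range[OF assms(2)] .
  define good where "good R \<longleftrightarrow> (\<exists>\<phi> \<tau> r. symmetric_figure_eight lam \<Lambda> \<phi> \<tau> r R \<and>
                     embedded_arc \<Lambda> \<tau> (plane_point \<phi> \<circ> r))" for R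
  have "\<exists>R. good R \<and> plane_point \<phi> (x0, 0) \<in> range R \<and>
      (\<forall>a>0. plane_point \<phi> (a, 0) \<in> range R \<longrightarrow> a = x0)" if x0: "x0 \<ge> 300" for x0
  proof -
    obtain \<tau> x z u w where *: "\<tau> > 0" "x 0 = x0" "z 0 = 0" "u 0 = 0" "x \<tau> = 0" "z \<tau> = 0"
      "\<And>t. 0 < t \<Longrightarrow> t < \<tau> \<Longrightarrow> z t > 0"
      "\<And>t. t \<in> {0..\<tau>} \<Longrightarrow> (x has_real_derivative u t) (at t within {0..\<tau>})"
      "\<And>t. t \<in> {0..\<tau>} \<Longrightarrow> (z has_real_derivative w t) (at t within {0..\<tau>})"
      "\<And>t. t \<in> {0..\<tau>} \<Longrightarrow> (u has_real_derivative fst (ring_force lam (x t, z t))) (at t within {0..\<tau>})"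
      "\<And>t. t \<in> {0..\<tau>} \<Longrightarrow> (w has_real_derivative snd (ring_force lam (x t, z t))) (at t within {0..\<tau>})"
      "\<And>t \<phi>. t \<in> {0..\<tau>} \<Longrightarrow> plane_point \<phi> (x t, z t) \<notin> unit_circle"
      "inj_on (\<lambda>t. (x t, z t)) {0..\<tau>}"
      "\<And>t. t \<in> {0..\<tau>} \<Longrightarrow> u t \<noteq> 0 \<or> w t \<noteq> 0"
      using exists_shot_to_center[OF assms(1) x0] by blast
    have "x 0 > 1" using x0 *(2) by simp
    from symmetric_figure_eight_from_arc[OF \<phi> *(1) this *(3-12)]
    obtain R where R: "symmetric_figure_eight lam \<Lambda> \<phi> \<tau> (\<lambda>t. (x t, z t)) R"
      "plane_point \<phi> (x 0, 0) \<in> range R"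
      "\<And>a. a > 0 \<Longrightarrow> plane_point \<phi> (a, 0) \<in> range R \<Longrightarrow> a = x 0" by blast
    have "continuous_on {0..\<tau>} u" "continuous_on {0..\<tau>} w"
      unfolding continuous_on_eq_continuous_within
      by (auto intro: DERIV_continuous[OF *(10)] DERIV_continuous[OF *(11)])
    then have "embedded_arc \<Lambda> \<tau> (plane_point \<phi> \<circ> (\<lambda>t. (x t, z t)))"
      by (intro embedded_arc_plane_curve[OF \<phi> *(8,9) _ _ *(13,14)])
    then have "good R" unfolding good_def using R(1) by blast
    then show ?thesis using R(2,3) *(2) by blast
  qed
  then obtain F where F: "\<And>x0. x0 \<ge> 300 \<Longrightarrow> good (F x0)" 
    "\<And>x0. x0 \<ge> 300 \<Longrightarrow> plane_point \<phi> (x0, 0) \<in> range (F x0)"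
    "\<And>x0 a. x0 \<ge> 300 \<Longrightarrow> a > 0 \<Longrightarrow> plane_point \<phi> (a, 0) \<in> range (F x0) \<Longrightarrow> a = x0" by metis
  have "inj_on (\<lambda>x0. range (F x0)) {300..}"
  proof (rule inj_onI)
    fix a b :: real assume ab: "a \<in> {300..}" "b \<in> {300..}" "range (F a) = range (F b)"
    then show "a = b" using F(2)[of a] F(3)[of b a] by simp
  qed
  then have "infinite ((\<lambda>x0. range (F x0)) ` {300..})"
    by (simp add: finite_image_iff infinite_Ici)
  moreover have "(\<lambda>x0. range (F x0)) ` {300..} \<subseteq> {range R | R. good R}" using F(1) by auto
  ultimately show ?thesis unfolding good_def using infinite_super by blast
qed

end
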